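(* For every $A\subset\overline\Omega$, $$\mathrm{Cap}_{p,\Omega}(A)=\inf\{\|u\|^p_{W^{1,p}(\Omega)}: u\in\tilde W^{1,p}(\Omega),\ \tilde u\ge1 \ \mathrm{Cap}_{p,\Omega}\text{-quasi everywhere on } A\}.$$
   Context: Throughout, $\Omega\subset\mathbb{R}^N$ is a nonempty open set and $p\in(1,\infty)$. $W^{1,p}(\Omega)$ is the usual Sobolev space with norm $\|u\|^p_{W^{1,p}(\Omega)}=\int_\Omega |u|^p+|\nabla u|^p\,dx$; $\tilde W^{1,p}(\Omega)$ is the closure in $W^{1,p}(\Omega)$ of $\{u|_\Omega: u\in C_c(\overline\Omega),\ u|_\Omega\in W^{1,p}(\Omega)\}$; for $A\subset\overline\Omega$, $\mathcal{Y}_{p,\Omega}(A)=\{u\in\tilde W^{1,p}(\Omega):\ \exists\, O \text{ open in } \overline\Omega \text{ (relative topology) with } A\subset O,\ u\ge 1 \text{ a.e. on } O\cap\Omega\}$ and $\mathrm{Cap}_{p,\Omega}(A)=\inf\{\|u\|^p_{W^{1,p}(\Omega)}: u\in\mathcal{Y}_{p,\Omega}(A)\}$ ($\inf\emptyset=\infty$). A set $P\subset\overline\Omega$ is $\mathrm{Cap}_{p,\Omega}$-polar if $\mathrm{Cap}_{p,\Omega}(P)=0$; "quasi everywhere" means outside a polar set. A function $f$ on $D\subset\overline\Omega$ is $\mathrm{Cap}_{p,\Omega}$-quasi continuous if for every $\varepsilon>0$ there is $V$ open in $\overline\Omega$ with $\mathrm{Cap}_{p,\Omega}(V)<\varepsilon$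 and $f|_{D\setminus V}$ continuous. For $u\in\tilde W^{1,p}(\Omega)$, $\tilde u:\overline\Omega\to\mathbb{R}$ denotes a $\mathrm{Cap}_{p,\Omega}$-quasi continuous function equal to $u$ a.e. on $\Omega$; such a function exists and is unique up to a polar set. *)

theory Defs
  imports "HOL-Analysis.Analysis"
begin

fun iter_pd :: "'a::euclidean_space list \<Rightarrow> ('a \<Rightarrow> real) \<Rightarrow> ('a \<Rightarrow> real)" where
  "iter_pd [] f = f"
| "iter_pd (v # vs) f = (\<lambda>x. frechet_derivative (iter_pd vs f) (at x) v)"

definition smooth_fun :: "('a::euclidean_space \<Rightarrow> real) \<Rightarrow> bool" where
  "smooth_fun f \<longleftrightarrow> (\<forall>vs x. iter_pd vs f differentiable (at x))"

definition test_fun :: "'a::euclidean_space set \<Rightarrow> ('a \<Rightarrow> real) \<Rightarrow> bool" where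
  "test_fun \<Omega> \<phi> \<longleftrightarrow> smooth_fun \<phi> \<and> compact (closure {x. \<phi> x \<noteq> 0})
      \<and> closure {x. \<phi> x \<noteq> 0} \<subseteq> \<Omega>"

text \<open>L^p(Omega) membership (functions, values outside Omega irrelevant).\<close>
definition Lp_fun :: "real \<Rightarrow> 'a::euclidean_space set \<Rightarrow> ('a \<Rightarrow> real) \<Rightarrow> bool" where
  "Lp_fun p \<Omega> u \<longleftrightarrow> u \<in> borel_measurable (lebesgue_on \<Omega>)
      \<and> integrable (lebesgue_on \<Omega>) (\<lambda>x. \<bar>u x\<bar> powr p)"

definition weak_gradient :: "real \<Rightarrow> 'a::euclidean_space set \<Rightarrow> ('a \<Rightarrow> real) \<Rightarrow> ('a \<Rightarrow> 'a) \<Rightarrow> bool" where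
  "weak_gradient p \<Omega> u g \<longleftrightarrow>
     (\<forall>b\<in>Basis. Lp_fun p \<Omega> (\<lambda>x. g x \<bullet> b) \<and>
        (\<forall>\<phi>. test_fun \<Omega> \<phi> \<longrightarrow>
           integral\<^sup>L (lebesgue_on \<Omega>) (\<lambda>x. u x * frechet_derivative \<phi> (at x) b)
           = - integral\<^sup>L (lebesgue_on \<Omega>) (\<lambda>x. (g x \<bullet> b) * \<phi> x)))"

definition W1p :: "real \<Rightarrow> 'a::euclidean_space set \<Rightarrow> ('a \<Rightarrow> real) set" where
  "W1p p \<Omega> = {u. Lp_fun p \<Omega> u \<and> (\<exists>g. weak_gradient p \<Omega> u g)}"

definition wgrad :: "real \<Rightarrow> 'a::euclidean_space set \<Rightarrow> ('a \<Rightarrow> real) \<Rightarrow> ('a \<Rightarrow> 'a)" where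
  "wgrad p \<Omega> u = (SOME g. weak_gradient p \<Omega> u g)"

definition W1p_norm_p :: "real \<Rightarrow> 'a::euclidean_space set \<Rightarrow> ('a \<Rightarrow> real) \<Rightarrow> real" where
  "W1p_norm_p p \<Omega> u = integral\<^sup>L (lebesgue_on \<Omega>)
      (\<lambda>x. \<bar>u x\<bar> powr p + norm (wgrad p \<Omega> u x) powr p)"

definition Cc_W1p :: "real \<Rightarrow> 'a::euclidean_space set \<Rightarrow> ('a \<Rightarrow> real) set" where
  "Cc_W1p p \<Omega> = {u \<in> W1p p \<Omega>. \<exists>v. continuous_on (closure \<Omega>) v
       \<and> compact (closure {x \<in> closure \<Omega>. v x \<noteq> 0})
       \<and> (\<forall>x\<in>\<Omega>. u x = v x)}"

definition W1p_tilde :: "real \<Rightarrow> 'a::euclidean_space set \<Rightarrow> ('a \<Rightarrow> real) set" where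
  "W1p_tilde p \<Omega> = {u \<in> W1p p \<Omega>. \<exists>f. (\<forall>n. f n \<in> Cc_W1p p \<Omega>)
       \<and> (\<lambda>n. W1p_norm_p p \<Omega> (\<lambda>x. f n x - u x)) \<longlonglongrightarrow> 0}"

definition Yset :: "real \<Rightarrow> 'a::euclidean_space set \<Rightarrow> 'a set \<Rightarrow> ('a \<Rightarrow> real) set" where
  "Yset p \<Omega> A = {u \<in> W1p_tilde p \<Omega>. \<exists>U. openin (top_of_set (closure \<Omega>)) U \<and> A \<subseteq> U
       \<and> (AE x in lebesgue. x \<in> U \<inter> \<Omega> \<longrightarrow> u x \<ge> 1)}"

text \<open>Relative capacity; values in [0,infinity], Inf of the empty set is infinity.\<close>
definition Cap :: "real \<Rightarrow> 'a::euclidean_space set \<Rightarrow> 'a set \<Rightarrow> ennreal" where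
  "Cap p \<Omega> A = (INF u\<in>Yset p \<Omega> A. ennreal (W1p_norm_p p \<Omega> u))"

definition quasi_continuous :: "real \<Rightarrow> 'a::euclidean_space set \<Rightarrow> 'a set \<Rightarrow> ('a \<Rightarrow> real) \<Rightarrow> bool" where
  "quasi_continuous p \<Omega> D f \<longleftrightarrow> (\<forall>\<epsilon>>0. \<exists>V. openin (top_of_set (closure \<Omega>)) V
       \<and> Cap p \<Omega> V < ennreal \<epsilon> \<and> continuous_on (D - V) f)"

definition qc_rep :: "real \<Rightarrow> 'a::euclidean_space set \<Rightarrow> ('a \<Rightarrow> real) \<Rightarrow> ('a \<Rightarrow> real) \<Rightarrow> bool" where
  "qc_rep p \<Omega> u ut \<longleftrightarrow> quasi_continuous p \<Omega> (closure \<Omega>) ut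
       \<and> (AE x in lebesgue_on \<Omega>. ut x = u x)"

end

theory Submission
  imports Defs
begin

text \<open>
  If \<open>u \<ge> 1\<close> a.e. on a relatively open \<open>U\<close> and \<open>ut\<close> is a quasi continuous version of \<open>u\<close>, then
  off an open set \<open>V\<close> of small capacity the set \<open>{ut < 1} \<inter> U\<close> is relatively open and null, so an
  admissible function for \<open>V\<close> is also admissible for \<open>V\<close> together with that set. Hence
  \<open>{ut < 1} \<inter> U\<close> is polar, and every competitor for the capacity is a competitor on the right.
  Conversely, if \<open>ut \<ge> 1\<close> quasi everywhere on \<open>A\<close>, a function slightly larger than \<open>\<bar>u\<bar>\<close> plus
  nonnegative functions of small norm, which are at least 1 near the exceptional sets, is admissible
  for \<open>A\<close>.

  Only smooth truncations \<open>sqrt (t\<^sup>2 + d\<^sup>2) - d\<close> are used instead of \<open>\<bar>t\<bar>\<close>, so the chain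
  rule for C1 functions with derivative bounded by 1 suffices. It follows from the convergence in L1
  of the difference quotients of \<open>u\<close> to its weak derivative. The triangle inequality in Lp is
  replaced by \<open>(a + b)\<^sup>p \<le> l\<^sup>-\<^sup>p a\<^sup>p + (1 - l)\<^sup>-\<^sup>p b\<^sup>p\<close> for \<open>0 < l < 1\<close>, which
  loses nothing when \<open>b\<close> is small and \<open>l\<close> tends to 1.
\<close>

section \<open>Smooth bump functions\<close>

text \<open>The right-hand side asks for some quasi continuous version of each competitor, so
  existence of such versions has to be proved; they arise as limits of continuous approximants off
  open sets of small capacity. The norm is evaluated at a gradient picked by \<open>SOME\<close>, so
  it can be computed only once weak gradients are known to be unique. Hence explicit bump functions
  and the fundamental lemma come before any Sobolev estimate. The absolute value is avoided because
  its derivative jumps at 0, while stability of \<open>W1p_tilde\<close> under composition is proved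
  with a continuous \<open>F'\<close>. The set where \<open>ut\<close> is at least 1 has no open
  neighbourhood on which this persists; relaxing 1 to \<open>1 - s\<close> supplies one, off a small
  set, and rescaling compensates the loss as \<open>s\<close> tends to 0. Completeness of the
  Sobolev space and countable subadditivity of the capacity are both replaced by
  \<open>tilde_suminf\<close>: if the norms decay fast enough, a single Lp function dominates all
  partial sums and their gradients, and every limit is a dominated one.\<close>

definition flat_exp :: "nat \<Rightarrow> real \<Rightarrow> real" where
  "flat_exp k t = (if t > 0 then inverse t ^ k * exp (- inverse t) else 0)"

lemma flat_exp_tendsto_0: "(flat_exp k \<longlongrightarrow> 0) (at_right 0)"
proof -
  have "((\<lambda>x::real. x ^ k / exp x) \<longlongrightarrow> 0) at_top"
    by (rule tendsto_power_div_exp_0)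
  then have "((\<lambda>t. inverse t ^ k / exp (inverse t)) \<longlongrightarrow> 0) (at_right (0::real))"
    using filterlim_compose filterlim_inverse_at_top_right by blast
  then show ?thesis
    by (rule Lim_transform_eventually)
       (auto simp: flat_exp_def eventually_at_filter exp_minus divide_inverse)
qed

text \<open>The powers of \<open>inverse t\<close> are part of the definition so that this family,
  which contains the classical flat function \<open>exp (- inverse t)\<close>, is closed under
  differentiation up to linear combinations. At the origin the right difference quotient of
  \<open>flat_exp k\<close> is \<open>flat_exp (Suc k)\<close>, which tends to 0.\<close>

lemma flat_exp_has_derivative:
  "(flat_exp k has_real_derivative (flat_exp (k + 2) t - real k * flat_exp (k + 1) t)) (at t)"
proof (cases t "0::real" rule: linorder_cases)
  case less
  have "((\<lambda>_. 0) has_real_derivative 0) (at t)" by simp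
  then have "(flat_exp k has_real_derivative 0) (at t)"
    by (rule DERIV_cong_ev[THEN iffD1, rotated -1])
       (use less in \<open>auto simp: flat_exp_def intro!: eventually_mono[OF eventually_nhds_in_open[of "{..<0}"]]\<close>)
  then show ?thesis using less by (simp add: flat_exp_def)
next
  case greater
  have "((\<lambda>t. inverse t ^ k * exp (- inverse t)) has_real_derivative
      (flat_exp (k + 2) t - real k * flat_exp (k + 1) t)) (at t)"
  \<comment> \<open>The power rule yields the truncated exponent \<open>k - Suc 0\<close>, so
    \<open>k = 0\<close> is treated apart.\<close>
  proof (cases k)
    case (Suc m)
    have "((\<lambda>t. inverse t ^ k * exp (- inverse t)) has_real_derivative
      real k * inverse t ^ (k - Suc 0) * (- (inverse t ^ 2)) * exp (- inverse t)
        + exp (- inverse t) * inverse t ^ 2 * inverse t ^ k) (at t)"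
      using greater by (auto intro!: derivative_eq_intros simp: power2_eq_square)
    then show ?thesis
      by (rule DERIV_cong) (use greater in \<open>simp add: Suc flat_exp_def algebra_simps power2_eq_square\<close>)
  qed (use greater in \<open>auto intro!: derivative_eq_intros simp: flat_exp_def field_simps power2_eq_square\<close>)
  then show ?thesis
    by (rule DERIV_cong_ev[THEN iffD1, rotated -1])
       (use greater in \<open>auto simp: flat_exp_def intro!: eventually_mono[OF eventually_nhds_in_open[of "{0<..}"]]\<close>)
next
  case equal
  have "((\<lambda>h. (flat_exp k h - flat_exp k 0) / (h - 0)) \<longlongrightarrow> 0) (at 0)"
  proof (rule filterlim_split_at)
    have "eventually (\<lambda>h. 0 = (flat_exp k h - flat_exp k 0) / (h - 0)) (at_left 0)"
      by (auto simp: flat_exp_def eventually_at_filter)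
    then show "((\<lambda>h. (flat_exp k h - flat_exp k 0) / (h - 0)) \<longlongrightarrow> 0) (at_left 0)"
      by (rule Lim_transform_eventually[rotated]) simp
    have "eventually (\<lambda>h. flat_exp (Suc k) h = (flat_exp k h - flat_exp k 0) / (h - 0)) (at_right 0)"
      by (auto simp: flat_exp_def eventually_at_filter field_simps)
    then show "((\<lambda>h. (flat_exp k h - flat_exp k 0) / (h - 0)) \<longlongrightarrow> 0) (at_right 0)"
      by (rule Lim_transform_eventually[rotated]) (rule flat_exp_tendsto_0)
  qed
  then show ?thesis using equal by (simp add: has_field_derivative_iff flat_exp_def)
qed

text \<open>A class of functions closed under directional derivatives consists of smooth functions.\<close>

inductive elem_smooth :: "('a::euclidean_space \<Rightarrow> real) \<Rightarrow> bool" where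
  const: "elem_smooth (\<lambda>_. c)"
| gen: "elem_smooth (\<lambda>x. flat_exp k (x \<bullet> w - a))"
| add: "elem_smooth f \<Longrightarrow> elem_smooth g \<Longrightarrow> elem_smooth (\<lambda>x. f x + g x)"
| mult: "elem_smooth f \<Longrightarrow> elem_smooth g \<Longrightarrow> elem_smooth (\<lambda>x. f x * g x)"

lemma elem_smooth_has_derivative:
  assumes "elem_smooth f"
  shows "\<exists>f'. (\<forall>x. (f has_derivative f' x) (at x)) \<and> (\<forall>v. elem_smooth (\<lambda>x. f' x v))"
  using assms
proof induction
  case (const c)
  show ?case
    by (rule exI[of _ "\<lambda>x v. 0"]) (auto intro: elem_smooth.const)
next
  case (gen k w a)
  let ?f' = "\<lambda>x v. (v \<bullet> w) * (flat_exp (k + 2) (x \<bullet> w - a) + (- real k) * flat_exp (k + 1) (x \<bullet> w - a))"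
  have "((\<lambda>x. flat_exp k (x \<bullet> w - a)) has_derivative ?f' x) (at x)" for x
    by (rule has_derivative_eq_rhs[OF has_derivative_compose[OF _
          flat_exp_has_derivative[unfolded has_field_derivative_def]]])
       (auto intro!: derivative_eq_intros simp: algebra_simps)
  moreover have "elem_smooth (\<lambda>x. ?f' x v)" for v
    by (intro elem_smooth.intros)
  ultimately show ?case by (intro exI[of _ ?f']) blast
next
  case (add f g)
  then obtain f' g' where f': "\<And>x. (f has_derivative f' x) (at x)" "\<And>v. elem_smooth (\<lambda>x. f' x v)"
    and g': "\<And>x. (g has_derivative g' x) (at x)" "\<And>v. elem_smooth (\<lambda>x. g' x v)" by blast
  show ?case
    by (rule exI[of _ "\<lambda>x v. f' x v + g' x v"]) (auto intro!: has_derivative_add f' g' elem_smooth.add)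
next
  case (mult f g)
  then obtain f' g' where f': "\<And>x. (f has_derivative f' x) (at x)" "\<And>v. elem_smooth (\<lambda>x. f' x v)"
    and g': "\<And>x. (g has_derivative g' x) (at x)" "\<And>v. elem_smooth (\<lambda>x. g' x v)" by blast
  show ?case
    by (rule exI[of _ "\<lambda>x v. f x * g' x v + f' x v * g x"])
       (auto intro!: has_derivative_mult f' g' elem_smooth.add elem_smooth.mult mult)
qed

lemma elem_smooth_smooth_fun:
  assumes "elem_smooth f"
  shows "smooth_fun f"
proof -
  have "elem_smooth (iter_pd vs f)" for vs
  proof (induction vs)
    case (Cons v vs)
    then obtain f' where f': "\<And>x. (iter_pd vs f has_derivative f' x) (at x)"
      "\<And>v. elem_smooth (\<lambda>x. f' x v)" using elem_smooth_has_derivative by blast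
    then have "frechet_derivative (iter_pd vs f) (at x) = f' x" for x
      by (metis frechet_derivative_at)
    with f' show ?case by simp
  qed (simp add: assms)
  then show ?thesis
    unfolding smooth_fun_def using elem_smooth_has_derivative differentiable_def by blast
qed

lemma elem_smooth_prod:
  "finite I \<Longrightarrow> (\<And>i. i \<in> I \<Longrightarrow> elem_smooth (f i)) \<Longrightarrow> elem_smooth (\<lambda>x. \<Prod>i\<in>I. f i x)"
  by (induction I rule: finite_induct) (auto intro: elem_smooth.intros)

lemma elem_smooth_power: "elem_smooth f \<Longrightarrow> elem_smooth (\<lambda>x. f x ^ n)"
  by (induction n) (auto intro: elem_smooth.intros)

definition box_bump :: "'a::euclidean_space \<Rightarrow> 'a \<Rightarrow> 'a \<Rightarrow> real" where
  "box_bump a c x = (\<Prod>b\<in>Basis. flat_exp 0 (x \<bullet> b - a \<bullet> b) * flat_exp 0 (c \<bullet> b - x \<bullet> b))"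

lemma elem_smooth_box_bump: "elem_smooth (box_bump a c)"
proof -
  have "elem_smooth (\<lambda>x. flat_exp 0 (c \<bullet> b - x \<bullet> b))" for b :: 'a
    using elem_smooth.gen[of 0 "-b" "- (c \<bullet> b)"] by simp
  then show ?thesis unfolding box_bump_def
    by (intro elem_smooth_prod elem_smooth.mult elem_smooth.gen) auto
qed

lemma flat_exp_0_bounds: "0 \<le> flat_exp 0 t" "flat_exp 0 t < 1" "0 < flat_exp 0 t \<longleftrightarrow> 0 < t"
  by (auto simp: flat_exp_def)

lemma box_bump_pos: "x \<in> box a c \<Longrightarrow> 0 < box_bump a c x"
  unfolding box_bump_def by (intro prod_pos mult_pos_pos) (auto simp: flat_exp_0_bounds mem_box)

lemma box_bump_eq_0: "x \<notin> box a c \<Longrightarrow> box_bump a c x = 0"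
  by (force simp: box_bump_def mem_box flat_exp_def prod_zero_iff)

lemma box_bump_bounds: "0 \<le> box_bump a c x" "box_bump a c x < 1"
proof -
  have *: "0 \<le> flat_exp 0 s * flat_exp 0 t \<and> flat_exp 0 s * flat_exp 0 t < 1" for s t
    using mult_strict_mono'[OF flat_exp_0_bounds(2)[of s] flat_exp_0_bounds(2)[of t]]
    by (auto simp: flat_exp_0_bounds)
  show "0 \<le> box_bump a c x" unfolding box_bump_def by (intro prod_nonneg) (auto simp: *)
  \<comment> \<open>Strictness has to come from one factor, since the remaining product is only
    bounded by 1; the basis is nonempty, so a factor can be split off.\<close>
  obtain b :: 'a where b: "b \<in> Basis" using nonempty_Basis by blast
  let ?f = "\<lambda>b. flat_exp 0 (x \<bullet> b - a \<bullet> b) * flat_exp 0 (c \<bullet> b - x \<bullet> b)"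
  have "box_bump a c x = ?f b * (\<Prod>b\<in>Basis - {b}. ?f b)"
    unfolding box_bump_def using b by (simp add: prod.remove)
  also have "\<dots> \<le> ?f b * 1"
    using * by (intro mult_left_mono prod_le_1) (auto simp: less_imp_le)
  also have "\<dots> < 1" using * by simp
  finally show "box_bump a c x < 1" .
qed

text \<open>Powers of \<open>1 - box_bump\<close> tend to 0 inside the box and are constantly 1 outside.\<close>

definition box_approx :: "nat \<Rightarrow> 'a::euclidean_space \<Rightarrow> 'a \<Rightarrow> 'a \<Rightarrow> real" where
  "box_approx n a c x = 1 - (1 - box_bump a c x) ^ n"

lemma box_approx_tendsto: "(\<lambda>n. box_approx n a c x) \<longlonglongrightarrow> indicator (box a c) x"
proof (cases "x \<in> box a c")
  case True
  then have "norm (1 - box_bump a c x) < 1"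
    using box_bump_pos[OF True] box_bump_bounds[of a c x] by (auto simp: abs_less_iff)
  then have "(\<lambda>n. (1 - box_bump a c x) ^ n) \<longlonglongrightarrow> 0"
    by (rule LIMSEQ_power_zero)
  then have "(\<lambda>n. box_approx n a c x) \<longlonglongrightarrow> 1 - 0"
    unfolding box_approx_def by (rule tendsto_diff[OF tendsto_const])
  with True show ?thesis by simp
qed (simp add: box_approx_def box_bump_eq_0)

lemma box_approx_bound: "\<bar>box_approx n a c x\<bar> \<le> 1"
  using box_bump_bounds[of a c x] by (auto simp: box_approx_def abs_le_iff power_le_one)

lemma box_approx_eq_0: "x \<notin> box a c \<Longrightarrow> box_approx n a c x = 0"
  by (simp add: box_approx_def box_bump_eq_0)

lemma test_fun_box_approx:
  assumes "cbox a c \<subseteq> \<Omega>"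
  shows "test_fun \<Omega> (box_approx n a c)"
proof -
  have "elem_smooth (\<lambda>x. 1 + (-1) * (1 + (-1) * box_bump a c x) ^ n)"
    by (intro elem_smooth.add elem_smooth.mult elem_smooth.const elem_smooth_power elem_smooth_box_bump)
  then have "smooth_fun (box_approx n a c)"
    using elem_smooth_smooth_fun by (simp add: box_approx_def[abs_def])
  moreover have sub: "closure {x. box_approx n a c x \<noteq> 0} \<subseteq> cbox a c"
    using box_subset_cbox box_approx_eq_0 by (intro closure_minimal[OF _ closed_cbox]) blast
  moreover have "compact (closure {x. box_approx n a c x \<noteq> 0})"
    using sub compact_cbox bounded_subset compact_eq_bounded_closed by blast
  ultimately show ?thesis using assms by (auto simp: test_fun_def)
qed

section \<open>The fundamental lemma of the calculus of variations\<close>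

text \<open>Open boxes are an intersection-stable generator of the Borel sets, and the sets over
  which \<open>f\<close> integrates to 0 form a Dynkin system; \<open>UNIV0\<close> serves its
  complement step. Testing with the sets where \<open>f\<close> is positive and where it is negative
  finishes.\<close>

lemma AE_eq_0_if_box_integrals_0:
  fixes f :: "'a::euclidean_space \<Rightarrow> real"
  assumes int: "integrable lborel f" and UNIV0: "integral\<^sup>L lborel f = 0"
    and box0: "\<And>a c. (\<integral>x. indicator (box a c) x * f x \<partial>lborel) = 0"
  shows "AE x in lborel. f x = 0"
proof -
  have intA: "integrable lborel (\<lambda>x. indicator A x * f x)" if "A \<in> sets borel" for A
    using integrable_mult_indicator[OF _ int, of A] that by simp
  have zero: "(\<integral>x. indicator A x * f x \<partial>lborel) = 0" if "A \<in> sets borel" for A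
  proof -
    let ?G = "range (\<lambda>(a, b). box a b :: 'a set)"
    have "Int_stable ?G"
      unfolding Int_stable_def by (auto simp: box_Int_box)
    moreover have "?G \<subseteq> Pow UNIV" by simp
    moreover have "A \<in> sigma_sets UNIV ?G"
      using that borel_eq_box by (metis Pow_UNIV sets_measure_of top_greatest)
    ultimately show ?thesis
    proof (induction rule: sigma_sets_induct_disjoint)
      case (basic A)
      then show ?case using box0 by auto
    next
      case empty
      then show ?case by simp
    next
      case (compl A)
      have A: "A \<in> sets borel" using compl(1) borel_eq_box by (metis Pow_UNIV sets_measure_of top_greatest)
      have "(\<integral>x. indicator (UNIV - A) x * f x \<partial>lborel) = (\<integral>x. f x - indicator A x * f x \<partial>lborel)"
        by (intro Bochner_Integration.integral_cong) (auto simp: indicator_def)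
      then show ?case using compl(2) int intA[OF A] UNIV0 by simp
    next
      case (union A)
      have A: "A i \<in> sets borel" for i
        using union(2) borel_eq_box by (metis Pow_UNIV range_subsetD sets_measure_of top_greatest)
      have "set_lebesgue_integral lborel (\<Union>i. A i) f = (\<Sum>i. set_lebesgue_integral lborel (A i) f)"
      proof (rule lebesgue_integral_countable_add)
        show "set_integrable lborel (\<Union> (range A)) f"
          unfolding set_integrable_def using A int by (intro integrable_mult_indicator) auto
      qed (use A union(1) in \<open>auto simp: disjoint_family_on_def\<close>)
      then show ?case using union(3) by (simp add: set_lebesgue_integral_def)
    qed
  qed
  have meas[measurable]: "f \<in> borel_measurable borel" using int by auto
  have "AE x in lborel. indicator {x. f x > 0} x * f x = 0"
    by (rule integral_nonneg_eq_0_iff_AE[THEN iffD1, OF intA _ zero]) (auto simp: indicator_def)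
  moreover have "AE x in lborel. - (indicator {x. f x < 0} x * f x) = 0"
  proof (rule integral_nonneg_eq_0_iff_AE[THEN iffD1])
    have A: "{x. f x < 0} \<in> sets borel" by measurable
    show "integrable lborel (\<lambda>x. - (indicator {x. f x < 0} x * f x))"
      using intA[OF A] by simp
    show "(\<integral>x. - (indicator {x. f x < 0} x * f x) \<partial>lborel) = 0"
      using zero[OF A] by simp
  qed (auto simp: indicator_def)
  ultimately show ?thesis
    by eventually_elim (auto simp: indicator_def split: if_splits)
qed

text \<open>Sobolev functions are only Lebesgue measurable, while Fubini and translation invariance
  are applied to Borel functions over \<open>lborel\<close>; this is the bridge.\<close>

lemma integrable_lebesgue_borel_rep:
  fixes f :: "'a::euclidean_space \<Rightarrow> real"
  assumes "integrable lebesgue f"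
  obtains f' where "f' \<in> borel_measurable borel" "integrable lborel f'" "AE x in lebesgue. f x = f' x"
proof -
  obtain f' where f': "f' \<in> borel_measurable lborel" "AE x in lborel. f x = f' x"
    using completion_ex_borel_measurable_real[of f lborel] assms by auto
  then have ae: "AE x in lebesgue. f x = f' x" by (simp add: AE_completion)
  have "f' \<in> borel_measurable lebesgue" using f'(1) by (simp add: measurable_completion)
  then have "integrable lebesgue f'" using ae by (rule integrable_cong_AE_imp[OF assms])
  then have "integrable lborel f'" using f'(1) by (simp add: integrable_completion)
  with f' ae that show ?thesis by simp
qed

lemma integral_lebesgue_on_eq:
  fixes f :: "'a::euclidean_space \<Rightarrow> 'b::{banach,second_countable_topology}"
  assumes "\<Omega> \<in> sets lebesgue" "\<And>x. x \<notin> \<Omega> \<Longrightarrow> f x = 0"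
  shows "integral\<^sup>L (lebesgue_on \<Omega>) f = integral\<^sup>L lebesgue f"
  using assms by (subst integral_restrict_space) (auto simp: indicator_def intro!: Bochner_Integration.integral_cong)

text \<open>The test functions \<open>box_approx n\<close> converge boundedly to the indicator of an
  open box, so \<open>f\<close> integrates to 0 over every open box whose closure lies in the
  domain. Inside a fixed box of this kind \<open>AE_eq_0_if_box_integrals_0\<close> applies, because
  intersections of boxes are boxes. Countably many boxes cover the domain.\<close>

lemma fundamental_lemma_calculus_of_variations:
  fixes f :: "'a::euclidean_space \<Rightarrow> real"
  assumes "open \<Omega>"
    and int: "\<And>K. compact K \<Longrightarrow> K \<subseteq> \<Omega> \<Longrightarrow> set_integrable lebesgue K f"
    and zero: "\<And>\<phi>. test_fun \<Omega> \<phi> \<Longrightarrow> integral\<^sup>L (lebesgue_on \<Omega>) (\<lambda>x. f x * \<phi> x) = 0"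
  shows "AE x in lebesgue. x \<in> \<Omega> \<longrightarrow> f x = 0"
proof -
  have box0: "(\<integral>x. indicator (box a c) x * f x \<partial>lebesgue) = 0" if sub: "cbox a c \<subseteq> \<Omega>" for a c
  proof -
    let ?h = "\<lambda>x. indicator (cbox a c) x * f x"
    have h: "integrable lebesgue ?h"
      using int[of "cbox a c"] sub by (simp add: set_integrable_def)
    have "(\<lambda>n. \<integral>x. ?h x * box_approx n a c x \<partial>lebesgue) \<longlonglongrightarrow> (\<integral>x. ?h x * indicator (box a c) x \<partial>lebesgue)"
    proof (rule integral_dominated_convergence[where w = "\<lambda>x. \<bar>?h x\<bar>"])
      have "box_approx n a c \<in> borel_measurable borel" for n
      proof -
        have "smooth_fun (box_approx n a c)" using test_fun_box_approx[OF sub] by (simp add: test_fun_def)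
        then have "\<forall>x. box_approx n a c differentiable (at x)"
          unfolding smooth_fun_def by (metis iter_pd.simps(1))
        then have "continuous_on UNIV (box_approx n a c)"
          by (simp add: differentiable_imp_continuous_within continuous_at_imp_continuous_on)
        then show ?thesis by (rule borel_measurable_continuous_onI)
      qed
      then have "box_approx n a c \<in> borel_measurable lebesgue" for n
        by (simp add: measurable_completion)
      then show "\<And>n. (\<lambda>x. ?h x * box_approx n a c x) \<in> borel_measurable lebesgue"
        by (intro borel_measurable_times[OF borel_measurable_integrable[OF h]])
      show "(\<lambda>x. ?h x * indicator (box a c) x) \<in> borel_measurable lebesgue"
        by (intro borel_measurable_times[OF borel_measurable_integrable[OF h]] borel_measurable_indicator) auto
      show "AE x in lebesgue. (\<lambda>n. ?h x * box_approx n a c x) \<longlonglongrightarrow> ?h x * indicator (box a c) x"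
        by (intro always_eventually allI tendsto_mult_left box_approx_tendsto)
      show "\<And>n. AE x in lebesgue. norm (?h x * box_approx n a c x) \<le> \<bar>?h x\<bar>"
        using box_approx_bound by (auto simp: abs_mult intro!: AE_I2 mult_left_le)
    qed (use h in auto)
    moreover have "(\<integral>x. ?h x * box_approx n a c x \<partial>lebesgue) = 0" for n
    proof -
      have out: "box_approx n a c x = 0" if "x \<notin> cbox a c" for x
        using that box_approx_eq_0 box_subset_cbox by blast
      have "0 = integral\<^sup>L (lebesgue_on \<Omega>) (\<lambda>x. f x * box_approx n a c x)"
        using zero test_fun_box_approx[OF sub] by simp
      also have "\<dots> = integral\<^sup>L lebesgue (\<lambda>x. f x * box_approx n a c x)"
        using \<open>open \<Omega>\<close> sub out by (intro integral_lebesgue_on_eq) auto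
      also have "\<dots> = (\<integral>x. ?h x * box_approx n a c x \<partial>lebesgue)"
        using out by (intro Bochner_Integration.integral_cong) (auto simp: indicator_def)
      finally show ?thesis by simp
    qed
    ultimately have "(\<integral>x. ?h x * indicator (box a c) x \<partial>lebesgue) = 0"
      by (simp add: LIMSEQ_const_iff)
    moreover have "?h x * indicator (box a c) x = indicator (box a c) x * f x" for x
      using box_subset_cbox[of a c] by (auto simp: indicator_def)
    ultimately show ?thesis by simp
  qed
  have loc: "AE x in lebesgue. x \<in> box a c \<longrightarrow> f x = 0" if sub: "cbox a c \<subseteq> \<Omega>" for a c
  proof -
    let ?h = "\<lambda>x. indicator (box a c) x * f x"
    have "integrable lebesgue (\<lambda>x. indicator (box a c) x *\<^sub>R (indicator (cbox a c) x * f x))"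
      using int[of "cbox a c"] sub by (intro integrable_mult_indicator) (auto simp: set_integrable_def)
    also have "(\<lambda>x. indicator (box a c) x *\<^sub>R (indicator (cbox a c) x * f x)) = ?h"
      using box_subset_cbox[of a c] by (auto simp: indicator_def fun_eq_iff)
    finally have h: "integrable lebesgue ?h" .
    then obtain h' where h': "h' \<in> borel_measurable borel" "integrable lborel h'" "AE x in lebesgue. ?h x = h' x"
      by (rule integrable_lebesgue_borel_rep)
    have eq: "(\<integral>x. indicator A x * h' x \<partial>lborel) = (\<integral>x. indicator A x * ?h x \<partial>lebesgue)"
      if [measurable]: "A \<in> sets borel" for A
    proof -
      have "(\<integral>x. indicator A x * h' x \<partial>lborel) = (\<integral>x. indicator A x * h' x \<partial>lebesgue)"
        using h'(1) by (subst integral_completion) auto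
      also have "\<dots> = (\<integral>x. indicator A x * ?h x \<partial>lebesgue)"
      proof (rule integral_cong_AE)
        show "AE x in lebesgue. indicator A x * h' x = indicator A x * ?h x"
          using h'(3) by eventually_elim simp
        show "(\<lambda>x. indicator A x * h' x) \<in> borel_measurable lebesgue"
          using h'(1) by (intro measurable_completion) auto
        show "(\<lambda>x. indicator A x * ?h x) \<in> borel_measurable lebesgue"
          by (intro borel_measurable_times[OF _ borel_measurable_integrable[OF h]] borel_measurable_indicator sets_completionI_sets) (simp add: that)
      qed
      finally show ?thesis .
    qed
    have "AE x in lborel. h' x = 0"
    proof (rule AE_eq_0_if_box_integrals_0[OF h'(2)])
      show "integral\<^sup>L lborel h' = 0"
        using eq[of UNIV] box0[OF sub] by simp
      fix a' c' :: 'a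
      obtain a'' c'' where i: "box a' c' \<inter> box a c = box a'' c''" "cbox a' c' \<inter> cbox a c = cbox a'' c''"
        by (rule that[OF box_Int_box Int_interval])
      have "(\<integral>x. indicator (box a' c') x * h' x \<partial>lborel) = (\<integral>x. indicator (box a'' c'') x * f x \<partial>lebesgue)"
        using i(1) by (subst eq) (auto intro!: Bochner_Integration.integral_cong simp: indicator_def set_eq_iff)
      then show "(\<integral>x. indicator (box a' c') x * h' x \<partial>lborel) = 0"
        using box0[of a'' c''] i(2) sub by auto
    qed
    then have "AE x in lebesgue. h' x = 0" by (simp add: AE_completion)
    with h'(3) show ?thesis by eventually_elim (auto simp: indicator_def split: if_splits)
  qed
  \<comment> \<open>The countable cover taken below consists of closed boxes; their faces are
    null.\<close>
  have locc: "AE x in lebesgue. x \<in> cbox a c \<longrightarrow> f x = 0" if sub: "cbox a c \<subseteq> \<Omega>" for a c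
  proof -
    have "AE x in lebesgue. x \<notin> cbox a c - box a c"
      using negligible_frontier_interval[of a c] by (intro AE_not_in) (simp add: negligible_iff_null_sets)
    with loc[OF sub] show ?thesis by eventually_elim blast
  qed
  obtain D where D: "countable D" "D \<subseteq> Pow \<Omega>" "\<And>X. X \<in> D \<Longrightarrow> \<exists>a b. X = cbox a b" "\<Union>D = \<Omega>"
    using open_countable_Union_open_cbox[OF \<open>open \<Omega>\<close>] by metis
  have "AE x in lebesgue. x \<in> X \<longrightarrow> f x = 0" if "X \<in> D" for X
    using D(2,3) that locc by blast
  then have "AE x in lebesgue. \<forall>X\<in>D. x \<in> X \<longrightarrow> f x = 0"
    using D(1) by (subst AE_ball_countable) auto
  then show ?thesis by eventually_elim (use D(4) in blast)
qed

section \<open>Test functions and local integrability\<close>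

lemma test_fun_differentiable: "test_fun \<Omega> \<phi> \<Longrightarrow> \<phi> differentiable (at x)"
  unfolding test_fun_def smooth_fun_def by (metis iter_pd.simps(1))

lemma test_fun_has_derivative:
  "test_fun \<Omega> \<phi> \<Longrightarrow> (\<phi> has_derivative frechet_derivative \<phi> (at x)) (at x)"
  using test_fun_differentiable frechet_derivative_works by blast

lemma test_fun_continuous: "test_fun \<Omega> \<phi> \<Longrightarrow> continuous_on UNIV \<phi>"
  by (simp add: test_fun_differentiable differentiable_imp_continuous_within continuous_at_imp_continuous_on)

lemma test_fun_deriv_continuous:
  assumes "test_fun \<Omega> \<phi>"
  shows "continuous_on UNIV (\<lambda>x. frechet_derivative \<phi> (at x) b)"
proof -
  have "iter_pd [b] \<phi> differentiable (at x)" for x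
    using assms unfolding test_fun_def smooth_fun_def by blast
  then have "\<forall>x. (\<lambda>x. frechet_derivative \<phi> (at x) b) differentiable (at x)"
    by simp
  then show ?thesis
    by (simp add: differentiable_imp_continuous_within continuous_at_imp_continuous_on)
qed

lemma eq_0_outside_support: "x \<notin> closure {x. \<phi> x \<noteq> 0} \<Longrightarrow> \<phi> x = 0"
  using closure_subset[of "{x. \<phi> x \<noteq> 0}"] by auto

lemma derivative_eq_0_outside_support:
  assumes "x \<notin> closure {x. \<phi> x \<noteq> 0}"
  shows "frechet_derivative \<phi> (at x) b = 0"
proof -
  have "((\<lambda>_. 0) has_derivative (\<lambda>_. 0)) (at x)" by simp
  moreover have "open (- closure {x. \<phi> x \<noteq> 0})" by auto
  moreover have "x \<in> - closure {x. \<phi> x \<noteq> 0}" using assms by simp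
  moreover have "0 = \<phi> y" if "y \<in> - closure {x. \<phi> x \<noteq> 0}" for y
    using eq_0_outside_support[of y \<phi>] that by simp
  ultimately have "(\<phi> has_derivative (\<lambda>_. 0)) (at x)"
    by (rule has_derivative_transform_within_open)
  then show ?thesis by (metis frechet_derivative_at)
qed

lemma bounded_if_compact_support:
  fixes f :: "'a::euclidean_space \<Rightarrow> real"
  assumes "continuous_on UNIV f" "compact K" "\<And>x. x \<notin> K \<Longrightarrow> f x = 0"
  obtains B where "B > 0" "\<And>x. \<bar>f x\<bar> \<le> B"
proof -
  have "bounded (f ` K)"
    by (rule compact_imp_bounded, rule compact_continuous_image[OF continuous_on_subset[OF assms(1)] assms(2)]) simp
  then obtain B where B: "B > 0" "\<And>x. x \<in> K \<Longrightarrow> norm (f x) \<le> B"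
    by (auto simp: bounded_pos)
  have "\<bar>f x\<bar> \<le> B" for x
    using B assms(3)[of x] by (cases "x \<in> K") auto
  then show ?thesis using that[of B] B(1) by simp
qed

lemma test_fun_bounded:
  assumes "test_fun \<Omega> \<phi>"
  obtains B where "B > 0" "\<And>x. \<bar>\<phi> x\<bar> \<le> B"
proof -
  have *: "compact (closure {x. \<phi> x \<noteq> 0})" using assms by (simp add: test_fun_def)
  show ?thesis
    by (rule bounded_if_compact_support[OF test_fun_continuous[OF assms] * eq_0_outside_support[of _ \<phi>]]) (assumption, rule that)
qed

lemma test_fun_deriv_bounded:
  assumes "test_fun \<Omega> \<phi>"
  obtains B where "B > 0" "\<And>x. \<bar>frechet_derivative \<phi> (at x) b\<bar> \<le> B"
proof -
  have *: "compact (closure {x. \<phi> x \<noteq> 0})" using assms by (simp add: test_fun_def)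
  show ?thesis
    by (rule bounded_if_compact_support[OF test_fun_deriv_continuous[OF assms] * derivative_eq_0_outside_support[of _ \<phi> b]]) (assumption, rule that)
qed

lemma frechet_derivative_shift:
  fixes f :: "'a::euclidean_space \<Rightarrow> real"
  assumes "f differentiable (at (x - v))"
  shows "((\<lambda>x. f (x - v)) has_derivative frechet_derivative f (at (x - v))) (at x)"
    and "frechet_derivative (\<lambda>x. f (x - v)) (at x) = frechet_derivative f (at (x - v))"
proof -
  show d: "((\<lambda>x. f (x - v)) has_derivative frechet_derivative f (at (x - v))) (at x)"
  proof -
    have "((\<lambda>x. x - v) has_derivative (\<lambda>x. x)) (at x)"
      by (auto intro!: derivative_eq_intros)
    moreover have "(f has_derivative frechet_derivative f (at (x - v))) (at (x - v))"
      using assms by (simp only: frechet_derivative_works)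
    ultimately show ?thesis by (rule has_derivative_compose)
  qed
  then show "frechet_derivative (\<lambda>x. f (x - v)) (at x) = frechet_derivative f (at (x - v))"
    by (metis frechet_derivative_at)
qed

lemma smooth_fun_shift:
  assumes "smooth_fun f"
  shows "smooth_fun (\<lambda>x. f (x - v))"
proof -
  have d: "iter_pd vs f differentiable (at x)" for vs x using assms by (auto simp: smooth_fun_def)
  have eq: "iter_pd vs (\<lambda>x. f (x - v)) = (\<lambda>x. iter_pd vs f (x - v))" for vs
    by (induction vs) (auto simp: frechet_derivative_shift(2)[OF d])
  show ?thesis unfolding smooth_fun_def eq
    by (intro allI) (rule differentiableI[OF frechet_derivative_shift(1)[OF d]])
qed

lemma closure_support_shift:
  fixes \<phi> :: "'a::euclidean_space \<Rightarrow> real"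
  shows "closure {x. \<phi> (x - v) \<noteq> 0} = (\<lambda>x. v + x) ` closure {x. \<phi> x \<noteq> 0}"
proof -
  have "{x. \<phi> (x - v) \<noteq> 0} = (\<lambda>x. v + x) ` {x. \<phi> x \<noteq> 0}"
    by (auto simp: image_iff intro!: exI[of _ "_ - v"])
  then show ?thesis by (simp add: closure_translation)
qed

lemma test_fun_shift:
  assumes "test_fun \<Omega> \<phi>" "\<And>x. x \<in> closure {x. \<phi> x \<noteq> 0} \<Longrightarrow> v + x \<in> \<Omega>'"
  shows "test_fun \<Omega>' (\<lambda>x. \<phi> (x - v))"
  using assms unfolding test_fun_def closure_support_shift
  by (auto intro: smooth_fun_shift compact_translation)

text \<open>Either \<open>a / l\<close> or \<open>b / (1 - l)\<close> bounds the convex combination \<open>a + b\<close> of the two.\<close>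

lemma powr_add_le_split:
  fixes a b l p :: real
  assumes "0 \<le> a" "0 \<le> b" "0 < l" "l < 1" "0 < p"
  shows "(a + b) powr p \<le> l powr (- p) * a powr p + (1 - l) powr (- p) * b powr p"
proof -
  define m where "m = max (a / l) (b / (1 - l))"
  have "a \<le> l * m" "b \<le> (1 - l) * m"
    using assms by (auto simp: m_def max_def field_simps)
  then have "a + b \<le> m" by (simp add: algebra_simps)
  then have "(a + b) powr p \<le> m powr p" using assms by (intro powr_mono2) auto
  also have "\<dots> \<le> (a / l) powr p + (b / (1 - l)) powr p" by (auto simp: m_def max_def)
  also have "\<dots> = l powr (- p) * a powr p + (1 - l) powr (- p) * b powr p"
    using assms by (simp add: powr_divide powr_minus_divide)
  finally show ?thesis .
qed

lemma le_one_plus_powr: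
  fixes a p :: real
  assumes "0 \<le> a" "1 \<le> p"
  shows "a \<le> 1 + a powr p"
proof (cases "a \<le> 1")
  case False
  then have "a powr 1 \<le> a powr p" using assms by (intro powr_mono) auto
  then show ?thesis using False by simp
qed (use assms in \<open>simp add: add_increasing2\<close>)

text \<open>A compact set has finite measure, and \<open>\<bar>u\<bar>\<close> is at most
  \<open>1 + \<bar>u\<bar> powr p\<close>; this elementary bound stands in for Hoelder's
  inequality.\<close>

lemma Lp_fun_set_integrable:
  assumes "Lp_fun p \<Omega> u" "1 \<le> p" "open \<Omega>" "compact K" "K \<subseteq> \<Omega>"
  shows "set_integrable lebesgue K u"
proof -
  have \<Omega>: "\<Omega> \<in> sets lebesgue" and K: "K \<in> sets lebesgue" "K \<in> sets borel"
    using borel_compact[OF assms(4)] assms(3) by auto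
  \<comment> \<open>\<open>Lp_fun\<close> says nothing about \<open>u\<close> off the domain, so
    measurability on the whole space is available only for the extension by 0.\<close>
  have m: "(\<lambda>x. if x \<in> \<Omega> then u x else 0) \<in> borel_measurable lebesgue"
    using assms(1) \<Omega> by (simp add: Lp_fun_def borel_measurable_if_D borel_measurable_if_I)
  have "integrable lebesgue (\<lambda>x. indicator \<Omega> x *\<^sub>R (\<bar>u x\<bar> powr p))"
    using assms(1) \<Omega> by (simp add: Lp_fun_def integrable_restrict_space)
  moreover have "integrable lebesgue (indicator K :: 'a \<Rightarrow> real)"
    using K assms(4) emeasure_compact_finite[of K]
    by (intro integrable_real_indicator) auto
  ultimately have "integrable lebesgue (\<lambda>x. indicator K x + indicator \<Omega> x *\<^sub>R (\<bar>u x\<bar> powr p))"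
    by (rule Bochner_Integration.integrable_add[rotated])
  moreover have "(\<lambda>x. indicator K x *\<^sub>R (if x \<in> \<Omega> then u x else 0)) \<in> borel_measurable lebesgue"
    using m K by (intro borel_measurable_scaleR borel_measurable_indicator) auto
  ultimately have "integrable lebesgue (\<lambda>x. indicator K x *\<^sub>R (if x \<in> \<Omega> then u x else 0))"
    by (rule Bochner_Integration.integrable_bound)
       (use assms(5) le_one_plus_powr[OF abs_ge_zero assms(2)] in \<open>auto simp: indicator_def\<close>)
  moreover have "(\<lambda>x. indicator K x *\<^sub>R (if x \<in> \<Omega> then u x else 0)) = (\<lambda>x. indicator K x *\<^sub>R u x)"
    using assms(5) by (auto simp: indicator_def fun_eq_iff)
  ultimately show ?thesis by (simp add: set_integrable_def)
qed

section \<open>Continuity of translations in L1\<close>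

lemma lborel_shift:
  fixes f :: "'a::euclidean_space \<Rightarrow> real"
  assumes "f \<in> borel_measurable borel"
  shows "integrable lborel (\<lambda>x. f (x + v)) \<longleftrightarrow> integrable lborel f"
    and "(\<integral>x. f (x + v) \<partial>lborel) = integral\<^sup>L lborel f"
proof -
  have "integrable (distr lborel borel ((+) v)) f \<longleftrightarrow> integrable lborel (\<lambda>x. f (v + x))"
    using assms by (subst integrable_distr_eq) auto
  then show "integrable lborel (\<lambda>x. f (x + v)) \<longleftrightarrow> integrable lborel f"
    by (simp add: lborel_distr_plus add.commute)
  have "integral\<^sup>L (distr lborel borel ((+) v)) f = (\<integral>x. f (v + x) \<partial>lborel)"
    using assms by (subst integral_distr) auto
  then show "(\<integral>x. f (x + v) \<partial>lborel) = integral\<^sup>L lborel f"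
    by (simp add: lborel_distr_plus add.commute)
qed

text \<open>The integral of a non-integrable function is 0 by convention, so the predicate has
  content only where the difference is integrable, as it is for integrable \<open>f\<close>.\<close>

definition transl_cont :: "('a::euclidean_space \<Rightarrow> real) \<Rightarrow> bool" where
  "transl_cont f \<longleftrightarrow> (\<forall>e>0. \<exists>d>0. \<forall>v. norm v < d \<longrightarrow> (\<integral>x. \<bar>f (x + v) - f x\<bar> \<partial>lborel) < e)"

lemma integrable_imp_borel_measurable: "integrable lborel f \<Longrightarrow> f \<in> borel_measurable borel"
  by (drule borel_measurable_integrable) simp

text \<open>A three-epsilon argument: by translation invariance the approximation error of the
  shifted function equals that of the unshifted one, so it is small uniformly in
  \<open>v\<close>.\<close>

lemma transl_cont_approx:
  fixes f :: "'a::euclidean_space \<Rightarrow> real"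
  assumes f: "integrable lborel f"
    and approx: "\<And>e. e > 0 \<Longrightarrow> \<exists>g. integrable lborel g \<and> transl_cont g \<and> (\<integral>x. \<bar>f x - g x\<bar> \<partial>lborel) < e"
  shows "transl_cont f"
  unfolding transl_cont_def
proof (intro allI impI)
  fix e :: real assume "e > 0"
  then obtain g where g: "integrable lborel g" "transl_cont g" "(\<integral>x. \<bar>f x - g x\<bar> \<partial>lborel) < e / 3"
    using approx[of "e/3"] by auto
  obtain d where d: "d > 0" "\<And>v. norm v < d \<Longrightarrow> (\<integral>x. \<bar>g (x + v) - g x\<bar> \<partial>lborel) < e / 3"
    using g(2) \<open>e > 0\<close> unfolding transl_cont_def by (metis zero_less_divide_iff zero_less_numeral)
  note [measurable] = integrable_imp_borel_measurable[OF f] integrable_imp_borel_measurable[OF g(1)]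
  have "(\<integral>x. \<bar>f (x + v) - f x\<bar> \<partial>lborel) < e" if v: "norm v < d" for v
  proof -
    have s: "integrable lborel (\<lambda>x. f (x + v))" "integrable lborel (\<lambda>x. g (x + v))"
      using f g(1) by (simp_all add: lborel_shift)
    have "(\<integral>x. \<bar>f (x + v) - f x\<bar> \<partial>lborel) \<le>
      (\<integral>x. \<bar>f (x + v) - g (x + v)\<bar> + \<bar>g (x + v) - g x\<bar> + \<bar>f x - g x\<bar> \<partial>lborel)"
      using f g(1) s by (intro integral_mono) auto
    also have "\<dots> = (\<integral>x. \<bar>f (x + v) - g (x + v)\<bar> \<partial>lborel) + (\<integral>x. \<bar>g (x + v) - g x\<bar> \<partial>lborel)
        + (\<integral>x. \<bar>f x - g x\<bar> \<partial>lborel)"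
      using f g(1) s by simp
    also have "(\<integral>x. \<bar>f (x + v) - g (x + v)\<bar> \<partial>lborel) = (\<integral>x. \<bar>f x - g x\<bar> \<partial>lborel)"
      using lborel_shift(2)[of "\<lambda>x. \<bar>f x - g x\<bar>" v] by simp
    finally show ?thesis using g(3) d(2)[OF v] by linarith
  qed
  with d(1) show "\<exists>d>0. \<forall>v. norm v < d \<longrightarrow> (\<integral>x. \<bar>f (x + v) - f x\<bar> \<partial>lborel) < e" by blast
qed

text \<open>The bound by \<open>2 * \<bar>f x\<bar>\<close> is the one provided by the limit case of
  \<open>integrable_induct\<close>; it makes dominated convergence available.\<close>

lemma transl_cont_lim:
  fixes f :: "'a::euclidean_space \<Rightarrow> real"
  assumes s: "\<And>i. integrable lborel (s i)" "\<And>i. transl_cont (s i)"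
    and lim: "\<And>x. (\<lambda>i. s i x) \<longlonglongrightarrow> f x" and bnd: "\<And>i x. \<bar>s i x\<bar> \<le> 2 * \<bar>f x\<bar>"
    and f: "integrable lborel f"
  shows "transl_cont f"
proof (rule transl_cont_approx[OF f])
  fix e :: real assume "e > 0"
  have "(\<lambda>i. \<integral>x. \<bar>f x - s i x\<bar> \<partial>lborel) \<longlonglongrightarrow> (\<integral>x. 0 \<partial>(lborel::'a measure))"
  proof (rule integral_dominated_convergence[where w = "\<lambda>x. 3 * \<bar>f x\<bar>"])
    show "AE x in lborel. (\<lambda>i. \<bar>f x - s i x\<bar>) \<longlonglongrightarrow> 0"
    proof (rule AE_I2)
      fix x :: 'a
      show "(\<lambda>i. \<bar>f x - s i x\<bar>) \<longlonglongrightarrow> 0"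
        using tendsto_rabs[OF tendsto_diff[OF tendsto_const[of "f x"] lim[of x]]] by simp
    qed
    have "\<bar>f x - s i x\<bar> \<le> 3 * \<bar>f x\<bar>" for i x using bnd[of i x] by linarith
    then show "AE x in lborel. norm \<bar>f x - s i x\<bar> \<le> 3 * \<bar>f x\<bar>" for i by simp
  qed (use f s in auto)
  then have "eventually (\<lambda>i. (\<integral>x. \<bar>f x - s i x\<bar> \<partial>lborel) < e) sequentially"
    using \<open>e > 0\<close> by (auto dest: order_tendstoD)
  then show "\<exists>g. integrable lborel g \<and> transl_cont g \<and> (\<integral>x. \<bar>f x - g x\<bar> \<partial>lborel) < e"
    using s by (auto simp: eventually_sequentially)
qed

text \<open>Squeeze \<open>A\<close> between a compact \<open>T\<close> and an open \<open>U\<close>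
  with \<open>U - T\<close> of small measure. Shifts shorter than the distance from \<open>T\<close>
  to the complement of \<open>U\<close> can change the indicator at \<open>x\<close> only if
  \<open>x\<close> or \<open>x + v\<close> lies in \<open>U - T\<close>.\<close>

lemma transl_cont_indicator_bounded:
  fixes A :: "'a::euclidean_space set"
  assumes A: "A \<in> sets borel" "bounded A"
  shows "transl_cont (\<lambda>x. indicator A x * c)"
  unfolding transl_cont_def
proof (intro allI impI)
  fix e :: real assume "e > 0"
  \<comment> \<open>Both \<open>U - A\<close> and \<open>A - T\<close> have measure below
    \<open>h\<close>, and \<open>S\<close> enters twice, which costs
    \<open>4 * h * \<bar>c\<bar>\<close>; the added 1 covers \<open>c = 0\<close>.\<close>
  define h where "h = e / (4 * (\<bar>c\<bar> + 1))"
  have "h > 0" using \<open>e > 0\<close> by (simp add: h_def)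
  have A': "A \<in> sets lebesgue" using A by simp
  obtain T where T: "closed T" "T \<subseteq> A" "A - T \<in> lmeasurable" "emeasure lebesgue (A - T) < ennreal h"
    using sets_lebesgue_inner_closed[OF A' \<open>h > 0\<close>] by metis
  obtain U where U: "open U" "A \<subseteq> U" "U - A \<in> lmeasurable" "emeasure lebesgue (U - A) < ennreal h"
    using sets_lebesgue_outer_open[OF A' \<open>h > 0\<close>] by metis
  have "compact T" using T(1,2) A(2) bounded_subset compact_eq_bounded_closed by blast
  moreover have "closed (- U)" "T \<inter> - U = {}" using U T by auto
  ultimately obtain d where d: "d > 0" "\<And>x y. x \<in> T \<Longrightarrow> y \<in> - U \<Longrightarrow> d \<le> dist x y"
    using separate_compact_closed by metis
  define S where "S = U - T"
  have S[measurable]: "S \<in> sets borel" using U(1) T(1) by (simp add: S_def)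
  have Seq: "S = (U - A) \<union> (A - T)" using U(2) T(2) by (auto simp: S_def)
  have "emeasure lborel S = emeasure lebesgue S" using S by simp
  also have "\<dots> \<le> emeasure lebesgue (U - A) + emeasure lebesgue (A - T)"
    unfolding Seq using T(3) U(3) by (intro emeasure_subadditive) auto
  also have "\<dots> < ennreal (h + h)" by (rule add_mono_ennreal[OF U(4) T(4)])
  also have "\<dots> = ennreal (2 * h)" by simp
  finally have em: "emeasure lborel S < ennreal (2 * h)" .
  then have intS: "integrable lborel (indicator S :: 'a \<Rightarrow> real)"
    by (intro integrable_real_indicator) (auto intro: less_trans)
  have m: "measure lborel S < 2 * h"
  proof -
    have "emeasure lborel S = ennreal (measure lborel S)"
      using em by (intro emeasure_eq_ennreal_measure) auto
    with em show ?thesis by (simp add: ennreal_less_iff)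
  qed
  have "(\<integral>x. \<bar>indicator A (x + v) * c - indicator A x * c\<bar> \<partial>lborel) < e" if v: "norm v < d" for v
  proof -
    have pt: "\<bar>indicator A (x + v) * c - indicator A x * c\<bar> \<le> \<bar>c\<bar> * (indicator S x + indicator S (x + v))" for x
    proof -
      have "x + v \<in> U" if "x \<in> T" using d(2)[OF that, of "x + v"] v by (auto simp: dist_norm)
      moreover have "x \<in> U" if "x + v \<in> T" using d(2)[OF that, of x] v by (auto simp: dist_norm)
      ultimately show ?thesis using T(2) U(2) by (auto simp: indicator_def S_def)
    qed
    have intS': "integrable lborel (\<lambda>x. indicator S (x + v) :: real)"
      using lborel_shift(1)[of "indicator S"] intS by simp
    have "(\<integral>x. \<bar>indicator A (x + v) * c - indicator A x * c\<bar> \<partial>lborel)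
        \<le> (\<integral>x. \<bar>c\<bar> * (indicator S x + indicator S (x + v)) \<partial>lborel)"
    proof (rule integral_mono_AE')
      show "integrable lborel (\<lambda>x. \<bar>c\<bar> * (indicator S x + indicator S (x + v)))"
        using intS intS' by simp
    qed (use pt in auto)
    also have "\<dots> = \<bar>c\<bar> * (measure lborel S + measure lborel S)"
      using intS intS' lborel_shift(2)[of "indicator S" v] by simp
    also have "\<dots> \<le> \<bar>c\<bar> * (4 * h)" using m by (intro mult_left_mono) auto
    also have "\<dots> < e" using \<open>e > 0\<close> by (simp add: h_def field_simps)
    finally show ?thesis .
  qed
  with d(1) show "\<exists>d>0. \<forall>v. norm v < d \<longrightarrow> (\<integral>x. \<bar>indicator A (x + v) * c - indicator A x * c\<bar> \<partial>lborel) < e"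
    by blast
qed

lemma integrable_transl_cont:
  fixes f :: "'a::euclidean_space \<Rightarrow> real"
  assumes "integrable lborel f"
  shows "transl_cont f"
  using assms
proof (induction rule: integrable_induct)
  case (base A c)
  have A: "A \<in> sets borel" using base by simp
  show ?case
  \<comment> \<open>\<open>A\<close> has finite measure but may be unbounded, so it is first cut
    down to balls.\<close>
  proof (rule transl_cont_lim[where s = "\<lambda>n x. indicator (A \<inter> cball 0 (real n)) x * c"])
    fix i
    have "emeasure lborel (A \<inter> cball 0 (real i)) \<le> emeasure lborel A"
      using A by (intro emeasure_mono) auto
    then have "integrable lborel (indicator (A \<inter> cball 0 (real i)) :: 'a \<Rightarrow> real)"
      using base A by (intro integrable_real_indicator) (auto intro: le_less_trans)
    then show "integrable lborel (\<lambda>x. indicator (A \<inter> cball 0 (real i)) x * c)" by simp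
    show "transl_cont (\<lambda>x. indicator (A \<inter> cball 0 (real i)) x * c)"
      using A by (intro transl_cont_indicator_bounded) (auto intro: bounded_Int)
  next
    fix x :: 'a
    obtain n where "norm x \<le> real n" using real_arch_simple by blast
    then have "eventually (\<lambda>i. indicator A x *\<^sub>R c = indicator (A \<inter> cball 0 (real i)) x * c) sequentially"
      by (auto simp: eventually_sequentially indicator_def intro!: exI[of _ n])
    then show "(\<lambda>i. indicator (A \<inter> cball 0 (real i)) x * c) \<longlonglongrightarrow> indicator A x *\<^sub>R c"
      by (rule Lim_transform_eventually[rotated]) simp
  next
    show "integrable lborel (\<lambda>x. indicator A x *\<^sub>R c)"
      using base by (intro integrable_scaleR_left integrable_real_indicator) auto
  qed (auto simp: indicator_def)
next
  case (add f g)
  show ?case unfolding transl_cont_def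
  proof (intro allI impI)
    fix e :: real assume "e > 0"
    obtain d1 where d1: "d1 > 0" "\<And>v. norm v < d1 \<Longrightarrow> (\<integral>x. \<bar>f (x + v) - f x\<bar> \<partial>lborel) < e / 2"
      using add(3) \<open>e > 0\<close> unfolding transl_cont_def by (metis half_gt_zero)
    obtain d2 where d2: "d2 > 0" "\<And>v. norm v < d2 \<Longrightarrow> (\<integral>x. \<bar>g (x + v) - g x\<bar> \<partial>lborel) < e / 2"
      using add(4) \<open>e > 0\<close> unfolding transl_cont_def by (metis half_gt_zero)
    have "(\<integral>x. \<bar>f (x + v) + g (x + v) - (f x + g x)\<bar> \<partial>lborel) < e" if v: "norm v < min d1 d2" for v
    proof -
      have s: "integrable lborel (\<lambda>x. f (x + v))" "integrable lborel (\<lambda>x. g (x + v))"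
        using add(1,2) lborel_shift(1) integrable_imp_borel_measurable by blast+
      have "(\<integral>x. \<bar>f (x + v) + g (x + v) - (f x + g x)\<bar> \<partial>lborel)
        \<le> (\<integral>x. \<bar>f (x + v) - f x\<bar> + \<bar>g (x + v) - g x\<bar> \<partial>lborel)"
        using add(1,2) s by (intro integral_mono) auto
      also have "\<dots> = (\<integral>x. \<bar>f (x + v) - f x\<bar> \<partial>lborel) + (\<integral>x. \<bar>g (x + v) - g x\<bar> \<partial>lborel)"
        using add(1,2) s by simp
      finally show ?thesis using d1(2)[of v] d2(2)[of v] v by simp
    qed
    then show "\<exists>d>0. \<forall>v. norm v < d \<longrightarrow> (\<integral>x. \<bar>f (x + v) + g (x + v) - (f x + g x)\<bar> \<partial>lborel) < e"
      using d1(1) d2(1) by (intro exI[of _ "min d1 d2"]) auto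
  qed
next
  case (lim f s)
  show ?case by (rule transl_cont_lim[of s]) (use lim in auto)
qed

text \<open>Joint integrability for the Fubini steps below. The parameter \<open>c\<close> is used
  with the values 0 and 1, which covers both an unshifted factor \<open>w x\<close> and a factor
  shifted by \<open>s *\<^sub>R b\<close>; \<open>k\<close> takes the bounded factor coming from a
  test function.\<close>

lemma integrable_pair_shift:
  fixes w :: "'a::euclidean_space \<Rightarrow> real" and k :: "real \<times> 'a \<Rightarrow> real"
  assumes w: "integrable lborel w" and k[measurable]: "k \<in> borel_measurable borel"
    and B: "\<And>z. \<bar>k z\<bar> \<le> B"
  shows "integrable (lborel \<Otimes>\<^sub>M lborel) (\<lambda>(s, x). indicator {0..t} s * w (x + (c * s) *\<^sub>R b) * k (s, x))"
proof -
  have wm[measurable]: "w \<in> borel_measurable borel" using w by (rule integrable_imp_borel_measurable)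
  have kp[measurable]: "k \<in> borel_measurable (borel \<Otimes>\<^sub>M borel)" using k by (simp add: borel_prod)
  have ws: "integrable lborel (\<lambda>x. w (x + v))" for v using w by (simp add: lborel_shift)
  have B0: "0 \<le> B" using B[of undefined] by linarith
  have ksec[measurable]: "(\<lambda>x. k (s, x)) \<in> borel_measurable borel" for s by measurable
  have "integrable (lborel \<Otimes>\<^sub>M lborel) (\<lambda>(s, x). indicator {0..t} s * w (x + (c * s) *\<^sub>R b) * B)"
  proof (rule lborel_pair.Fubini_integrable)
    have "(\<integral>x. norm (case (s, x) of (s, x) \<Rightarrow> indicator {0..t} s * w (x + (c * s) *\<^sub>R b) * B) \<partial>lborel)
      = indicator {0..t} s * (B * (\<integral>x. \<bar>w x\<bar> \<partial>lborel))" for s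
      using B0 lborel_shift(2)[of "\<lambda>x. \<bar>w x\<bar>" "(c * s) *\<^sub>R b"]
      by (simp add: abs_mult mult.assoc mult.commute)
    then show "integrable lborel (\<lambda>s. \<integral>x. norm (case (s, x) of (s, x) \<Rightarrow> indicator {0..t} s * w (x + (c * s) *\<^sub>R b) * B) \<partial>lborel)"
      by (auto intro!: integrable_mult_left integrable_real_indicator simp: emeasure_lborel_Icc_eq)
  qed (use ws in \<open>auto intro!: AE_I2 integrable_mult_left\<close>)
  then show ?thesis
    by (rule Bochner_Integration.integrable_bound)
       (auto simp: abs_mult B0 split: prod.split intro!: AE_I2 mult_left_mono order_trans[OF B])
qed

section \<open>The chain rule for weak gradients\<close>

lemma test_fun_outside:
  assumes "test_fun \<Omega> \<phi>" "x \<notin> \<Omega>"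
  shows "\<phi> x = 0" "frechet_derivative \<phi> (at x) b = 0"
proof -
  have "x \<notin> closure {x. \<phi> x \<noteq> 0}" using assms unfolding test_fun_def by blast
  then show "\<phi> x = 0" "frechet_derivative \<phi> (at x) b = 0"
    by (rule eq_0_outside_support, rule derivative_eq_0_outside_support)
qed

lemma integrable_mult_bounded:
  fixes w k :: "'a::euclidean_space \<Rightarrow> real"
  assumes w: "integrable lborel w" and k: "k \<in> borel_measurable borel" "\<And>x. \<bar>k x\<bar> \<le> C"
  shows "integrable lborel (\<lambda>x. w x * k x)"
proof (rule Bochner_Integration.integrable_bound)
  show "integrable lborel (\<lambda>x. C * w x)" using w by simp
  have "0 \<le> C" using k(2)[of undefined] by linarith
  then show "AE x in lborel. norm (w x * k x) \<le> norm (C * w x)"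
    using k(2) by (auto simp: abs_mult mult.commute intro!: AE_I2 mult_right_mono)
qed (use k(1) integrable_imp_borel_measurable[OF w] in auto)

text \<open>Tested against \<open>\<phi>\<close>, the shift of \<open>u\<close> moves to
  \<open>\<phi>\<close>, where the fundamental theorem of calculus writes the difference as an
  integral of directional derivatives. Fubini, the weak identity for each shift and a shift back
  turn it into the right-hand side, and the fundamental lemma removes \<open>\<phi>\<close>. The
  weak identity is assumed for shifted test functions because \<open>u\<close> and \<open>h\<close>
  will be local representatives, valid only where these shifts are supported.\<close>

lemma difference_eq_integral_weak_derivative:
  fixes u h :: "'a::euclidean_space \<Rightarrow> real"
  assumes "open \<Omega>" and u: "integrable lborel u" and h: "integrable lborel h" and "0 \<le> t"
    and weak: "\<And>\<phi> s. test_fun \<Omega> \<phi> \<Longrightarrow> 0 \<le> s \<Longrightarrow> s \<le> t \<Longrightarrow>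
      (\<integral>y. u y * frechet_derivative \<phi> (at (y - s *\<^sub>R b)) b \<partial>lborel) = - (\<integral>y. h y * \<phi> (y - s *\<^sub>R b) \<partial>lborel)"
  shows "AE x in lborel. x \<in> \<Omega> \<longrightarrow> u (x + t *\<^sub>R b) - u x = (\<integral>s. indicator {0..t} s * h (x + s *\<^sub>R b) \<partial>lborel)"
proof -
  note [measurable] = integrable_imp_borel_measurable[OF u] integrable_imp_borel_measurable[OF h]
  define H where "H x = (\<integral>s. indicator {0..t} s * h (x + s *\<^sub>R b) \<partial>lborel)" for x
  have pH: "integrable (lborel \<Otimes>\<^sub>M lborel) (\<lambda>(s, x). indicator {0..t} s * h (x + s *\<^sub>R b))"
    using integrable_pair_shift[OF h, of "\<lambda>_. 1" 1 t 1 b] by simp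
  have H: "integrable lborel H"
    unfolding H_def using lborel_pair.integrable_snd[OF pH] by simp
  have us: "integrable lborel (\<lambda>x. u (x + t *\<^sub>R b))" using u by (simp add: lborel_shift)
  let ?f = "\<lambda>x. u (x + t *\<^sub>R b) - u x - H x"
  have f: "integrable lborel ?f" using us u H by simp
  then have fm: "?f \<in> borel_measurable borel" by (rule integrable_imp_borel_measurable)
  have fl: "integrable lebesgue ?f" using f fm by (subst integrable_completion) auto
  have "AE x in lebesgue. x \<in> \<Omega> \<longrightarrow> ?f x = 0"
  proof (rule fundamental_lemma_calculus_of_variations[OF \<open>open \<Omega>\<close>])
    fix K :: "'a set" assume "compact K"
    then have "K \<in> sets lebesgue" by (auto dest: borel_compact)
    then show "set_integrable lebesgue K ?f"
      unfolding set_integrable_def using fl by (rule integrable_mult_indicator)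
  next
    fix \<phi> assume \<phi>: "test_fun \<Omega> \<phi>"
    let ?d = "\<lambda>x. frechet_derivative \<phi> (at x) b"
    have \<phi>m[measurable]: "\<phi> \<in> borel_measurable borel" "?d \<in> borel_measurable borel"
      using test_fun_continuous[OF \<phi>] test_fun_deriv_continuous[OF \<phi>] borel_measurable_continuous_onI by auto
    obtain B where B: "\<And>x. \<bar>\<phi> x\<bar> \<le> B" using test_fun_bounded[OF \<phi>] by blast
    obtain B' where B': "\<And>x. \<bar>?d x\<bar> \<le> B'" using test_fun_deriv_bounded[OF \<phi>, of b] by blast
    note bnd_int = integrable_mult_bounded
    have \<phi>s: "(\<lambda>x. \<phi> (x - v)) \<in> borel_measurable borel" "(\<lambda>x. ?d (x - v)) \<in> borel_measurable borel" for v
      by measurable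
    have inner: "(\<integral>s. indicator {0..t} s * ?d (y - s *\<^sub>R b) \<partial>lborel) = \<phi> y - \<phi> (y - t *\<^sub>R b)" for y
    proof -
      have "(\<integral>s. indicator {0..t} s *\<^sub>R ?d (y - s *\<^sub>R b) \<partial>lborel) = - \<phi> (y - t *\<^sub>R b) - (- \<phi> (y - 0 *\<^sub>R b))"
      proof (rule integral_FTC_atLeastAtMost[OF \<open>0 \<le> t\<close>])
        fix s :: real
        have lin: "linear (frechet_derivative \<phi> (at (y - s *\<^sub>R b)))"
          using test_fun_has_derivative[OF \<phi>] has_derivative_linear by blast
        have "((\<lambda>s. y - s *\<^sub>R b) has_derivative (\<lambda>s. - (s *\<^sub>R b))) (at s within {0..t})"
          by (auto intro!: derivative_eq_intros)
        from has_derivative_compose[OF this test_fun_has_derivative[OF \<phi>]]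
        have "((\<lambda>s. \<phi> (y - s *\<^sub>R b)) has_derivative (\<lambda>r. frechet_derivative \<phi> (at (y - s *\<^sub>R b)) (- (r *\<^sub>R b)))) (at s within {0..t})" .
        from has_derivative_minus[OF this]
        show "((\<lambda>s. - \<phi> (y - s *\<^sub>R b)) has_vector_derivative ?d (y - s *\<^sub>R b)) (at s within {0..t})"
          unfolding has_vector_derivative_def by (simp add: linear_neg[OF lin] linear_cmul[OF lin])
        show "continuous_on {0..t} (\<lambda>s. ?d (y - s *\<^sub>R b))"
          by (rule continuous_on_compose2[OF test_fun_deriv_continuous[OF \<phi>]]) (auto intro!: continuous_intros)
      qed
      then show ?thesis by simp
    qed
    have k1: "(\<lambda>z. ?d (snd z - fst z *\<^sub>R b)) \<in> borel_measurable borel"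
      by (rule borel_measurable_continuous_onI, rule continuous_on_compose2[OF test_fun_deriv_continuous[OF \<phi>]])
         (auto intro!: continuous_intros)
    have k2: "(\<lambda>z::real \<times> 'a. \<phi> (snd z)) \<in> borel_measurable borel"
      by (rule borel_measurable_continuous_onI, rule continuous_on_compose2[OF test_fun_continuous[OF \<phi>]])
         (auto intro!: continuous_intros)
    have p1: "integrable (lborel \<Otimes>\<^sub>M lborel) (\<lambda>(s, y). indicator {0..t} s * u y * ?d (y - s *\<^sub>R b))"
      using integrable_pair_shift[OF u k1, of B' t 0 b] B' by simp
    have p2: "integrable (lborel \<Otimes>\<^sub>M lborel) (\<lambda>(s, x). indicator {0..t} s * h (x + s *\<^sub>R b) * \<phi> x)"
      using integrable_pair_shift[OF h k2, of B t 1 b] B by simp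
    have "(\<integral>x. (u (x + t *\<^sub>R b) - u x) * \<phi> x \<partial>lborel)
        = (\<integral>x. u (x + t *\<^sub>R b) * \<phi> x \<partial>lborel) - (\<integral>x. u x * \<phi> x \<partial>lborel)"
      using bnd_int[OF us \<phi>m(1) B] bnd_int[OF u \<phi>m(1) B] by (simp add: left_diff_distrib)
    also have "(\<integral>x. u (x + t *\<^sub>R b) * \<phi> x \<partial>lborel) = (\<integral>x. u x * \<phi> (x - t *\<^sub>R b) \<partial>lborel)"
      using lborel_shift(2)[of "\<lambda>x. u x * \<phi> (x - t *\<^sub>R b)" "t *\<^sub>R b"] by simp
    also have "(\<integral>x. u x * \<phi> (x - t *\<^sub>R b) \<partial>lborel) - (\<integral>x. u x * \<phi> x \<partial>lborel)
        = - (\<integral>x. u x * (\<phi> x - \<phi> (x - t *\<^sub>R b)) \<partial>lborel)"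
      using bnd_int[OF u \<phi>m(1) B] bnd_int[OF u \<phi>s(1) B] by (simp add: right_diff_distrib)
    also have "(\<integral>y. u y * (\<phi> y - \<phi> (y - t *\<^sub>R b)) \<partial>lborel)
        = (\<integral>y. (\<integral>s. indicator {0..t} s * u y * ?d (y - s *\<^sub>R b) \<partial>lborel) \<partial>lborel)"
      unfolding inner[symmetric] by (simp flip: integral_mult_right_zero add: mult_ac)
    also have "\<dots> = (\<integral>s. (\<integral>y. indicator {0..t} s * u y * ?d (y - s *\<^sub>R b) \<partial>lborel) \<partial>lborel)"
      using lborel_pair.Fubini_integral[OF p1] by simp
    also have "\<dots> = (\<integral>s. - (\<integral>x. indicator {0..t} s * h (x + s *\<^sub>R b) * \<phi> x \<partial>lborel) \<partial>lborel)"
    proof (intro Bochner_Integration.integral_cong refl)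
      fix s :: real
      have "(\<integral>y. u y * ?d (y - s *\<^sub>R b) \<partial>lborel) = - (\<integral>y. h y * \<phi> (y - s *\<^sub>R b) \<partial>lborel)" if "s \<in> {0..t}"
        using weak[OF \<phi>] that by simp
      also have "(\<integral>y. h y * \<phi> (y - s *\<^sub>R b) \<partial>lborel) = (\<integral>x. h (x + s *\<^sub>R b) * \<phi> x \<partial>lborel)"
        using lborel_shift(2)[of "\<lambda>x. h x * \<phi> (x - s *\<^sub>R b)" "s *\<^sub>R b"] by simp
      finally show "(\<integral>y. indicator {0..t} s * u y * ?d (y - s *\<^sub>R b) \<partial>lborel)
          = - (\<integral>x. indicator {0..t} s * h (x + s *\<^sub>R b) * \<phi> x \<partial>lborel)"
        by (cases "s \<in> {0..t}") (simp_all add: mult.assoc)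
    qed
    also have "\<dots> = - (\<integral>x. (\<integral>s. indicator {0..t} s * h (x + s *\<^sub>R b) * \<phi> x \<partial>lborel) \<partial>lborel)"
      using lborel_pair.Fubini_integral[OF p2] by simp
    also have "\<dots> = - (\<integral>x. H x * \<phi> x \<partial>lborel)"
      by (simp add: H_def)
    finally have "(\<integral>x. (u (x + t *\<^sub>R b) - u x) * \<phi> x \<partial>lborel) = (\<integral>x. H x * \<phi> x \<partial>lborel)" by simp
    then have "(\<integral>x. ?f x * \<phi> x \<partial>lborel) = 0"
      using bnd_int[OF _ \<phi>m(1) B, of "\<lambda>x. u (x + t *\<^sub>R b) - u x"] us u bnd_int[OF H \<phi>m(1) B]
      by (simp add: left_diff_distrib[of "_ - _"])
    moreover have "integral\<^sup>L (lebesgue_on \<Omega>) (\<lambda>x. ?f x * \<phi> x) = integral\<^sup>L lebesgue (\<lambda>x. ?f x * \<phi> x)"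
      using \<open>open \<Omega>\<close> by (intro integral_lebesgue_on_eq) (auto simp: test_fun_outside[OF \<phi>])
    moreover have "integral\<^sup>L lebesgue (\<lambda>x. ?f x * \<phi> x) = integral\<^sup>L lborel (\<lambda>x. ?f x * \<phi> x)"
      using fm by (intro integral_completion) auto
    ultimately show "integral\<^sup>L (lebesgue_on \<Omega>) (\<lambda>x. ?f x * \<phi> x) = 0" by simp
  qed
  then have "AE x in lborel. x \<in> \<Omega> \<longrightarrow> ?f x = 0" by (simp add: AE_completion_iff)
  then show ?thesis by eventually_elim (simp add: H_def)
qed

text \<open>On the domain the quotient minus \<open>h\<close> is the mean over \<open>s\<close> in
  \<open>{0..t n}\<close> of \<open>h (x + s *\<^sub>R b) - h x\<close>. By Fubini its L1 norm is at
  most the mean of the L1 norms of these differences, which continuity of translations makes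
  small.\<close>

lemma difference_quotient_L1_tendsto:
  fixes u h :: "'a::euclidean_space \<Rightarrow> real"
  assumes "open \<Omega>" and u: "integrable lborel u" and h: "integrable lborel h" and "0 < r"
    and weak: "\<And>\<phi> s. test_fun \<Omega> \<phi> \<Longrightarrow> 0 \<le> s \<Longrightarrow> s \<le> r \<Longrightarrow>
      (\<integral>y. u y * frechet_derivative \<phi> (at (y - s *\<^sub>R b)) b \<partial>lborel) = - (\<integral>y. h y * \<phi> (y - s *\<^sub>R b) \<partial>lborel)"
    and t: "t \<longlonglongrightarrow> 0" "\<And>n. 0 < t n" "\<And>n. t n \<le> r"
  shows "(\<lambda>n. \<integral>x. \<bar>indicator \<Omega> x * ((u (x + t n *\<^sub>R b) - u x) / t n - h x)\<bar> \<partial>lborel) \<longlonglongrightarrow> 0"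
proof (rule LIMSEQ_I)
  fix e :: real assume "e > 0"
  note [measurable] = integrable_imp_borel_measurable[OF u] integrable_imp_borel_measurable[OF h]
  have [measurable]: "\<Omega> \<in> sets borel" using \<open>open \<Omega>\<close> by simp
  obtain d where d: "d > 0" "\<And>v. norm v < d \<Longrightarrow> (\<integral>x. \<bar>h (x + v) - h x\<bar> \<partial>lborel) < e / 2"
    using integrable_transl_cont[OF h] \<open>e > 0\<close> unfolding transl_cont_def by (metis half_gt_zero)
  have "(\<lambda>n. norm (t n *\<^sub>R b)) \<longlonglongrightarrow> 0"
    using tendsto_norm[OF tendsto_scaleR[OF t(1) tendsto_const[of b]]] by simp
  then have "eventually (\<lambda>n. norm (t n *\<^sub>R b) < d) sequentially"
    using d(1) by (rule order_tendstoD)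
  then obtain N where N: "\<And>n. n \<ge> N \<Longrightarrow> norm (t n *\<^sub>R b) < d"
    by (auto simp: eventually_sequentially)
  have "norm ((\<integral>x. \<bar>indicator \<Omega> x * ((u (x + t n *\<^sub>R b) - u x) / t n - h x)\<bar> \<partial>lborel) - 0) < e" if n: "n \<ge> N" for n
  proof -
    let ?t = "t n"
    let ?q = "\<lambda>(s, x). indicator {0..?t} s * (h (x + s *\<^sub>R b) - h x)"
    have p1: "integrable (lborel \<Otimes>\<^sub>M lborel) (\<lambda>(s, x). indicator {0..?t} s * h (x + s *\<^sub>R b))"
      using integrable_pair_shift[OF h, of "\<lambda>_. 1" 1 ?t 1 b] by simp
    have p2: "integrable (lborel \<Otimes>\<^sub>M lborel) (\<lambda>(s, x). indicator {0..?t} s * h x)"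
      using integrable_pair_shift[OF h, of "\<lambda>_. 1" 1 ?t 0 b] by simp
    have q: "integrable (lborel \<Otimes>\<^sub>M lborel) ?q"
      using Bochner_Integration.integrable_diff[OF p1 p2] by (simp add: case_prod_beta' right_diff_distrib)
    have aq: "integrable (lborel \<Otimes>\<^sub>M lborel) (\<lambda>(s, x). \<bar>indicator {0..?t} s * (h (x + s *\<^sub>R b) - h x)\<bar>)"
      using integrable_abs[OF q] by (simp add: case_prod_beta')
    have id: "AE x in lborel. x \<in> \<Omega> \<longrightarrow> u (x + ?t *\<^sub>R b) - u x = (\<integral>s. indicator {0..?t} s * h (x + s *\<^sub>R b) \<partial>lborel)"
      using t(2,3)[of n] by (intro difference_eq_integral_weak_derivative[OF \<open>open \<Omega>\<close> u h] weak) auto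
    have sec: "AE x in lborel. integrable lborel (\<lambda>s. indicator {0..?t} s * h (x + s *\<^sub>R b))"
      using lborel_pair.AE_integrable_snd[OF p1] by simp
    have int1: "integrable lborel (\<lambda>x. \<integral>s. \<bar>indicator {0..?t} s * (h (x + s *\<^sub>R b) - h x)\<bar> \<partial>lborel)"
      using lborel_pair.integrable_snd[OF aq] by simp
    have indt: "integrable lborel (\<lambda>s. indicator {0..?t} s * c)" for c :: real
      by (intro integrable_mult_left integrable_real_indicator) (auto simp: emeasure_lborel_Icc_eq)
    have tt: "(\<integral>s. indicator {0..?t} s * c \<partial>lborel) = ?t * c" for c :: real
      using t(2)[of n] by (simp add: less_imp_le)
    have "(\<integral>x. \<bar>indicator \<Omega> x * ((u (x + ?t *\<^sub>R b) - u x) / ?t - h x)\<bar> \<partial>lborel)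
        \<le> (\<integral>x. (\<integral>s. \<bar>indicator {0..?t} s * (h (x + s *\<^sub>R b) - h x)\<bar> \<partial>lborel) / ?t \<partial>lborel)"
    proof (rule integral_mono_AE')
      show "AE x in lborel. \<bar>indicator \<Omega> x * ((u (x + ?t *\<^sub>R b) - u x) / ?t - h x)\<bar>
        \<le> (\<integral>s. \<bar>indicator {0..?t} s * (h (x + s *\<^sub>R b) - h x)\<bar> \<partial>lborel) / ?t"
        using id sec
      proof eventually_elim
        case (elim x)
        show ?case
        proof (cases "x \<in> \<Omega>")
          case True
          have "(\<integral>s. indicator {0..?t} s * (h (x + s *\<^sub>R b) - h x) \<partial>lborel)
            = (\<integral>s. indicator {0..?t} s * h (x + s *\<^sub>R b) \<partial>lborel) - ?t * h x"
            using elim(2) indt[of "h x"] tt[of "h x"] by (simp add: right_diff_distrib)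
          also have "\<dots> = ?t * ((u (x + ?t *\<^sub>R b) - u x) / ?t - h x)"
            using elim(1) True t(2)[of n] by (simp add: right_diff_distrib)
          finally have "?t * \<bar>(u (x + ?t *\<^sub>R b) - u x) / ?t - h x\<bar>
              = \<bar>\<integral>s. indicator {0..?t} s * (h (x + s *\<^sub>R b) - h x) \<partial>lborel\<bar>"
            using t(2)[of n] by (simp add: abs_mult)
          also have "\<dots> \<le> (\<integral>s. \<bar>indicator {0..?t} s * (h (x + s *\<^sub>R b) - h x)\<bar> \<partial>lborel)"
            by (rule integral_abs_bound)
          finally show ?thesis using t(2)[of n] True by (simp add: field_simps)
        qed (use t(2)[of n] in \<open>simp add: less_imp_le\<close>)
      qed
    qed (use int1 t(2)[of n] in \<open>auto intro!: AE_I2 divide_nonneg_pos\<close>)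
    also have "\<dots> = (\<integral>x. (\<integral>s. \<bar>indicator {0..?t} s * (h (x + s *\<^sub>R b) - h x)\<bar> \<partial>lborel) \<partial>lborel) / ?t"
      by simp
    also have "(\<integral>x. (\<integral>s. \<bar>indicator {0..?t} s * (h (x + s *\<^sub>R b) - h x)\<bar> \<partial>lborel) \<partial>lborel)
        = (\<integral>s. (\<integral>x. \<bar>indicator {0..?t} s * (h (x + s *\<^sub>R b) - h x)\<bar> \<partial>lborel) \<partial>lborel)"
      using lborel_pair.Fubini_integral[OF aq] by simp
    also have "\<dots> \<le> (\<integral>s. indicator {0..?t} s * (e / 2) \<partial>lborel)"
    proof (rule integral_mono_AE'[OF indt])
      have "(\<integral>x. \<bar>indicator {0..?t} s * (h (x + s *\<^sub>R b) - h x)\<bar> \<partial>lborel) \<le> indicator {0..?t} s * (e / 2)" for s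
      proof (cases "s \<in> {0..?t}")
        case True
        then have "norm (s *\<^sub>R b) \<le> norm (t n *\<^sub>R b)" by (auto intro: mult_right_mono)
        then have "norm (s *\<^sub>R b) < d" using N[OF n] by linarith
        from d(2)[OF this] True show ?thesis by simp
      qed simp
      then show "AE s in lborel. (\<integral>x. \<bar>indicator {0..?t} s * (h (x + s *\<^sub>R b) - h x)\<bar> \<partial>lborel) \<le> indicator {0..?t} s * (e / 2)"
        by simp
    qed (use \<open>e > 0\<close> in \<open>auto intro!: AE_I2\<close>)
    also have "\<dots> = ?t * (e / 2)" by (rule tt)
    finally have "(\<integral>x. \<bar>indicator \<Omega> x * ((u (x + ?t *\<^sub>R b) - u x) / ?t - h x)\<bar> \<partial>lborel) \<le> e / 2"
      using t(2)[of n] by (simp add: divide_right_mono)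
    then show ?thesis using \<open>e > 0\<close> by simp
  qed
  then show "\<exists>N. \<forall>n\<ge>N. norm ((\<integral>x. \<bar>indicator \<Omega> x * ((u (x + t n *\<^sub>R b) - u x) / t n - h x)\<bar> \<partial>lborel) - 0) < e"
    by blast
qed

text \<open>The value \<open>F' a\<close> at \<open>c = a\<close> makes the quotient continuous in
  \<open>c\<close> at \<open>a\<close>, and the identity \<open>diff_quot_mult\<close> holds without
  a case distinction.\<close>

definition diff_quot :: "(real \<Rightarrow> real) \<Rightarrow> (real \<Rightarrow> real) \<Rightarrow> real \<Rightarrow> real \<Rightarrow> real" where
  "diff_quot F F' a c = (if c = a then F' a else (F c - F a) / (c - a))"

lemma diff_quot_mult: "diff_quot F F' a c * (c - a) = F c - F a"
  by (simp add: diff_quot_def)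

lemma lipschitz_1_of_derivative:
  fixes F :: "real \<Rightarrow> real"
  assumes F: "\<And>x. (F has_real_derivative F' x) (at x)" "\<And>x. \<bar>F' x\<bar> \<le> 1"
  shows "\<bar>F c - F a\<bar> \<le> \<bar>c - a\<bar>"
  using field_differentiable_bound[of UNIV F F' 1 c a] F by (auto intro: DERIV_subset)

lemma diff_quot_bound:
  assumes F: "\<And>x. (F has_real_derivative F' x) (at x)" "\<And>x. \<bar>F' x\<bar> \<le> 1"
  shows "\<bar>diff_quot F F' a c\<bar> \<le> 1"
  using lipschitz_1_of_derivative[OF F, of c a] F(2) by (auto simp: diff_quot_def divide_le_eq)

lemma diff_quot_tendsto:
  assumes F: "\<And>x. (F has_real_derivative F' x) (at x)" and c: "c \<longlonglongrightarrow> a"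
  shows "(\<lambda>n. diff_quot F F' a (c n)) \<longlonglongrightarrow> F' a"
proof -
  have "((\<lambda>c. (F c - F a) / (c - a)) \<longlongrightarrow> F' a) (at a)"
    using F[of a] by (simp add: has_field_derivative_iff)
  then have "((\<lambda>c. diff_quot F F' a c) \<longlongrightarrow> F' a) (at a)"
    by (rule Lim_transform_eventually) (auto simp: diff_quot_def eventually_at_filter)
  then have "isCont (diff_quot F F' a) a" by (simp add: isCont_def diff_quot_def[of F F' a a])
  then have "(\<lambda>n. diff_quot F F' a (c n)) \<longlonglongrightarrow> diff_quot F F' a a"
    using c by (rule isCont_tendsto_compose)
  then show ?thesis by (simp add: diff_quot_def)
qed

lemma test_fun_difference_quotient:
  assumes \<phi>: "test_fun \<Omega> \<phi>" and t: "t \<longlonglongrightarrow> 0" "\<And>n. 0 < t n"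
  shows "(\<lambda>n. (\<phi> (y - t n *\<^sub>R b) - \<phi> y) / t n) \<longlonglongrightarrow> - frechet_derivative \<phi> (at y) b"
    and "(\<And>x. \<bar>frechet_derivative \<phi> (at x) b\<bar> \<le> B) \<Longrightarrow> \<bar>(\<phi> (y - t n *\<^sub>R b) - \<phi> y) / t n\<bar> \<le> B"
proof -
  have d: "((\<lambda>s. \<phi> (y - s *\<^sub>R b)) has_real_derivative - frechet_derivative \<phi> (at (y - s *\<^sub>R b)) b) (at s)" for s
  proof -
    have lin: "linear (frechet_derivative \<phi> (at (y - s *\<^sub>R b)))"
      using test_fun_has_derivative[OF \<phi>] has_derivative_linear by blast
    have "((\<lambda>s. y - s *\<^sub>R b) has_derivative (\<lambda>s. - (s *\<^sub>R b))) (at s)"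
      by (auto intro!: derivative_eq_intros)
    from has_derivative_compose[OF this test_fun_has_derivative[OF \<phi>]]
    show ?thesis unfolding has_field_derivative_def
      by (rule has_derivative_eq_rhs) (simp add: fun_eq_iff linear_neg[OF lin] linear_cmul[OF lin])
  qed
  have "((\<lambda>s. (\<phi> (y - s *\<^sub>R b) - \<phi> y) / s) \<longlongrightarrow> - frechet_derivative \<phi> (at y) b) (at 0)"
    using d[of 0] by (simp add: has_field_derivative_iff)
  then show "(\<lambda>n. (\<phi> (y - t n *\<^sub>R b) - \<phi> y) / t n) \<longlonglongrightarrow> - frechet_derivative \<phi> (at y) b"
    by (rule filterlim_compose) (use t in \<open>auto simp: filterlim_at intro!: always_eventually less_imp_neq[symmetric]\<close>)
  assume B: "\<And>x. \<bar>frechet_derivative \<phi> (at x) b\<bar> \<le> B"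
  have "\<bar>\<phi> (y - t n *\<^sub>R b) - \<phi> (y - 0 *\<^sub>R b)\<bar> \<le> B * \<bar>t n - 0\<bar>"
    using field_differentiable_bound[of UNIV "\<lambda>s. \<phi> (y - s *\<^sub>R b)" "\<lambda>s. - frechet_derivative \<phi> (at (y - s *\<^sub>R b)) b" B "t n" 0]
      d B by auto
  then show "\<bar>(\<phi> (y - t n *\<^sub>R b) - \<phi> y) / t n\<bar> \<le> B"
    using t(2)[of n] by (simp add: divide_le_eq)
qed

text \<open>A difference quotient of \<open>\<phi>\<close> is shifted onto \<open>F (u x)\<close>,
  whose increments are \<open>\<theta> n x\<close> times those of \<open>u\<close>. The factor
  \<open>\<theta> n\<close> is bounded by 1 and tends to \<open>F' (u x)\<close> almost everywhere
  on the domain along a subsequence, while the quotients of \<open>u\<close> tend to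
  \<open>h\<close> in L1. Hence \<open>u\<close> itself never has to be approximated by smooth
  functions.\<close>

lemma integral_chain_rule:
  fixes u h :: "'a::euclidean_space \<Rightarrow> real"
  assumes "open \<Omega>" and u: "integrable lborel u" and h: "integrable lborel h" and "0 < r"
    and weak: "\<And>\<phi> s. test_fun \<Omega> \<phi> \<Longrightarrow> 0 \<le> s \<Longrightarrow> s \<le> r \<Longrightarrow>
      (\<integral>y. u y * frechet_derivative \<phi> (at (y - s *\<^sub>R b)) b \<partial>lborel) = - (\<integral>y. h y * \<phi> (y - s *\<^sub>R b) \<partial>lborel)"
    and F: "\<And>x. (F has_real_derivative F' x) (at x)" "\<And>x. \<bar>F' x\<bar> \<le> 1" "F 0 = 0"
    and F'm[measurable]: "F' \<in> borel_measurable borel"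
    and \<phi>: "test_fun \<Omega> \<phi>"
  shows "(\<integral>y. F (u y) * frechet_derivative \<phi> (at y) b \<partial>lborel) = - (\<integral>y. F' (u y) * h y * \<phi> y \<partial>lborel)"
proof -
  note [measurable] = integrable_imp_borel_measurable[OF u] integrable_imp_borel_measurable[OF h]
  let ?d = "\<lambda>x. frechet_derivative \<phi> (at x) b"
  have [measurable]: "\<phi> \<in> borel_measurable borel" "?d \<in> borel_measurable borel"
    using test_fun_continuous[OF \<phi>] test_fun_deriv_continuous[OF \<phi>] borel_measurable_continuous_onI by auto
  have Fm[measurable]: "F \<in> borel_measurable borel"
    using F(1) DERIV_isCont by (intro borel_measurable_continuous_onI continuous_at_imp_continuous_on) blast
  have [measurable]: "\<Omega> \<in> sets borel" using \<open>open \<Omega>\<close> by simp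
  obtain B where B: "B > 0" "\<And>x. \<bar>\<phi> x\<bar> \<le> B" using test_fun_bounded[OF \<phi>] by blast
  obtain B' where B': "\<And>x. \<bar>?d x\<bar> \<le> B'" using test_fun_deriv_bounded[OF \<phi>, of b] by blast
  have Fu: "integrable lborel (\<lambda>x. F (u x))"
    by (rule Bochner_Integration.integrable_bound[OF u])
       (use lipschitz_1_of_derivative[OF F(1,2), of _ 0] F(3) in auto)
  have Fus: "integrable lborel (\<lambda>x. F (u (x + v)))" for v
    using lborel_shift(1)[of "\<lambda>x. F (u x)" v] Fu by simp
  define t0 where "t0 n = r / real (Suc n)" for n
  have t0: "t0 \<longlonglongrightarrow> 0" "\<And>n. 0 < t0 n" "\<And>n. t0 n \<le> r"
    using \<open>0 < r\<close> LIMSEQ_Suc[OF lim_const_over_n[of r]] unfolding t0_def[abs_def] by (auto simp: divide_le_eq)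
  \<comment> \<open>The error is measured on the domain only; elsewhere \<open>\<phi>\<close>
    vanishes.\<close>
  define E where "E n x = indicator \<Omega> x * ((u (x + t0 n *\<^sub>R b) - u x) / t0 n - h x)" for n x
  have E0: "(\<lambda>n. \<integral>x. \<bar>E n x\<bar> \<partial>lborel) \<longlonglongrightarrow> 0"
    unfolding E_def by (rule difference_quotient_L1_tendsto[OF \<open>open \<Omega>\<close> u h \<open>0 < r\<close> weak t0])
  have us: "integrable lborel (\<lambda>x. u (x + v))" for v using u by (simp add: lborel_shift)
  have Eint: "integrable lborel (E n)" for n
  proof -
    have "integrable lborel (\<lambda>x. indicator \<Omega> x *\<^sub>R ((u (x + t0 n *\<^sub>R b) - u x) / t0 n - h x))"
      using us u h by (intro integrable_mult_indicator) auto
    then show ?thesis by (simp add: E_def[abs_def])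
  qed
  note [measurable] = integrable_imp_borel_measurable[OF Eint]
  \<comment> \<open>Convergence in L1 controls the integrals; the pointwise limit of
    \<open>\<theta> n\<close> needs almost everywhere convergence, hence a subsequence.\<close>
  obtain k where k: "strict_mono k" "AE x in lborel. (\<lambda>n. E (k n) x) \<longlonglongrightarrow> 0"
    using tendsto_L1_AE_subseq[of lborel E] Eint E0 by auto
  define t where "t n = t0 (k n)" for n
  have t: "t \<longlonglongrightarrow> 0" "\<And>n. 0 < t n"
    using t0 LIMSEQ_subseq_LIMSEQ[OF t0(1) k(1)] by (auto simp: t_def[abs_def] o_def)
  define \<theta> where "\<theta> n x = diff_quot F F' (u x) (u (x + t n *\<^sub>R b))" for n x
  have \<theta>b: "\<bar>\<theta> n x\<bar> \<le> 1" for n x unfolding \<theta>_def by (rule diff_quot_bound[OF F(1,2)])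
  have \<theta>m[measurable]: "\<theta> n \<in> borel_measurable borel" for n
    unfolding \<theta>_def diff_quot_def by measurable
  have lim1: "(\<lambda>n. \<integral>x. F (u x) * ((\<phi> (x - t n *\<^sub>R b) - \<phi> x) / t n) \<partial>lborel) \<longlonglongrightarrow> (\<integral>x. F (u x) * (- ?d x) \<partial>lborel)"
  proof (rule integral_dominated_convergence[where w = "\<lambda>x. \<bar>F (u x)\<bar> * B'"])
    show "AE x in lborel. (\<lambda>n. F (u x) * ((\<phi> (x - t n *\<^sub>R b) - \<phi> x) / t n)) \<longlonglongrightarrow> F (u x) * (- ?d x)"
      by (intro AE_I2 tendsto_mult_left test_fun_difference_quotient(1)[OF \<phi> t])
    show "AE x in lborel. norm (F (u x) * ((\<phi> (x - t n *\<^sub>R b) - \<phi> x) / t n)) \<le> \<bar>F (u x)\<bar> * B'" for n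
      unfolding real_norm_def abs_mult
      by (intro AE_I2 mult_left_mono test_fun_difference_quotient(2)[OF \<phi> t B']) auto
  qed (use Fu in auto)
  have eq: "(\<integral>x. F (u x) * ((\<phi> (x - t n *\<^sub>R b) - \<phi> x) / t n) \<partial>lborel)
      = (\<integral>x. E (k n) x * (\<theta> n x * \<phi> x) \<partial>lborel) + (\<integral>x. h x * (\<theta> n x * \<phi> x) \<partial>lborel)" for n
  proof -
    have i1: "integrable lborel (\<lambda>x. F (u x) * \<phi> (x - t n *\<^sub>R b))"
      by (rule integrable_mult_bounded[OF Fu _ B(2)]) measurable
    have i2: "integrable lborel (\<lambda>x. F (u x) * \<phi> x)"
      by (rule integrable_mult_bounded[OF Fu _ B(2)]) measurable
    have i3: "integrable lborel (\<lambda>x. F (u (x + t n *\<^sub>R b)) * \<phi> x)"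
      by (rule integrable_mult_bounded[OF Fus _ B(2)]) measurable
    have b: "\<bar>\<theta> n x * \<phi> x\<bar> \<le> B" for x
      using mult_mono'[OF \<theta>b[of n x] B(2)[of x]] by (simp add: abs_mult)
    have i4: "integrable lborel (\<lambda>x. E (k n) x * (\<theta> n x * \<phi> x))"
      by (rule integrable_mult_bounded[OF Eint _ b]) measurable
    have i5: "integrable lborel (\<lambda>x. h x * (\<theta> n x * \<phi> x))"
      by (rule integrable_mult_bounded[OF h _ b]) measurable
    have "(\<integral>x. F (u x) * ((\<phi> (x - t n *\<^sub>R b) - \<phi> x) / t n) \<partial>lborel)
      = ((\<integral>x. F (u x) * \<phi> (x - t n *\<^sub>R b) \<partial>lborel) - (\<integral>x. F (u x) * \<phi> x \<partial>lborel)) / t n"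
      using i1 i2 by (simp flip: Bochner_Integration.integral_diff add: right_diff_distrib)
    also have "(\<integral>x. F (u x) * \<phi> (x - t n *\<^sub>R b) \<partial>lborel) = (\<integral>x. F (u (x + t n *\<^sub>R b)) * \<phi> x \<partial>lborel)"
      using lborel_shift(2)[of "\<lambda>x. F (u x) * \<phi> (x - t n *\<^sub>R b)" "t n *\<^sub>R b"] by simp
    also have "((\<integral>x. F (u (x + t n *\<^sub>R b)) * \<phi> x \<partial>lborel) - (\<integral>x. F (u x) * \<phi> x \<partial>lborel)) / t n
        = (\<integral>x. (F (u (x + t n *\<^sub>R b)) - F (u x)) / t n * \<phi> x \<partial>lborel)"
      using i2 i3 by (simp flip: Bochner_Integration.integral_diff add: left_diff_distrib)
    also have "\<dots> = (\<integral>x. E (k n) x * (\<theta> n x * \<phi> x) + h x * (\<theta> n x * \<phi> x) \<partial>lborel)"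
    proof (intro Bochner_Integration.integral_cong refl)
      fix x
      have eq: "F (u (x + t n *\<^sub>R b)) - F (u x) = \<theta> n x * (u (x + t n *\<^sub>R b) - u x)"
        by (simp add: \<theta>_def diff_quot_mult)
      show "(F (u (x + t n *\<^sub>R b)) - F (u x)) / t n * \<phi> x = E (k n) x * (\<theta> n x * \<phi> x) + h x * (\<theta> n x * \<phi> x)"
        unfolding eq
        by (cases "x \<in> \<Omega>") (simp_all add: E_def t_def left_diff_distrib right_diff_distrib mult_ac test_fun_outside(1)[OF \<phi>])
    qed
    finally show ?thesis using i4 i5 by simp
  qed
  have lim2: "(\<lambda>n. \<integral>x. E (k n) x * (\<theta> n x * \<phi> x) \<partial>lborel) \<longlonglongrightarrow> 0"
  proof (rule Lim_null_comparison)
    show "eventually (\<lambda>n. norm (\<integral>x. E (k n) x * (\<theta> n x * \<phi> x) \<partial>lborel) \<le> (\<integral>x. \<bar>E (k n) x\<bar> \<partial>lborel) * B) sequentially"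
    proof (rule always_eventually, rule allI)
      fix n
      have "norm (\<integral>x. E (k n) x * (\<theta> n x * \<phi> x) \<partial>lborel) \<le> (\<integral>x. \<bar>E (k n) x\<bar> * B \<partial>lborel)"
      proof (rule Bochner_Integration.integral_norm_bound_integral)
        have b: "\<bar>\<theta> n x * \<phi> x\<bar> \<le> B" for x
          using mult_mono'[OF \<theta>b[of n x] B(2)[of x]] by (simp add: abs_mult)
        show "integrable lborel (\<lambda>x. E (k n) x * (\<theta> n x * \<phi> x))"
          by (rule integrable_mult_bounded[OF Eint _ b]) measurable
        show "norm (E (k n) x * (\<theta> n x * \<phi> x)) \<le> \<bar>E (k n) x\<bar> * B" for x
          unfolding real_norm_def abs_mult[of "E (k n) x"] by (intro mult_left_mono b) auto
      qed (use Eint in auto)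
      then show "norm (\<integral>x. E (k n) x * (\<theta> n x * \<phi> x) \<partial>lborel) \<le> (\<integral>x. \<bar>E (k n) x\<bar> \<partial>lborel) * B" by simp
    qed
    show "(\<lambda>n. (\<integral>x. \<bar>E (k n) x\<bar> \<partial>lborel) * B) \<longlonglongrightarrow> 0"
      using tendsto_mult_left_zero[OF LIMSEQ_subseq_LIMSEQ[OF E0 k(1)], of B] by (simp add: o_def)
  qed
  have lim3: "(\<lambda>n. \<integral>x. h x * (\<theta> n x * \<phi> x) \<partial>lborel) \<longlonglongrightarrow> (\<integral>x. h x * (F' (u x) * \<phi> x) \<partial>lborel)"
  proof (rule integral_dominated_convergence[where w = "\<lambda>x. \<bar>h x\<bar> * B"])
    show "AE x in lborel. (\<lambda>n. h x * (\<theta> n x * \<phi> x)) \<longlonglongrightarrow> h x * (F' (u x) * \<phi> x)"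
      using k(2)
    proof eventually_elim
      case (elim x)
      show ?case
      proof (cases "x \<in> \<Omega>")
        case True
        \<comment> \<open>Solving the definition of \<open>E\<close> for the shifted value shows
          that \<open>u (x + t n *\<^sub>R b)\<close> tends to \<open>u x\<close>.\<close>
        have "(\<lambda>n. u x + t n * (E (k n) x + h x)) \<longlonglongrightarrow> u x + 0 * (0 + h x)"
          by (intro tendsto_intros t elim)
        moreover have "u x + t n * (E (k n) x + h x) = u (x + t n *\<^sub>R b)" for n
          using True t(2)[of n] by (simp add: E_def t_def)
        ultimately have "(\<lambda>n. u (x + t n *\<^sub>R b)) \<longlonglongrightarrow> u x" by simp
        then have "(\<lambda>n. \<theta> n x) \<longlonglongrightarrow> F' (u x)"
          unfolding \<theta>_def by (rule diff_quot_tendsto[OF F(1)])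
        then show ?thesis by (intro tendsto_mult_left tendsto_mult_right)
      qed (simp add: test_fun_outside(1)[OF \<phi>])
    qed
    fix n
    have b: "\<bar>\<theta> n x * \<phi> x\<bar> \<le> B" for x
      using mult_mono'[OF \<theta>b[of n x] B(2)[of x]] by (simp add: abs_mult)
    show "AE x in lborel. norm (h x * (\<theta> n x * \<phi> x)) \<le> \<bar>h x\<bar> * B"
      unfolding real_norm_def abs_mult[of "h _"] by (intro AE_I2 mult_left_mono b) auto
  qed (use h in auto)
  have "(\<lambda>n. \<integral>x. F (u x) * ((\<phi> (x - t n *\<^sub>R b) - \<phi> x) / t n) \<partial>lborel) \<longlonglongrightarrow> 0 + (\<integral>x. h x * (F' (u x) * \<phi> x) \<partial>lborel)"
    unfolding eq by (intro tendsto_add lim2 lim3)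
  from LIMSEQ_unique[OF lim1 this]
  have "- (\<integral>x. F (u x) * ?d x \<partial>lborel) = (\<integral>x. h x * (F' (u x) * \<phi> x) \<partial>lborel)" by simp
  then show ?thesis by (simp add: mult_ac)
qed

lemma integral_lborel_eq_lebesgue_on:
  fixes f f' :: "'a::euclidean_space \<Rightarrow> real"
  assumes "open \<Omega>" and f: "f \<in> borel_measurable borel" and f': "f' \<in> borel_measurable (lebesgue_on \<Omega>)"
    and ae: "AE x in lebesgue. x \<in> \<Omega> \<longrightarrow> f x = f' x" and out: "\<And>x. x \<notin> \<Omega> \<Longrightarrow> f x = 0"
  shows "integral\<^sup>L lborel f = integral\<^sup>L (lebesgue_on \<Omega>) f'"
proof -
  have \<Omega>: "\<Omega> \<in> sets lebesgue" using assms(1) by simp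
  have "integral\<^sup>L lborel f = integral\<^sup>L lebesgue f" using f by (intro integral_completion[symmetric]) simp
  also have "\<dots> = integral\<^sup>L (lebesgue_on \<Omega>) f" using integral_lebesgue_on_eq[OF \<Omega> out] by simp
  also have "\<dots> = integral\<^sup>L (lebesgue_on \<Omega>) f'"
  proof (rule integral_cong_AE)
    show "f \<in> borel_measurable (lebesgue_on \<Omega>)"
      using f by (intro measurable_restrict_space1 measurable_completion) simp
    show "AE x in lebesgue_on \<Omega>. f x = f' x" using ae \<Omega> by (simp add: AE_restrict_space_iff)
  qed (fact f')
  finally show ?thesis .
qed

lemma test_fun_borel_measurable_lebesgue_on:
  assumes "test_fun \<Omega> \<phi>"
  shows "\<phi> \<in> borel_measurable (lebesgue_on S)" "(\<lambda>x. frechet_derivative \<phi> (at x) b) \<in> borel_measurable (lebesgue_on S)"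
  using borel_measurable_continuous_onI[OF test_fun_continuous[OF assms]]
    borel_measurable_continuous_onI[OF test_fun_deriv_continuous[OF assms]]
  by (auto intro!: measurable_restrict_space1 measurable_completion)

text \<open>Localisation reduces this to \<open>integral_chain_rule\<close>: for shifts up to
  \<open>r\<close> all supports near that of \<open>\<phi>\<close> stay in a compact
  \<open>K2\<close> inside the domain, and on \<open>K2\<close> the functions \<open>u\<close> and
  \<open>g x \<bullet> b\<close> agree almost everywhere with integrable Borel functions on the
  whole space.\<close>

lemma weak_gradient_chain_rule:
  fixes \<Omega> :: "'a::euclidean_space set"
  assumes "open \<Omega>" "1 \<le> p" and u: "Lp_fun p \<Omega> u" and g: "weak_gradient p \<Omega> u g"
    and F: "\<And>x. (F has_real_derivative F' x) (at x)" "\<And>x. \<bar>F' x\<bar> \<le> 1" "F 0 = 0"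
    and F': "F' \<in> borel_measurable borel"
  shows "weak_gradient p \<Omega> (\<lambda>x. F (u x)) (\<lambda>x. F' (u x) *\<^sub>R g x)"
  unfolding weak_gradient_def
proof (intro ballI conjI allI impI)
  fix b :: 'a assume b: "b \<in> Basis"
  let ?h = "\<lambda>x. g x \<bullet> b"
  have um: "u \<in> borel_measurable (lebesgue_on \<Omega>)" using u by (simp add: Lp_fun_def)
  have h: "Lp_fun p \<Omega> ?h" using g b by (simp add: weak_gradient_def)
  then have hm: "?h \<in> borel_measurable (lebesgue_on \<Omega>)" and hi: "integrable (lebesgue_on \<Omega>) (\<lambda>x. \<bar>?h x\<bar> powr p)"
    by (simp_all add: Lp_fun_def)
  have Fb: "F \<in> borel_measurable borel"
    using F(1) DERIV_isCont by (intro borel_measurable_continuous_onI continuous_at_imp_continuous_on) blast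
  have Fum: "(\<lambda>x. F (u x)) \<in> borel_measurable (lebesgue_on \<Omega>)" using measurable_compose[OF um Fb] .
  have F'um: "(\<lambda>x. F' (u x)) \<in> borel_measurable (lebesgue_on \<Omega>)" using measurable_compose[OF um F'] .
  show "Lp_fun p \<Omega> (\<lambda>x. (F' (u x) *\<^sub>R g x) \<bullet> b)"
    unfolding Lp_fun_def
  proof
    show m: "(\<lambda>x. (F' (u x) *\<^sub>R g x) \<bullet> b) \<in> borel_measurable (lebesgue_on \<Omega>)"
      using F'um hm by simp
    have "\<bar>F' (u x) * ?h x\<bar> powr p \<le> \<bar>?h x\<bar> powr p" for x
      using assms(2) F(2)[of "u x"] by (intro powr_mono2) (auto simp: abs_mult mult_left_le_one_le)
    then show "integrable (lebesgue_on \<Omega>) (\<lambda>x. \<bar>(F' (u x) *\<^sub>R g x) \<bullet> b\<bar> powr p)"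
      using m by (intro Bochner_Integration.integrable_bound[OF hi]) auto
  qed
  fix \<phi> assume \<phi>: "test_fun \<Omega> \<phi>"
  define K where "K = closure {x. \<phi> x \<noteq> 0}"
  have K: "compact K" "K \<subseteq> \<Omega>" using \<phi> by (auto simp: K_def test_fun_def)
  obtain e where e: "e > 0" "(\<Union>x\<in>K. ball x e) \<subseteq> \<Omega>"
    using compact_subset_open_imp_ball_epsilon_subset[OF K(1) \<open>open \<Omega>\<close> K(2)] by blast
  \<comment> \<open>A point of \<open>\<Omega>'\<close> shifted by at most \<open>r\<close> is
    within \<open>2 * r\<close> of \<open>K\<close>; \<open>K2\<close> allows the distance
    \<open>3 * r\<close>, still below \<open>e\<close>, which is \<open>4 * r\<close>.\<close>
  define r where "r = e / 4"
  have r: "r > 0" using e by (simp add: r_def)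
  define \<Omega>' where "\<Omega>' = (\<Union>x\<in>K. ball x r)"
  have \<Omega>': "open \<Omega>'" "K \<subseteq> \<Omega>'" using r by (auto simp: \<Omega>'_def)
  have \<phi>': "test_fun \<Omega>' \<phi>" using \<phi> \<Omega>' by (auto simp: test_fun_def K_def)
  define K2 where "K2 = {x + y |x y. x \<in> K \<and> y \<in> cball 0 (3 * r)}"
  have K2c: "compact K2" unfolding K2_def by (intro compact_sums K compact_cball)
  have K2: "K2 \<subseteq> \<Omega>"
  proof
    fix z assume "z \<in> K2"
    then obtain x y where "z = x + y" "x \<in> K" "norm y \<le> 3 * r" by (auto simp: K2_def)
    then have "z \<in> ball x e" using e(1) by (simp add: dist_norm r_def)
    with \<open>x \<in> K\<close> e(2) show "z \<in> \<Omega>" by blast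
  qed
  have shiftK2: "s *\<^sub>R b + y \<in> K2" if y: "y \<in> \<Omega>'" and s: "0 \<le> s" "s \<le> r" for s y
  proof -
    obtain x where x: "x \<in> K" "dist x y < r" using y by (auto simp: \<Omega>'_def)
    have "norm (s *\<^sub>R b + y - x) \<le> norm (s *\<^sub>R b) + norm (y - x)" by (metis add_diff_eq norm_triangle_ineq)
    also have "\<dots> \<le> 3 * r" using s x(2) b r by (simp add: dist_norm norm_minus_commute)
    finally have "s *\<^sub>R b + y - x \<in> cball 0 (3 * r)" by simp
    moreover have "s *\<^sub>R b + y = x + (s *\<^sub>R b + y - x)" by simp
    ultimately show ?thesis using x(1) unfolding K2_def by blast
  qed
  have K2b: "K2 \<in> sets borel" using K2c by (rule borel_compact)
  have rep: "\<exists>w0. w0 \<in> borel_measurable borel \<and> integrable lborel w0 \<and> (AE x in lebesgue. x \<in> K2 \<longrightarrow> w0 x = w x)"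
    if "Lp_fun p \<Omega> w" for w
  proof -
    have "integrable lebesgue (\<lambda>x. indicator K2 x *\<^sub>R w x)"
      using Lp_fun_set_integrable[OF that assms(2,1) K2c K2] by (simp add: set_integrable_def)
    then obtain w0 where w0: "w0 \<in> borel_measurable borel" "integrable lborel w0"
      "AE x in lebesgue. indicator K2 x *\<^sub>R w x = w0 x" by (rule integrable_lebesgue_borel_rep)
    from w0(3) have "AE x in lebesgue. x \<in> K2 \<longrightarrow> w0 x = w x" by eventually_elim auto
    with w0(1,2) show ?thesis by blast
  qed
  obtain u0 where u0: "u0 \<in> borel_measurable borel" "integrable lborel u0" "AE x in lebesgue. x \<in> K2 \<longrightarrow> u0 x = u x"
    using rep[OF u] by blast
  obtain h0 where h0: "h0 \<in> borel_measurable borel" "integrable lborel h0" "AE x in lebesgue. x \<in> K2 \<longrightarrow> h0 x = ?h x"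
    using rep[OF h] by blast
  note [measurable] = u0(1) h0(1) Fb F'
  \<comment> \<open>The shifted test function is supported in \<open>K2\<close>, where
    \<open>u0\<close> and \<open>h0\<close> may be exchanged for \<open>u\<close> and the gradient
    component; there it is an admissible test function for the weak gradient on
    \<open>\<Omega>\<close>.\<close>
  have weak: "(\<integral>y. u0 y * frechet_derivative \<psi> (at (y - s *\<^sub>R b)) b \<partial>lborel) = - (\<integral>y. h0 y * \<psi> (y - s *\<^sub>R b) \<partial>lborel)"
    if \<psi>: "test_fun \<Omega>' \<psi>" and s: "0 \<le> s" "s \<le> r" for \<psi> s
  proof -
    let ?\<psi> = "\<lambda>y. \<psi> (y - s *\<^sub>R b)"
    have suppK2: "s *\<^sub>R b + x \<in> K2" if "x \<in> closure {x. \<psi> x \<noteq> 0}" for x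
      using \<psi> that shiftK2[OF _ s] unfolding test_fun_def by blast
    have \<psi>s: "test_fun K2 ?\<psi>" by (rule test_fun_shift[OF \<psi> suppK2])
    have \<psi>s': "test_fun \<Omega> ?\<psi>" by (rule test_fun_shift[OF \<psi>]) (use suppK2 K2 in blast)
    have d: "frechet_derivative ?\<psi> (at y) b = frechet_derivative \<psi> (at (y - s *\<^sub>R b)) b" for y
      using frechet_derivative_shift(2)[OF test_fun_differentiable[OF \<psi>]] by simp
    have [measurable]: "?\<psi> \<in> borel_measurable borel" "(\<lambda>y. frechet_derivative ?\<psi> (at y) b) \<in> borel_measurable borel"
      using test_fun_continuous[OF \<psi>s] test_fun_deriv_continuous[OF \<psi>s] borel_measurable_continuous_onI by auto
    have "(\<integral>y. u0 y * frechet_derivative ?\<psi> (at y) b \<partial>lborel) = integral\<^sup>L (lebesgue_on \<Omega>) (\<lambda>y. u y * frechet_derivative ?\<psi> (at y) b)"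
    proof (rule integral_lborel_eq_lebesgue_on[OF \<open>open \<Omega>\<close>])
      show "(\<lambda>y. u y * frechet_derivative ?\<psi> (at y) b) \<in> borel_measurable (lebesgue_on \<Omega>)"
        by (intro borel_measurable_times um test_fun_borel_measurable_lebesgue_on[OF \<psi>s])
      show "AE y in lebesgue. y \<in> \<Omega> \<longrightarrow> u0 y * frechet_derivative ?\<psi> (at y) b = u y * frechet_derivative ?\<psi> (at y) b"
        using u0(3)
      proof eventually_elim
        case (elim y)
        then show ?case by (cases "y \<in> K2") (simp_all add: test_fun_outside(2)[OF \<psi>s])
      qed
    qed (simp_all add: test_fun_outside(2)[OF \<psi>s'])
    also have "\<dots> = - integral\<^sup>L (lebesgue_on \<Omega>) (\<lambda>y. ?h y * ?\<psi> y)"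
      using g b \<psi>s' by (simp add: weak_gradient_def)
    also have "integral\<^sup>L (lebesgue_on \<Omega>) (\<lambda>y. ?h y * ?\<psi> y) = (\<integral>y. h0 y * ?\<psi> y \<partial>lborel)"
    proof (rule integral_lborel_eq_lebesgue_on[OF \<open>open \<Omega>\<close>, symmetric])
      show "(\<lambda>y. ?h y * ?\<psi> y) \<in> borel_measurable (lebesgue_on \<Omega>)"
        by (intro borel_measurable_times hm test_fun_borel_measurable_lebesgue_on[OF \<psi>s])
      show "AE y in lebesgue. y \<in> \<Omega> \<longrightarrow> h0 y * ?\<psi> y = ?h y * ?\<psi> y"
        using h0(3)
      proof eventually_elim
        case (elim y)
        then show ?case by (cases "y \<in> K2") (simp_all add: test_fun_outside(1)[OF \<psi>s])
      qed
    qed (simp_all add: test_fun_outside(1)[OF \<psi>s'])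
    finally show ?thesis by (simp add: d)
  qed
  have chain: "(\<integral>y. F (u0 y) * frechet_derivative \<phi> (at y) b \<partial>lborel) = - (\<integral>y. F' (u0 y) * h0 y * \<phi> y \<partial>lborel)"
    by (rule integral_chain_rule[OF \<Omega>'(1) u0(2) h0(2) r weak F F' \<phi>'])
  have [measurable]: "\<phi> \<in> borel_measurable borel" "(\<lambda>y. frechet_derivative \<phi> (at y) b) \<in> borel_measurable borel"
    using test_fun_continuous[OF \<phi>] test_fun_deriv_continuous[OF \<phi>] borel_measurable_continuous_onI by auto
  have KK2: "K \<subseteq> K2" 
  proof
    fix x assume "x \<in> K"
    moreover have "x = x + 0" "0 \<in> cball 0 (3 * r)" using r by auto
    ultimately show "x \<in> K2" unfolding K2_def by blast
  qed
  have \<phi>K2: "test_fun K2 \<phi>" using \<phi> KK2 by (auto simp: test_fun_def K_def)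
  have "integral\<^sup>L (lebesgue_on \<Omega>) (\<lambda>x. F (u x) * frechet_derivative \<phi> (at x) b)
      = (\<integral>y. F (u0 y) * frechet_derivative \<phi> (at y) b \<partial>lborel)"
  proof (rule integral_lborel_eq_lebesgue_on[OF \<open>open \<Omega>\<close>, symmetric])
    show "(\<lambda>x. F (u x) * frechet_derivative \<phi> (at x) b) \<in> borel_measurable (lebesgue_on \<Omega>)"
      by (intro borel_measurable_times Fum test_fun_borel_measurable_lebesgue_on[OF \<phi>])
    show "AE y in lebesgue. y \<in> \<Omega> \<longrightarrow> F (u0 y) * frechet_derivative \<phi> (at y) b = F (u y) * frechet_derivative \<phi> (at y) b"
      using u0(3)
    proof eventually_elim
      case (elim y)
      then show ?case by (cases "y \<in> K2") (simp_all add: test_fun_outside(2)[OF \<phi>K2])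
    qed
  qed (simp_all add: test_fun_outside(2)[OF \<phi>])
  moreover have "integral\<^sup>L (lebesgue_on \<Omega>) (\<lambda>x. ((F' (u x) *\<^sub>R g x) \<bullet> b) * \<phi> x)
      = (\<integral>y. F' (u0 y) * h0 y * \<phi> y \<partial>lborel)"
  proof (rule integral_lborel_eq_lebesgue_on[OF \<open>open \<Omega>\<close>, symmetric])
    show "(\<lambda>x. ((F' (u x) *\<^sub>R g x) \<bullet> b) * \<phi> x) \<in> borel_measurable (lebesgue_on \<Omega>)"
      unfolding inner_scaleR_left
      by (intro borel_measurable_times F'um hm test_fun_borel_measurable_lebesgue_on[OF \<phi>])
    show "AE y in lebesgue. y \<in> \<Omega> \<longrightarrow> F' (u0 y) * h0 y * \<phi> y = ((F' (u y) *\<^sub>R g y) \<bullet> b) * \<phi> y"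
      using u0(3) h0(3)
    proof eventually_elim
      case (elim y)
      then show ?case by (cases "y \<in> K2") (simp_all add: test_fun_outside(1)[OF \<phi>K2])
    qed
  qed (simp_all add: test_fun_outside(1)[OF \<phi>])
  ultimately show "integral\<^sup>L (lebesgue_on \<Omega>) (\<lambda>x. F (u x) * frechet_derivative \<phi> (at x) b)
      = - integral\<^sup>L (lebesgue_on \<Omega>) (\<lambda>x. ((F' (u x) *\<^sub>R g x) \<bullet> b) * \<phi> x)"
    using chain by simp
qed

section \<open>Sobolev functions\<close>

text \<open>Treats functions and gradients uniformly: \<open>weak_gradient\<close> speaks of
  components, whereas the energy involves the Euclidean norm of the whole gradient.\<close>

definition Lp_vec :: "real \<Rightarrow> 'a::euclidean_space set \<Rightarrow> ('a \<Rightarrow> 'b::euclidean_space) \<Rightarrow> bool" where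
  "Lp_vec p \<Omega> g \<longleftrightarrow> g \<in> borel_measurable (lebesgue_on \<Omega>) \<and> integrable (lebesgue_on \<Omega>) (\<lambda>x. norm (g x) powr p)"

lemma Lp_fun_iff_Lp_vec: "Lp_fun p \<Omega> u \<longleftrightarrow> Lp_vec p \<Omega> u"
  by (simp add: Lp_fun_def Lp_vec_def)

lemma Lp_vec_measurable: "Lp_vec p \<Omega> g \<Longrightarrow> g \<in> borel_measurable (lebesgue_on \<Omega>)"
  and Lp_vec_integrable: "Lp_vec p \<Omega> g \<Longrightarrow> integrable (lebesgue_on \<Omega>) (\<lambda>x. norm (g x) powr p)"
  by (simp_all add: Lp_vec_def)

lemma Lp_vec_dominated:
  assumes "0 \<le> p" "Lp_vec p \<Omega> f" "g \<in> borel_measurable (lebesgue_on \<Omega>)"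
    "AE x in lebesgue_on \<Omega>. norm (g x) \<le> norm (f x)"
  shows "Lp_vec p \<Omega> g"
  unfolding Lp_vec_def
proof
  have "(\<lambda>x. norm (g x) powr p) \<in> borel_measurable (lebesgue_on \<Omega>)" using assms(3) by measurable
  moreover have "AE x in lebesgue_on \<Omega>. norm (norm (g x) powr p) \<le> norm (norm (f x) powr p)"
    using assms(4) by eventually_elim (use assms(1) in \<open>auto intro: powr_mono2\<close>)
  ultimately show "integrable (lebesgue_on \<Omega>) (\<lambda>x. norm (g x) powr p)"
    by (rule Bochner_Integration.integrable_bound[OF Lp_vec_integrable[OF assms(2)]])
qed fact

lemma norm_add_powr_le:
  fixes x y :: "'b::real_normed_vector"
  assumes "0 < l" "l < 1" "0 < p"
  shows "norm (x + y) powr p \<le> l powr (- p) * norm x powr p + (1 - l) powr (- p) * norm y powr p"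
proof -
  have "norm (x + y) powr p \<le> (norm x + norm y) powr p"
    using assms by (intro powr_mono2 norm_triangle_ineq) auto
  also have "\<dots> \<le> l powr (- p) * norm x powr p + (1 - l) powr (- p) * norm y powr p"
    using assms by (intro powr_add_le_split) auto
  finally show ?thesis .
qed

lemma Lp_vec_add:
  assumes "0 < p" "Lp_vec p \<Omega> f" "Lp_vec p \<Omega> g"
  shows "Lp_vec p \<Omega> (\<lambda>x. f x + g x)"
  unfolding Lp_vec_def
proof
  note m = Lp_vec_measurable[OF assms(2)] Lp_vec_measurable[OF assms(3)]
  show "(\<lambda>x. f x + g x) \<in> borel_measurable (lebesgue_on \<Omega>)" using m by measurable
  then have m': "(\<lambda>x. norm (f x + g x) powr p) \<in> borel_measurable (lebesgue_on \<Omega>)" by measurable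
  obtain l :: real where l: "0 < l" "l < 1" by (meson dense zero_less_one)
  have i: "integrable (lebesgue_on \<Omega>) (\<lambda>x. l powr (- p) * norm (f x) powr p + (1 - l) powr (- p) * norm (g x) powr p)"
    using Lp_vec_integrable[OF assms(2)] Lp_vec_integrable[OF assms(3)] by simp
  show "integrable (lebesgue_on \<Omega>) (\<lambda>x. norm (f x + g x) powr p)"
  proof (rule Bochner_Integration.integrable_bound[OF i m'], rule AE_I2)
    fix x
    show "norm (norm (f x + g x) powr p) \<le> norm (l powr (- p) * norm (f x) powr p + (1 - l) powr (- p) * norm (g x) powr p)"
      using norm_add_powr_le[OF l assms(1), of "f x" "g x"] by simp
  qed
qed

lemma Lp_vec_scaleR: "Lp_vec p \<Omega> f \<Longrightarrow> Lp_vec p \<Omega> (\<lambda>x. c *\<^sub>R f x)"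
  unfolding Lp_vec_def by (auto simp: powr_mult)

lemma Lp_vec_0: "Lp_vec p \<Omega> (\<lambda>x. 0)"
  by (simp add: Lp_vec_def)

lemma Lp_vec_sum:
  assumes "0 < p" "finite I" "\<And>i. i \<in> I \<Longrightarrow> Lp_vec p \<Omega> (f i)"
  shows "Lp_vec p \<Omega> (\<lambda>x. \<Sum>i\<in>I. f i x)"
  using assms(2,3)
  by (induction I rule: finite_induct) (auto intro: Lp_vec_0 Lp_vec_add[OF assms(1)])

lemma Lp_vec_iff_components:
  fixes g :: "'a::euclidean_space \<Rightarrow> 'b::euclidean_space"
  assumes "0 < p"
  shows "Lp_vec p \<Omega> g \<longleftrightarrow> (\<forall>b\<in>Basis. Lp_fun p \<Omega> (\<lambda>x. g x \<bullet> b))"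
proof
  assume g: "Lp_vec p \<Omega> g"
  show "\<forall>b\<in>Basis. Lp_fun p \<Omega> (\<lambda>x. g x \<bullet> b)"
  proof
    fix b :: 'b assume "b \<in> Basis"
    then show "Lp_fun p \<Omega> (\<lambda>x. g x \<bullet> b)"
      unfolding Lp_fun_iff_Lp_vec using assms Lp_vec_measurable[OF g]
      by (intro Lp_vec_dominated[OF _ g]) (auto simp: Basis_le_norm)
  qed
next
  assume "\<forall>b\<in>Basis. Lp_fun p \<Omega> (\<lambda>x. g x \<bullet> b)"
  then have "Lp_vec p \<Omega> (\<lambda>x. g x \<bullet> b)" if "b \<in> Basis" for b using that by (simp add: Lp_fun_iff_Lp_vec)
  then have "Lp_vec p \<Omega> (\<lambda>x. (g x \<bullet> b) *\<^sub>R b)" if "b \<in> Basis" for b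
    unfolding Lp_vec_def using that by (auto simp: powr_mult intro!: borel_measurable_scaleR)
  then have "Lp_vec p \<Omega> (\<lambda>x. \<Sum>b\<in>Basis. (g x \<bullet> b) *\<^sub>R b)"
    using assms by (intro Lp_vec_sum) auto
  then show "Lp_vec p \<Omega> g" by (simp add: euclidean_representation)
qed

section \<open>The space \<open>W1p\<close> and its energy, computed from any weak gradient\<close>

locale sobolev_domain =
  fixes \<Omega> :: "'a::euclidean_space set" and p :: real
  assumes open_domain: "open \<Omega>" and p_gt_1: "1 < p"
begin

abbreviation M :: "'a measure" where "M \<equiv> lebesgue_on \<Omega>"

abbreviation N :: "('a \<Rightarrow> real) \<Rightarrow> real" where "N \<equiv> W1p_norm_p p \<Omega>"

text \<open>A relation in place of the choice \<open>wgrad\<close>, so that sums, multiples,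
  compositions and limits carry an explicit gradient; \<open>N_eq\<close> leads back to the
  norm.\<close>

definition has_grad :: "('a \<Rightarrow> real) \<Rightarrow> ('a \<Rightarrow> 'a) \<Rightarrow> bool" where
  "has_grad u g \<longleftrightarrow> Lp_fun p \<Omega> u \<and> weak_gradient p \<Omega> u g"

lemma p_pos: "0 < p" and p_ge_1: "1 \<le> p" and p_nonneg: "0 \<le> p"
  using p_gt_1 by auto

lemma domain_sets: "\<Omega> \<in> sets lebesgue"
  using open_domain by simp

lemma W1p_iff: "u \<in> W1p p \<Omega> \<longleftrightarrow> (\<exists>g. has_grad u g)"
  by (auto simp: W1p_def has_grad_def)

lemma has_grad_Lp:
  assumes "has_grad u g"
  shows "Lp_vec p \<Omega> u" "Lp_vec p \<Omega> g"
proof -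
  show "Lp_vec p \<Omega> u" using assms by (simp add: has_grad_def Lp_fun_iff_Lp_vec)
  show "Lp_vec p \<Omega> g"
    unfolding Lp_vec_iff_components[OF p_pos] using assms by (simp add: has_grad_def weak_gradient_def)
qed

lemma has_gradI:
  assumes "Lp_vec p \<Omega> u" "Lp_vec p \<Omega> g"
    and "\<And>b \<phi>. b \<in> Basis \<Longrightarrow> test_fun \<Omega> \<phi> \<Longrightarrow>
      integral\<^sup>L M (\<lambda>x. u x * frechet_derivative \<phi> (at x) b) = - integral\<^sup>L M (\<lambda>x. (g x \<bullet> b) * \<phi> x)"
  shows "has_grad u g"
  using assms unfolding has_grad_def weak_gradient_def Lp_vec_iff_components[OF p_pos, of \<Omega> g]
  by (simp add: Lp_fun_iff_Lp_vec)

lemma has_grad_integral: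
  assumes "has_grad u g" "b \<in> Basis" "test_fun \<Omega> \<phi>"
  shows "integral\<^sup>L M (\<lambda>x. u x * frechet_derivative \<phi> (at x) b) = - integral\<^sup>L M (\<lambda>x. (g x \<bullet> b) * \<phi> x)"
  using assms by (simp add: has_grad_def weak_gradient_def)

lemma Lp_mult_integrable:
  assumes u: "Lp_fun p \<Omega> u" and k: "k \<in> borel_measurable M" "\<And>x. \<bar>k x\<bar> \<le> C"
    and K: "compact K" "K \<subseteq> \<Omega>" "\<And>x. x \<notin> K \<Longrightarrow> k x = 0"
  shows "integrable M (\<lambda>x. u x * k x)"
proof -
  have C: "0 \<le> C" using k(2)[of undefined] by linarith
  have um: "u \<in> borel_measurable M" using u by (simp add: Lp_fun_def)
  have Ks: "K \<in> sets lebesgue" using borel_compact[OF K(1)] by auto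
  have "integrable lebesgue (\<lambda>x. indicator \<Omega> x *\<^sub>R (indicator K x *\<^sub>R u x))"
    using Lp_fun_set_integrable[OF u p_ge_1 open_domain K(1,2)] domain_sets
    unfolding set_integrable_def by (intro integrable_mult_indicator[of \<Omega>])
  then have "integrable M (\<lambda>x. indicator K x *\<^sub>R u x)"
    using domain_sets by (simp add: integrable_restrict_space)
  then have i: "integrable M (\<lambda>x. C * (indicator K x *\<^sub>R u x))" by simp
  have ae: "AE x in M. norm (u x * k x) \<le> norm (C * (indicator K x *\<^sub>R u x))"
    using k(2) K(3) C by (intro AE_I2) (auto simp: indicator_def abs_mult mult.commute intro: mult_right_mono)
  show ?thesis
    by (rule Bochner_Integration.integrable_bound[OF i _ ae]) (intro borel_measurable_times um k(1))
qed

lemma test_fun_mult_integrable: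
  assumes u: "Lp_fun p \<Omega> u" and \<phi>: "test_fun \<Omega> \<phi>"
  shows "integrable M (\<lambda>x. u x * \<phi> x)" "integrable M (\<lambda>x. u x * frechet_derivative \<phi> (at x) b)"
proof -
  obtain B where B: "\<And>x. \<bar>\<phi> x\<bar> \<le> B" using test_fun_bounded[OF \<phi>] by blast
  obtain B' where B': "\<And>x. \<bar>frechet_derivative \<phi> (at x) b\<bar> \<le> B'" using test_fun_deriv_bounded[OF \<phi>, of b] by blast
  have K: "compact (closure {x. \<phi> x \<noteq> 0})" "closure {x. \<phi> x \<noteq> 0} \<subseteq> \<Omega>" using \<phi> by (auto simp: test_fun_def)
  show "integrable M (\<lambda>x. u x * \<phi> x)"
    by (rule Lp_mult_integrable[OF u test_fun_borel_measurable_lebesgue_on(1)[OF \<phi>] B K eq_0_outside_support[of _ \<phi>]])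
  show "integrable M (\<lambda>x. u x * frechet_derivative \<phi> (at x) b)"
    by (rule Lp_mult_integrable[OF u test_fun_borel_measurable_lebesgue_on(2)[OF \<phi>] B' K derivative_eq_0_outside_support[of _ \<phi> b]])
qed

lemma has_grad_components:
  assumes "has_grad u g"
  shows "Lp_fun p \<Omega> u" "b \<in> Basis \<Longrightarrow> Lp_fun p \<Omega> (\<lambda>x. g x \<bullet> b)"
  using assms by (auto simp: has_grad_def weak_gradient_def)

lemma has_grad_add:
  assumes "has_grad u g" "has_grad v k"
  shows "has_grad (\<lambda>x. u x + v x) (\<lambda>x. g x + k x)"
proof (rule has_gradI)
  show "Lp_vec p \<Omega> (\<lambda>x. u x + v x)" "Lp_vec p \<Omega> (\<lambda>x. g x + k x)"
    using has_grad_Lp[OF assms(1)] has_grad_Lp[OF assms(2)] by (auto intro: Lp_vec_add[OF p_pos])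
  fix b :: 'a and \<phi> assume b: "b \<in> Basis" and \<phi>: "test_fun \<Omega> \<phi>"
  note i = test_fun_mult_integrable(2)[OF has_grad_components(1)[OF assms(1)] \<phi>, of b]
    test_fun_mult_integrable(2)[OF has_grad_components(1)[OF assms(2)] \<phi>, of b]
    test_fun_mult_integrable(1)[OF has_grad_components(2)[OF assms(1) b] \<phi>]
    test_fun_mult_integrable(1)[OF has_grad_components(2)[OF assms(2) b] \<phi>]
  show "integral\<^sup>L M (\<lambda>x. (u x + v x) * frechet_derivative \<phi> (at x) b) = - integral\<^sup>L M (\<lambda>x. ((g x + k x) \<bullet> b) * \<phi> x)"
    unfolding distrib_right inner_add_left
    by (simp add: i has_grad_integral[OF assms(1) b \<phi>] has_grad_integral[OF assms(2) b \<phi>])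
qed

lemma has_grad_scale:
  assumes "has_grad u g"
  shows "has_grad (\<lambda>x. c * u x) (\<lambda>x. c *\<^sub>R g x)"
proof (rule has_gradI)
  show "Lp_vec p \<Omega> (\<lambda>x. c * u x)" "Lp_vec p \<Omega> (\<lambda>x. c *\<^sub>R g x)"
    using has_grad_Lp[OF assms] Lp_vec_scaleR[of p \<Omega> u c] by (auto intro: Lp_vec_scaleR)
  fix b :: 'a and \<phi> assume b: "b \<in> Basis" and \<phi>: "test_fun \<Omega> \<phi>"
  show "integral\<^sup>L M (\<lambda>x. (c * u x) * frechet_derivative \<phi> (at x) b) = - integral\<^sup>L M (\<lambda>x. ((c *\<^sub>R g x) \<bullet> b) * \<phi> x)"
    by (simp add: mult.assoc has_grad_integral[OF assms(1) b \<phi>])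
qed

lemma has_grad_diff:
  assumes "has_grad u g" "has_grad v k"
  shows "has_grad (\<lambda>x. u x - v x) (\<lambda>x. g x - k x)"
  using has_grad_add[OF assms(1) has_grad_scale[OF assms(2), of "-1"]] by simp

text \<open>The difference of two gradients is a weak gradient of the zero function, so each of its
  components is annihilated by the fundamental lemma. This makes the energy independent of the
  gradient selected by \<open>wgrad\<close>.\<close>

lemma has_grad_unique:
  assumes "has_grad u g" "has_grad u k"
  shows "AE x in M. g x = k x"
proof -
  have "AE x in lebesgue. x \<in> \<Omega> \<longrightarrow> (g x - k x) \<bullet> b = 0" if b: "b \<in> Basis" for b
  proof (rule fundamental_lemma_calculus_of_variations[OF open_domain])
    have d: "has_grad (\<lambda>x. u x - u x) (\<lambda>x. g x - k x)" by (rule has_grad_diff[OF assms])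
    show "set_integrable lebesgue K (\<lambda>x. (g x - k x) \<bullet> b)" if "compact K" "K \<subseteq> \<Omega>" for K
      by (rule Lp_fun_set_integrable[OF has_grad_components(2)[OF d b] p_ge_1 open_domain that])
    fix \<phi> assume "test_fun \<Omega> \<phi>"
    from has_grad_integral[OF d b this] show "integral\<^sup>L M (\<lambda>x. ((g x - k x) \<bullet> b) * \<phi> x) = 0" by simp
  qed
  then have "AE x in lebesgue. \<forall>b\<in>Basis. x \<in> \<Omega> \<longrightarrow> (g x - k x) \<bullet> b = 0"
    by (subst AE_ball_countable) (auto intro: countable_finite)
  then have "AE x in lebesgue. x \<in> \<Omega> \<longrightarrow> g x = k x"
    by eventually_elim (auto simp: inner_diff_left intro: euclidean_eqI)
  then show ?thesis using domain_sets by (simp add: AE_restrict_space_iff)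
qed

lemma has_grad_energy_integrable:
  assumes "has_grad u g"
  shows "integrable M (\<lambda>x. \<bar>u x\<bar> powr p + norm (g x) powr p)"
  using Lp_vec_integrable[OF has_grad_Lp(1)[OF assms]] Lp_vec_integrable[OF has_grad_Lp(2)[OF assms]] by simp

lemma N_eq:
  assumes "has_grad u g"
  shows "N u = integral\<^sup>L M (\<lambda>x. \<bar>u x\<bar> powr p + norm (g x) powr p)"
proof -
  have "weak_gradient p \<Omega> u (wgrad p \<Omega> u)"
    unfolding wgrad_def by (rule someI[of _ g]) (use assms in \<open>simp add: has_grad_def\<close>)
  then have w: "has_grad u (wgrad p \<Omega> u)" using assms by (simp add: has_grad_def)
  have "AE x in M. wgrad p \<Omega> u x = g x" by (rule has_grad_unique[OF w assms])
  then have "AE x in M. \<bar>u x\<bar> powr p + norm (wgrad p \<Omega> u x) powr p = \<bar>u x\<bar> powr p + norm (g x) powr p"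
    by eventually_elim simp
  then show ?thesis unfolding W1p_norm_p_def
    using has_grad_energy_integrable[OF assms] has_grad_energy_integrable[OF w]
    by (intro integral_cong_AE) auto
qed

lemma N_nonneg: "0 \<le> N u"
  unfolding W1p_norm_p_def by (intro integral_nonneg_AE) auto

lemma N_scale:
  assumes "u \<in> W1p p \<Omega>"
  shows "N (\<lambda>x. c * u x) = \<bar>c\<bar> powr p * N u"
proof -
  obtain g where g: "has_grad u g" using assms by (auto simp: W1p_iff)
  show ?thesis
    unfolding N_eq[OF g] N_eq[OF has_grad_scale[OF g]]
    by (simp add: powr_mult abs_mult flip: integral_mult_right_zero distrib_left)
qed

lemma N_add_le:
  assumes "u \<in> W1p p \<Omega>" "v \<in> W1p p \<Omega>" "0 < l" "l < 1"
  shows "N (\<lambda>x. u x + v x) \<le> l powr (- p) * N u + (1 - l) powr (- p) * N v"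
proof -
  obtain g where g: "has_grad u g" using assms by (auto simp: W1p_iff)
  obtain k where k: "has_grad v k" using assms by (auto simp: W1p_iff)
  let ?e = "\<lambda>u g x. \<bar>u x\<bar> powr p + norm (g x) powr p"
  note i = has_grad_energy_integrable[OF g] has_grad_energy_integrable[OF k]
  have "N (\<lambda>x. u x + v x) = integral\<^sup>L M (?e (\<lambda>x. u x + v x) (\<lambda>x. g x + k x))"
    by (rule N_eq[OF has_grad_add[OF g k]])
  also have "\<dots> \<le> integral\<^sup>L M (\<lambda>x. l powr (- p) * ?e u g x + (1 - l) powr (- p) * ?e v k x)"
  proof (rule integral_mono)
    fix x
    show "?e (\<lambda>x. u x + v x) (\<lambda>x. g x + k x) x \<le> l powr (- p) * ?e u g x + (1 - l) powr (- p) * ?e v k x"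
      using norm_add_powr_le[OF assms(3,4) p_pos, of "u x" "v x"] norm_add_powr_le[OF assms(3,4) p_pos, of "g x" "k x"]
      by (simp add: distrib_left)
  qed (use has_grad_energy_integrable[OF has_grad_add[OF g k]] i in auto)
  also have "\<dots> = l powr (- p) * N u + (1 - l) powr (- p) * N v"
    unfolding N_eq[OF g] N_eq[OF k] using i by (simp del: Bochner_Integration.integral_add add: Bochner_Integration.integral_add[where f = "\<lambda>x. l powr (- p) * ?e u g x"])
  finally show ?thesis .
qed

lemma N_add_le_2:
  assumes "u \<in> W1p p \<Omega>" "v \<in> W1p p \<Omega>"
  shows "N (\<lambda>x. u x + v x) \<le> 2 powr p * (N u + N v)"
  using N_add_le[OF assms, of "1/2"] by (simp add: powr_minus powr_divide distrib_left)

lemma W1p_add: "u \<in> W1p p \<Omega> \<Longrightarrow> v \<in> W1p p \<Omega> \<Longrightarrow> (\<lambda>x. u x + v x) \<in> W1p p \<Omega>"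
  and W1p_scale: "u \<in> W1p p \<Omega> \<Longrightarrow> (\<lambda>x. c * u x) \<in> W1p p \<Omega>"
  and W1p_diff: "u \<in> W1p p \<Omega> \<Longrightarrow> v \<in> W1p p \<Omega> \<Longrightarrow> (\<lambda>x. u x - v x) \<in> W1p p \<Omega>"
  unfolding W1p_iff by (blast intro: has_grad_add has_grad_scale has_grad_diff)+

lemma N_minus_commute:
  assumes "u \<in> W1p p \<Omega>" "v \<in> W1p p \<Omega>"
  shows "N (\<lambda>x. u x - v x) = N (\<lambda>x. v x - u x)"
  using N_scale[OF W1p_diff[OF assms], of "-1"] by simp

lemma N_diff_triangle:
  assumes "u \<in> W1p p \<Omega>" "v \<in> W1p p \<Omega>" "w \<in> W1p p \<Omega>"
  shows "N (\<lambda>x. u x - w x) \<le> 2 powr p * (N (\<lambda>x. u x - v x) + N (\<lambda>x. v x - w x))"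
  using N_add_le_2[OF W1p_diff[OF assms(1,2)] W1p_diff[OF assms(2,3)]] by simp

end

section \<open>The closure \<open>W1p_tilde\<close>: linear structure and stability under C1
  contractions\<close>

context sobolev_domain begin

lemma tilde_imp_W1p: "u \<in> W1p_tilde p \<Omega> \<Longrightarrow> u \<in> W1p p \<Omega>"
  by (simp add: W1p_tilde_def)

lemma Cc_imp_W1p: "u \<in> Cc_W1p p \<Omega> \<Longrightarrow> u \<in> W1p p \<Omega>"
  by (simp add: Cc_W1p_def)

lemma Cc_imp_tilde:
  assumes "u \<in> Cc_W1p p \<Omega>"
  shows "u \<in> W1p_tilde p \<Omega>"
proof -
  have "N (\<lambda>x. 0 * u x) = 0" using N_scale[OF Cc_imp_W1p[OF assms], of 0] by simp
  then have "(\<lambda>n::nat. N (\<lambda>x. u x - u x)) \<longlonglongrightarrow> 0" by simp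
  then show ?thesis
    unfolding W1p_tilde_def using assms Cc_imp_W1p by (auto intro!: exI[of _ "\<lambda>_. u"])
qed

lemma CcE:
  assumes "u \<in> Cc_W1p p \<Omega>"
  obtains v where "continuous_on (closure \<Omega>) v" "compact (closure {x \<in> closure \<Omega>. v x \<noteq> 0})"
    "\<And>x. x \<in> \<Omega> \<Longrightarrow> u x = v x"
  using assms unfolding Cc_W1p_def by blast

lemma compact_closure_subset:
  fixes S T :: "'b::euclidean_space set"
  assumes "compact (closure T)" "S \<subseteq> T"
  shows "compact (closure S)"
  using assms by (meson bounded_closure bounded_subset closed_closure closure_subset compact_eq_bounded_closed)

lemma Cc_add:
  assumes "u \<in> Cc_W1p p \<Omega>" "w \<in> Cc_W1p p \<Omega>"
  shows "(\<lambda>x. u x + w x) \<in> Cc_W1p p \<Omega>"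
proof -
  obtain v where v: "continuous_on (closure \<Omega>) v" "compact (closure {x \<in> closure \<Omega>. v x \<noteq> 0})"
    "\<And>x. x \<in> \<Omega> \<Longrightarrow> u x = v x" using CcE[OF assms(1)] by blast
  obtain v' where v': "continuous_on (closure \<Omega>) v'" "compact (closure {x \<in> closure \<Omega>. v' x \<noteq> 0})"
    "\<And>x. x \<in> \<Omega> \<Longrightarrow> w x = v' x" using CcE[OF assms(2)] by blast
  have "compact (closure {x \<in> closure \<Omega>. v x + v' x \<noteq> 0})"
  proof (rule compact_closure_subset)
    show "compact (closure ({x \<in> closure \<Omega>. v x \<noteq> 0} \<union> {x \<in> closure \<Omega>. v' x \<noteq> 0}))"
      unfolding closure_Un using v(2) v'(2) by (rule compact_Un)
  qed auto
  moreover have "continuous_on (closure \<Omega>) (\<lambda>x. v x + v' x)" using v(1) v'(1) by (rule continuous_on_add)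
  moreover have "(\<lambda>x. u x + w x) \<in> W1p p \<Omega>" using assms Cc_imp_W1p W1p_add by blast
  ultimately show ?thesis unfolding Cc_W1p_def using v(3) v'(3)
    by (auto intro!: exI[of _ "\<lambda>x. v x + v' x"])
qed

lemma Cc_compose:
  assumes "u \<in> Cc_W1p p \<Omega>" "continuous_on UNIV F" "F 0 = 0" "(\<lambda>x. F (u x)) \<in> W1p p \<Omega>"
  shows "(\<lambda>x. F (u x)) \<in> Cc_W1p p \<Omega>"
proof -
  obtain v where v: "continuous_on (closure \<Omega>) v" "compact (closure {x \<in> closure \<Omega>. v x \<noteq> 0})"
    "\<And>x. x \<in> \<Omega> \<Longrightarrow> u x = v x" using CcE[OF assms(1)] by blast
  have "compact (closure {x \<in> closure \<Omega>. F (v x) \<noteq> 0})"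
    by (rule compact_closure_subset[OF v(2)]) (use assms(3) in auto)
  moreover have "continuous_on (closure \<Omega>) (\<lambda>x. F (v x))"
    by (rule continuous_on_compose2[OF assms(2) v(1)]) simp
  ultimately show ?thesis unfolding Cc_W1p_def using v(3) assms(4)
    by (auto intro!: exI[of _ "\<lambda>x. F (v x)"])
qed

lemma Cc_scale:
  assumes "u \<in> Cc_W1p p \<Omega>"
  shows "(\<lambda>x. c * u x) \<in> Cc_W1p p \<Omega>"
  by (rule Cc_compose[OF assms, of "\<lambda>t. c * t"])
    (simp_all add: W1p_scale Cc_imp_W1p[OF assms] continuous_on_mult_left)

lemma tilde_approx:
  assumes "u \<in> W1p_tilde p \<Omega>" "e > 0"
  obtains f where "f \<in> Cc_W1p p \<Omega>" "N (\<lambda>x. f x - u x) < e"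
proof -
  obtain f where f: "\<And>n. f n \<in> Cc_W1p p \<Omega>" "(\<lambda>n. N (\<lambda>x. f n x - u x)) \<longlonglongrightarrow> 0"
    using assms(1) unfolding W1p_tilde_def by blast
  then have "eventually (\<lambda>n. N (\<lambda>x. f n x - u x) < e) sequentially"
    using assms(2) by (auto dest: order_tendstoD)
  then obtain n where "N (\<lambda>x. f n x - u x) < e" by (auto simp: eventually_sequentially)
  with f(1) show ?thesis by (rule that)
qed

text \<open>A closure is closed: two successive approximations are combined, and the constant
  \<open>2 powr p\<close> of \<open>N_diff_triangle\<close> is absorbed. Approximants may therefore
  be taken in \<open>W1p_tilde\<close> itself, for instance partial sums.\<close>

lemma tildeI:
  assumes "u \<in> W1p p \<Omega>" "\<And>e. e > 0 \<Longrightarrow> \<exists>f\<in>W1p_tilde p \<Omega>. N (\<lambda>x. f x - u x) < e"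
  shows "u \<in> W1p_tilde p \<Omega>"
proof -
  have "\<exists>f\<in>Cc_W1p p \<Omega>. N (\<lambda>x. f x - u x) < 2 powr p * (2 * inverse (real (Suc n)))" for n
  proof -
    let ?e = "inverse (real (Suc n))"
    have e: "?e > 0" by simp
    obtain v where v: "v \<in> W1p_tilde p \<Omega>" "N (\<lambda>x. v x - u x) < ?e" using assms(2)[OF e] by blast
    obtain f where f: "f \<in> Cc_W1p p \<Omega>" "N (\<lambda>x. f x - v x) < ?e" using tilde_approx[OF v(1) e] by blast
    have "N (\<lambda>x. f x - u x) \<le> 2 powr p * (N (\<lambda>x. f x - v x) + N (\<lambda>x. v x - u x))"
      by (rule N_diff_triangle[OF Cc_imp_W1p[OF f(1)] tilde_imp_W1p[OF v(1)] assms(1)])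
    also have "\<dots> < 2 powr p * (?e + ?e)" using f(2) v(2) by (intro mult_strict_left_mono add_strict_mono) auto
    also have "\<dots> = 2 powr p * (2 * ?e)" by simp
    finally show ?thesis using f(1) by blast
  qed
  then obtain f where f: "\<And>n. f n \<in> Cc_W1p p \<Omega>" "\<And>n. N (\<lambda>x. f n x - u x) < 2 powr p * (2 * inverse (real (Suc n)))"
    by metis
  have "(\<lambda>n. N (\<lambda>x. f n x - u x)) \<longlonglongrightarrow> 0"
  proof (rule real_tendsto_sandwich[OF _ _ tendsto_const])
    show "(\<lambda>n. 2 powr p * (2 * inverse (real (Suc n)))) \<longlonglongrightarrow> 0"
      by (intro tendsto_mult_right_zero LIMSEQ_inverse_real_of_nat)
    show "eventually (\<lambda>n. N (\<lambda>x. f n x - u x) \<le> 2 powr p * (2 * inverse (real (Suc n)))) sequentially"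
      by (intro always_eventually allI less_imp_le f(2))
  qed (auto simp: N_nonneg)
  with f(1) assms(1) show ?thesis unfolding W1p_tilde_def by blast
qed

lemma tilde_add:
  assumes "u \<in> W1p_tilde p \<Omega>" "v \<in> W1p_tilde p \<Omega>"
  shows "(\<lambda>x. u x + v x) \<in> W1p_tilde p \<Omega>"
proof (rule tildeI)
  note uW = tilde_imp_W1p[OF assms(1)] and vW = tilde_imp_W1p[OF assms(2)]
  show "(\<lambda>x. u x + v x) \<in> W1p p \<Omega>" by (rule W1p_add[OF uW vW])
  fix e :: real assume "e > 0"
  let ?d = "e / (2 * 2 powr p)"
  have d: "?d > 0" using \<open>e > 0\<close> by simp
  obtain f where f: "f \<in> Cc_W1p p \<Omega>" "N (\<lambda>x. f x - u x) < ?d" using tilde_approx[OF assms(1) d] by blast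
  obtain g where g: "g \<in> Cc_W1p p \<Omega>" "N (\<lambda>x. g x - v x) < ?d" using tilde_approx[OF assms(2) d] by blast
  have "N (\<lambda>x. (f x - u x) + (g x - v x)) \<le> 2 powr p * (N (\<lambda>x. f x - u x) + N (\<lambda>x. g x - v x))"
    by (intro N_add_le_2 W1p_diff Cc_imp_W1p f g uW vW)
  also have "\<dots> < 2 powr p * (?d + ?d)" using f g by (intro mult_strict_left_mono add_strict_mono) auto
  also have "\<dots> = e" by simp
  finally have "N (\<lambda>x. (f x + g x) - (u x + v x)) < e" by (simp add: algebra_simps)
  then show "\<exists>f\<in>W1p_tilde p \<Omega>. N (\<lambda>x. f x - (u x + v x)) < e"
    using Cc_imp_tilde[OF Cc_add[OF f(1) g(1)]] by (rule bexI)
qed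

lemma tilde_scale:
  assumes "u \<in> W1p_tilde p \<Omega>"
  shows "(\<lambda>x. c * u x) \<in> W1p_tilde p \<Omega>"
proof (rule tildeI)
  note uW = tilde_imp_W1p[OF assms]
  show "(\<lambda>x. c * u x) \<in> W1p p \<Omega>" by (rule W1p_scale[OF uW])
  fix e :: real assume "e > 0"
  \<comment> \<open>The added 1 keeps the denominator positive when \<open>c = 0\<close>.\<close>
  let ?d = "e / (\<bar>c\<bar> powr p + 1)"
  have d: "?d > 0" using \<open>e > 0\<close> by (simp add: add_nonneg_pos)
  obtain f where f: "f \<in> Cc_W1p p \<Omega>" "N (\<lambda>x. f x - u x) < ?d" using tilde_approx[OF assms d] by blast
  have "N (\<lambda>x. c * f x - c * u x) = \<bar>c\<bar> powr p * N (\<lambda>x. f x - u x)"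
    using N_scale[OF W1p_diff[OF Cc_imp_W1p[OF f(1)] uW], of c] by (simp add: right_diff_distrib)
  also have "\<dots> \<le> \<bar>c\<bar> powr p * ?d" using f(2) by (intro mult_left_mono) auto
  also have "\<dots> < e"
  proof -
    have "\<bar>c\<bar> powr p + 1 > 0" by (simp add: add_nonneg_pos)
    then show ?thesis using \<open>e > 0\<close> by (simp add: field_simps)
  qed
  finally show "\<exists>f\<in>W1p_tilde p \<Omega>. N (\<lambda>x. f x - c * u x) < e"
    using Cc_imp_tilde[OF Cc_scale[OF f(1), of c]] by (rule bexI)
qed

lemma has_grad_compose:
  assumes "has_grad u g"
    and F: "\<And>x. (F has_real_derivative F' x) (at x)" "\<And>x. \<bar>F' x\<bar> \<le> 1" "F 0 = 0"
    and F': "continuous_on UNIV F'"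
  shows "has_grad (\<lambda>x. F (u x)) (\<lambda>x. F' (u x) *\<^sub>R g x)"
  unfolding has_grad_def
proof
  have u: "Lp_fun p \<Omega> u" "weak_gradient p \<Omega> u g" using assms(1) by (simp_all add: has_grad_def)
  show "weak_gradient p \<Omega> (\<lambda>x. F (u x)) (\<lambda>x. F' (u x) *\<^sub>R g x)"
    by (rule weak_gradient_chain_rule[OF open_domain p_ge_1 u F borel_measurable_continuous_onI[OF F']])
  have Fb: "F \<in> borel_measurable borel"
    using F(1) DERIV_isCont by (intro borel_measurable_continuous_onI continuous_at_imp_continuous_on) blast
  have "norm (F (u x)) \<le> norm (u x)" for x
    using lipschitz_1_of_derivative[OF F(1,2), of "u x" 0] F(3) by simp
  then have ae: "AE x in M. norm (F (u x)) \<le> norm (u x)" by (intro AE_I2)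
  have m: "(\<lambda>x. F (u x)) \<in> borel_measurable M"
    by (rule measurable_compose[OF _ Fb]) (use u(1) in \<open>simp add: Lp_fun_def\<close>)
  show "Lp_fun p \<Omega> (\<lambda>x. F (u x))"
    using u(1) m ae unfolding Lp_fun_iff_Lp_vec by (rule Lp_vec_dominated[OF p_nonneg])
qed

lemma N_compose_le:
  assumes "u \<in> W1p p \<Omega>"
    and F: "\<And>x. (F has_real_derivative F' x) (at x)" "\<And>x. \<bar>F' x\<bar> \<le> 1" "F 0 = 0"
    and F': "continuous_on UNIV F'"
  shows "(\<lambda>x. F (u x)) \<in> W1p p \<Omega>" "N (\<lambda>x. F (u x)) \<le> N u"
proof -
  obtain g where g: "has_grad u g" using assms(1) by (auto simp: W1p_iff)
  note h = has_grad_compose[OF g F F']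
  show "(\<lambda>x. F (u x)) \<in> W1p p \<Omega>" using h by (auto simp: W1p_iff)
  show "N (\<lambda>x. F (u x)) \<le> N u"
    unfolding N_eq[OF g] N_eq[OF h]
  proof (rule integral_mono[OF has_grad_energy_integrable[OF h] has_grad_energy_integrable[OF g]])
    fix x
    have "\<bar>F (u x)\<bar> powr p \<le> \<bar>u x\<bar> powr p"
      using lipschitz_1_of_derivative[OF F(1,2), of "u x" 0] F(3) p_nonneg by (intro powr_mono2) auto
    moreover have "norm (F' (u x) *\<^sub>R g x) powr p \<le> norm (g x) powr p"
      using F(2)[of "u x"] p_nonneg by (intro powr_mono2) (auto simp: mult_left_le_one_le)
    ultimately show "\<bar>F (u x)\<bar> powr p + norm (F' (u x) *\<^sub>R g x) powr p \<le> \<bar>u x\<bar> powr p + norm (g x) powr p" by simp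
  qed
qed

lemma N_tendsto_0_AE_subseq:
  assumes f: "\<And>n. f n \<in> W1p p \<Omega>" and lim: "(\<lambda>n. N (f n)) \<longlonglongrightarrow> 0"
  obtains k :: "nat \<Rightarrow> nat" where "strict_mono k" "AE x in M. (\<lambda>n. f (k n) x) \<longlonglongrightarrow> 0"
proof -
  have "\<exists>g. has_grad (f n) g" for n using f by (simp add: W1p_iff)
  then obtain g where g: "\<And>n. has_grad (f n) (g n)" by metis
  have i: "integrable M (\<lambda>x. \<bar>f n x\<bar> powr p)" for n
    using Lp_vec_integrable[OF has_grad_Lp(1)[OF g[of n]]] by simp
  have "(\<lambda>n. integral\<^sup>L M (\<lambda>x. norm (\<bar>f n x\<bar> powr p))) \<longlonglongrightarrow> 0"
  proof (rule real_tendsto_sandwich[OF _ _ tendsto_const lim])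
    show "eventually (\<lambda>n. integral\<^sup>L M (\<lambda>x. norm (\<bar>f n x\<bar> powr p)) \<le> N (f n)) sequentially"
      unfolding N_eq[OF g] using i has_grad_energy_integrable[OF g]
      by (intro always_eventually allI integral_mono) auto
  qed (auto intro!: always_eventually integral_nonneg_AE)
  with i obtain k where k: "strict_mono k" "AE x in M. (\<lambda>n. \<bar>f (k n) x\<bar> powr p) \<longlonglongrightarrow> 0"
    using tendsto_L1_AE_subseq[of M "\<lambda>n x. \<bar>f n x\<bar> powr p"] by auto
  from k(2) have "AE x in M. (\<lambda>n. f (k n) x) \<longlonglongrightarrow> 0"
  proof eventually_elim
    case (elim x)
    have "(\<lambda>n. (\<bar>f (k n) x\<bar> powr p) powr (1 / p)) \<longlonglongrightarrow> 0 powr (1 / p)"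
      using elim p_pos by (intro tendsto_powr') (auto intro!: always_eventually)
    then have "(\<lambda>n. \<bar>f (k n) x\<bar>) \<longlonglongrightarrow> 0" using p_pos by (simp add: powr_powr)
    then show ?case by (simp add: tendsto_rabs_zero_iff)
  qed
  with k(1) show ?thesis by (rule that)
qed

text \<open>Bounding \<open>F'\<close> alone does not control the difference of the two composed
  gradients. It splits as \<open>F' (f n x)\<close> times the difference of the gradients, plus
  \<open>F' (f n x) - F' (u x)\<close> times \<open>g x\<close>. The first part is bounded by the
  norm of \<open>f n - u\<close>; the energy \<open>R n\<close> of the second tends to 0 by
  dominated convergence, since \<open>F'\<close> is continuous and \<open>f n\<close> tends to
  \<open>u\<close> almost everywhere along a subsequence.\<close>

lemma tilde_compose:
  assumes u: "u \<in> W1p_tilde p \<Omega>"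
    and F: "\<And>x. (F has_real_derivative F' x) (at x)" "\<And>x. \<bar>F' x\<bar> \<le> 1" "F 0 = 0"
    and F': "continuous_on UNIV F'"
  shows "(\<lambda>x. F (u x)) \<in> W1p_tilde p \<Omega>"
proof (rule tildeI)
  note uW = tilde_imp_W1p[OF u]
  show FuW: "(\<lambda>x. F (u x)) \<in> W1p p \<Omega>" by (rule N_compose_le(1)[OF uW F F'])
  obtain g where g: "has_grad u g" using uW by (auto simp: W1p_iff)
  obtain f0 where f0: "\<And>n. f0 n \<in> Cc_W1p p \<Omega>" "(\<lambda>n. N (\<lambda>x. f0 n x - u x)) \<longlonglongrightarrow> 0"
    using u unfolding W1p_tilde_def by blast
  have d: "(\<lambda>x. f0 n x - u x) \<in> W1p p \<Omega>" for n
    by (rule W1p_diff[OF Cc_imp_W1p[OF f0(1)] uW])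
  obtain k where k: "strict_mono k" "AE x in M. (\<lambda>n. f0 (k n) x - u x) \<longlonglongrightarrow> 0"
    by (rule N_tendsto_0_AE_subseq[OF d f0(2)])
  define f where "f n = f0 (k n)" for n
  have f: "f n \<in> Cc_W1p p \<Omega>" for n using f0 by (simp add: f_def)
  have fN: "(\<lambda>n. N (\<lambda>x. f n x - u x)) \<longlonglongrightarrow> 0"
    using LIMSEQ_subseq_LIMSEQ[OF f0(2) k(1)] by (simp add: f_def o_def)
  have fae: "AE x in M. (\<lambda>n. f n x) \<longlonglongrightarrow> u x"
    using k(2) by eventually_elim (simp add: f_def LIM_zero_iff)
  have "\<exists>q. has_grad (f n) q" for n using Cc_imp_W1p[OF f] by (simp add: W1p_iff)
  then obtain q where q: "\<And>n. has_grad (f n) (q n)" by metis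
  have Fc: "continuous_on UNIV F" using F(1) DERIV_isCont continuous_at_imp_continuous_on by blast
  have F'b: "F' \<in> borel_measurable borel" by (rule borel_measurable_continuous_onI[OF F'])
  have gm: "g \<in> borel_measurable M" and um: "u \<in> borel_measurable M"
    by (rule Lp_vec_measurable[OF has_grad_Lp(2)[OF g]], rule Lp_vec_measurable[OF has_grad_Lp(1)[OF g]])
  have fm: "f n \<in> borel_measurable M" for n by (rule Lp_vec_measurable[OF has_grad_Lp(1)[OF q]])
  define R where "R n = integral\<^sup>L M (\<lambda>x. norm ((F' (f n x) - F' (u x)) *\<^sub>R g x) powr p)" for n
  have bnd: "\<bar>F' a - F' c\<bar> \<le> 2" for a c using F(2)[of a] F(2)[of c] by linarith
  have Rpt: "norm ((F' (f n x) - F' (u x)) *\<^sub>R g x) powr p \<le> 2 powr p * norm (g x) powr p" for n x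
    using p_nonneg bnd by (auto simp: powr_mult intro!: mult_right_mono powr_mono2)
  have gi: "integrable M (\<lambda>x. 2 powr p * norm (g x) powr p)"
    using Lp_vec_integrable[OF has_grad_Lp(2)[OF g]] by simp
  have Rm: "(\<lambda>x. norm ((F' (f n x) - F' (u x)) *\<^sub>R g x) powr p) \<in> borel_measurable M" for n
    using measurable_compose[OF fm F'b] measurable_compose[OF um F'b] gm by measurable
  have Ri: "integrable M (\<lambda>x. norm ((F' (f n x) - F' (u x)) *\<^sub>R g x) powr p)" for n
    by (rule Bochner_Integration.integrable_bound[OF gi Rm]) (use Rpt in auto)
  have Rlim: "R \<longlonglongrightarrow> 0"
  proof -
    have "(\<lambda>n. R n) \<longlonglongrightarrow> integral\<^sup>L M (\<lambda>x. 0)"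
      unfolding R_def
    proof (rule integral_dominated_convergence[OF _ Rm gi])
      show "AE x in M. (\<lambda>n. norm ((F' (f n x) - F' (u x)) *\<^sub>R g x) powr p) \<longlonglongrightarrow> 0"
        using fae
      proof eventually_elim
        case (elim x)
        have "isCont F' (u x)" using F' by (simp add: continuous_on_eq_continuous_at)
        then have "(\<lambda>n. F' (f n x)) \<longlonglongrightarrow> F' (u x)" using elim by (rule isCont_tendsto_compose)
        then have "(\<lambda>n. norm ((F' (f n x) - F' (u x)) *\<^sub>R g x)) \<longlonglongrightarrow> norm ((F' (u x) - F' (u x)) *\<^sub>R g x)"
          by (intro tendsto_intros)
        then have "(\<lambda>n. norm ((F' (f n x) - F' (u x)) *\<^sub>R g x)) \<longlonglongrightarrow> 0" by simp
        then have "(\<lambda>n. norm ((F' (f n x) - F' (u x)) *\<^sub>R g x) powr p) \<longlonglongrightarrow> 0 powr p"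
          using p_pos by (intro tendsto_powr') (auto intro!: always_eventually)
        then show ?case by simp
      qed
    qed (use Rpt in auto)
    then show ?thesis by simp
  qed
  have le: "N (\<lambda>x. F (f n x) - F (u x)) \<le> 2 powr p * (N (\<lambda>x. f n x - u x) + R n)" for n
  proof -
    let ?G = "\<lambda>x. F' (f n x) *\<^sub>R q n x - F' (u x) *\<^sub>R g x"
    have G: "has_grad (\<lambda>x. F (f n x) - F (u x)) ?G"
      by (rule has_grad_diff[OF has_grad_compose[OF q F F'] has_grad_compose[OF g F F']])
    have D: "has_grad (\<lambda>x. f n x - u x) (\<lambda>x. q n x - g x)" by (rule has_grad_diff[OF q g])
    note iD = has_grad_energy_integrable[OF D]
    have "N (\<lambda>x. F (f n x) - F (u x)) = integral\<^sup>L M (\<lambda>x. \<bar>F (f n x) - F (u x)\<bar> powr p + norm (?G x) powr p)"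
      by (rule N_eq[OF G])
    also have "\<dots> \<le> integral\<^sup>L M (\<lambda>x. 2 powr p * ((\<bar>f n x - u x\<bar> powr p + norm (q n x - g x) powr p)
        + norm ((F' (f n x) - F' (u x)) *\<^sub>R g x) powr p))"
    proof (rule integral_mono[OF has_grad_energy_integrable[OF G]])
      show "integrable M (\<lambda>x. 2 powr p * ((\<bar>f n x - u x\<bar> powr p + norm (q n x - g x) powr p)
        + norm ((F' (f n x) - F' (u x)) *\<^sub>R g x) powr p))"
        by (intro integrable_mult_right Bochner_Integration.integrable_add[OF iD Ri])
      fix x
      have "\<bar>F (f n x) - F (u x)\<bar> powr p \<le> \<bar>f n x - u x\<bar> powr p"
        using lipschitz_1_of_derivative[OF F(1,2)] p_nonneg by (intro powr_mono2) auto
      also have "\<dots> \<le> 2 powr p * \<bar>f n x - u x\<bar> powr p"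
        using p_nonneg by (intro mult_le_cancel_right1[THEN iffD2]) (auto simp: ge_one_powr_ge_zero)
      finally have 1: "\<bar>F (f n x) - F (u x)\<bar> powr p \<le> 2 powr p * \<bar>f n x - u x\<bar> powr p" .
      have "?G x = F' (f n x) *\<^sub>R (q n x - g x) + (F' (f n x) - F' (u x)) *\<^sub>R g x"
        by (simp add: algebra_simps)
      then have "norm (?G x) powr p \<le> 2 powr p * (norm (F' (f n x) *\<^sub>R (q n x - g x)) powr p
          + norm ((F' (f n x) - F' (u x)) *\<^sub>R g x) powr p)"
        using norm_add_powr_le[of "1/2" p "F' (f n x) *\<^sub>R (q n x - g x)" "(F' (f n x) - F' (u x)) *\<^sub>R g x"] p_pos
        by (simp add: powr_minus powr_divide distrib_left del: norm_scaleR)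
      also have "\<dots> \<le> 2 powr p * (norm (q n x - g x) powr p + norm ((F' (f n x) - F' (u x)) *\<^sub>R g x) powr p)"
        using F(2)[of "f n x"] p_nonneg
        by (intro mult_left_mono add_right_mono powr_mono2) (auto simp: mult_left_le_one_le)
      finally show "\<bar>F (f n x) - F (u x)\<bar> powr p + norm (?G x) powr p \<le> 2 powr p * ((\<bar>f n x - u x\<bar> powr p + norm (q n x - g x) powr p)
        + norm ((F' (f n x) - F' (u x)) *\<^sub>R g x) powr p)"
        using 1 by (simp only: distrib_left)
    qed
    also have "\<dots> = 2 powr p * (N (\<lambda>x. f n x - u x) + R n)"
      unfolding N_eq[OF D] R_def using iD Ri[of n]
      by (simp only: integral_mult_right_zero Bochner_Integration.integral_add[OF iD Ri])
    finally show ?thesis .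
  qed
  have "(\<lambda>n. 2 powr p * (N (\<lambda>x. f n x - u x) + R n)) \<longlonglongrightarrow> 2 powr p * (0 + 0)"
    by (intro tendsto_intros fN Rlim)
  then have lim: "(\<lambda>n. 2 powr p * (N (\<lambda>x. f n x - u x) + R n)) \<longlonglongrightarrow> 0"
    by (simp only: add_0 mult_zero_right)
  fix e :: real assume "e > 0"
  with lim have "eventually (\<lambda>n. 2 powr p * (N (\<lambda>x. f n x - u x) + R n) < e) sequentially"
    by (rule order_tendstoD)
  then obtain n where n: "2 powr p * (N (\<lambda>x. f n x - u x) + R n) < e" by (auto simp: eventually_sequentially)
  have "(\<lambda>x. F (f n x)) \<in> Cc_W1p p \<Omega>"
    by (rule Cc_compose[OF f Fc F(3) N_compose_le(1)[OF Cc_imp_W1p[OF f] F F']])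
  then show "\<exists>v\<in>W1p_tilde p \<Omega>. N (\<lambda>x. v x - F (u x)) < e"
    using Cc_imp_tilde le[of n] n by (intro bexI[of _ "\<lambda>x. F (f n x)"]) auto
qed

end

section \<open>Summation of rapidly small functions\<close>

lemma sums_geometric_tail: "(\<lambda>n. (1/2::real) ^ Suc (n + k)) sums ((1/2) ^ k)"
proof -
  have "(\<lambda>n. (1/2::real) ^ n) sums 2" using geometric_sums[of "1/2::real"] by simp
  from sums_mult[OF this, of "(1/2) ^ Suc k"] show ?thesis by (simp add: power_add mult_ac)
qed

lemma dominated_suminf_tail:
  fixes f :: "nat \<Rightarrow> 'b::euclidean_space"
  assumes "\<And>n. norm (f n) \<le> (1/2) ^ Suc n * t"
  shows "summable f" "norm (suminf f - (\<Sum>n<k. f n)) \<le> (1/2) ^ k * t"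
proof -
  have b: "summable (\<lambda>n. (1/2) ^ Suc (n + k) * t)" "(\<Sum>n. (1/2) ^ Suc (n + k) * t) = (1/2) ^ k * t" for k
    using sums_mult2[OF sums_geometric_tail[of k], of t] by (simp_all only: sums_iff)
  have sn: "summable (\<lambda>n. norm (f n))"
    by (rule summable_comparison_test'[OF b(1)[of 0], of 0]) (use assms in simp)
  then show s: "summable f" by (rule summable_norm_cancel)
  have sk: "summable (\<lambda>n. norm (f (n + k)))" by (rule summable_ignore_initial_segment[OF sn])
  have "suminf f - (\<Sum>n<k. f n) = (\<Sum>n. f (n + k))" using suminf_minus_initial_segment[OF s, of k] by simp
  also have "norm \<dots> \<le> (\<Sum>n. norm (f (n + k)))" by (rule summable_norm[OF sk])
  also have "\<dots> \<le> (\<Sum>n. (1/2) ^ Suc (n + k) * t)"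
    by (rule suminf_le[OF assms sk b(1)])
  finally show "norm (suminf f - (\<Sum>n<k. f n)) \<le> (1/2) ^ k * t" using b(2) by simp
qed

context sobolev_domain begin

lemma zero_in_tilde:
  assumes "u \<in> W1p_tilde p \<Omega>"
  shows "(\<lambda>x. 0) \<in> W1p_tilde p \<Omega>"
  using tilde_scale[OF assms, of 0] by simp

lemma has_grad_0: "has_grad (\<lambda>x. 0) (\<lambda>x. 0)"
  by (rule has_gradI) (auto intro: Lp_vec_0)

lemma has_grad_sum:
  fixes k :: nat
  assumes "\<And>n. has_grad (u n) (g n)"
  shows "has_grad (\<lambda>x. \<Sum>n<k. u n x) (\<lambda>x. \<Sum>n<k. g n x)"
  by (induction k) (simp_all add: has_grad_0 has_grad_add assms)

lemma tilde_sum: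
  fixes k :: nat
  assumes "\<And>n. u n \<in> W1p_tilde p \<Omega>"
  shows "(\<lambda>x. \<Sum>n<k. u n x) \<in> W1p_tilde p \<Omega>"
  by (induction k) (simp_all add: zero_in_tilde[OF assms] tilde_add assms)

text \<open>One factor \<open>(1/2) ^ Suc n\<close> makes the weighted energies summable. The other,
  raised to the power \<open>p\<close>, pays for the weights and yields a geometric pointwise bound
  on \<open>u n\<close> and on its gradient by multiples of one Lp function. Through this lemma
  countably many exceptional sets receive a single admissible function.\<close>

lemma tilde_suminf:
  assumes u: "\<And>n. u n \<in> W1p_tilde p \<Omega>"
    and small: "\<And>n. N (u n) \<le> e * ((1/2) ^ Suc n * ((1/2) ^ Suc n) powr p)"
  shows "AE x in M. summable (\<lambda>n. u n x)"
    and "(\<lambda>x. \<Sum>n. u n x) \<in> W1p_tilde p \<Omega>"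
    and "N (\<lambda>x. \<Sum>n. u n x) \<le> 2 * e"
proof -
  define c :: "nat \<Rightarrow> real" where "c n = (1/2) ^ Suc n" for n
  have c: "c n > 0" for n by (simp add: c_def)
  have "\<exists>g. has_grad (u n) g" for n using tilde_imp_W1p[OF u] by (simp add: W1p_iff)
  then obtain g where g: "\<And>n. has_grad (u n) (g n)" by metis
  \<comment> \<open>The sum \<open>T\<close> of the energies weighted by \<open>c n powr (- p)\<close> is integrable and satisfies
    \<open>\<bar>u n x\<bar> \<le> c n * T x powr (1 / p)\<close>, so \<open>T powr (1 / p)\<close> dominates all partial sums.\<close>
  define A where "A n x = c n powr (- p) * (\<bar>u n x\<bar> powr p + norm (g n x) powr p)" for n x
  have A0: "0 \<le> A n x" for n x by (simp add: A_def)
  have Ai: "integrable M (A n)" for n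
    unfolding A_def using has_grad_energy_integrable[OF g] by (rule integrable_mult_right)
  have AN: "integral\<^sup>L M (A n) = c n powr (- p) * N (u n)" for n
    unfolding A_def N_eq[OF g] by (rule integral_mult_right_zero)
  have Ale: "integral\<^sup>L M (A n) \<le> e * c n" for n
  proof -
    have "c n powr (- p) * N (u n) \<le> c n powr (- p) * (e * (c n * c n powr p))"
      using small[of n] by (intro mult_left_mono) (auto simp: c_def)
    also have "\<dots> = e * c n" using c[of n] by (simp add: powr_minus field_simps)
    finally show ?thesis by (simp add: AN)
  qed
  have cs: "summable (\<lambda>n. e * c n)" "(\<Sum>n. e * c n) = e"
  proof -
    have "c sums 1" using sums_geometric_tail[of 0] by (simp add: c_def[abs_def])
    from sums_mult[OF this, of e] show "summable (\<lambda>n. e * c n)" "(\<Sum>n. e * c n) = e"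
      by (simp_all add: sums_iff)
  qed
  have Is: "summable (\<lambda>n. integral\<^sup>L M (A n))"
    by (rule summable_comparison_test'[OF cs(1), of 0])
       (use Ale A0 in \<open>simp add: abs_of_nonneg integral_nonneg_AE\<close>)
  have "(\<integral>\<^sup>+x. (\<Sum>n. ennreal (A n x)) \<partial>M) = (\<Sum>n. \<integral>\<^sup>+x. ennreal (A n x) \<partial>M)"
    by (rule nn_integral_suminf) (use Ai in auto)
  also have "\<dots> = (\<Sum>n. ennreal (integral\<^sup>L M (A n)))"
    by (intro suminf_cong nn_integral_eq_integral Ai) (use A0 in auto)
  also have "\<dots> = ennreal (\<Sum>n. integral\<^sup>L M (A n))"
    by (rule suminf_ennreal2[OF _ Is]) (use A0 in \<open>simp add: integral_nonneg_AE\<close>)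
  finally have "(\<integral>\<^sup>+x. (\<Sum>n. ennreal (A n x)) \<partial>M) \<noteq> \<infinity>" by simp
  then have "AE x in M. (\<Sum>n. ennreal (A n x)) \<noteq> \<infinity>"
    by (intro nn_integral_PInf_AE) (use Ai in auto)
  then have As: "AE x in M. summable (\<lambda>n. A n x)"
    by eventually_elim (use A0 in \<open>auto intro: summable_suminf_not_top\<close>)
  define T where "T x = (\<Sum>n. A n x)" for x
  have As': "AE x in M. summable (\<lambda>n. norm (A n x))"
    using As by eventually_elim (simp add: A0)
  have Is': "summable (\<lambda>n. integral\<^sup>L M (\<lambda>x. norm (A n x)))" using Is by (simp add: A0)
  have Ti: "integrable M T" unfolding T_def by (rule integrable_suminf[OF Ai As' Is'])
  have "integral\<^sup>L M T = (\<Sum>n. integral\<^sup>L M (A n))" unfolding T_def by (rule integral_suminf[OF Ai As' Is'])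
  also have "\<dots> \<le> (\<Sum>n. e * c n)" by (rule suminf_le[OF Ale Is cs(1)])
  finally have Te: "integral\<^sup>L M T \<le> e" using cs(2) by simp
  define t where "t x = T x powr (1 / p)" for x
  have T0: "AE x in M. 0 \<le> T x"
    using As by eventually_elim (auto simp: T_def A0 intro: suminf_nonneg)
  have tp: "AE x in M. t x powr p = T x"
    using T0 by eventually_elim (use p_pos in \<open>simp add: t_def powr_powr\<close>)
  have bnd: "AE x in M. \<forall>n. \<bar>u n x\<bar> \<le> c n * t x \<and> norm (g n x) \<le> c n * t x"
    using As T0
  proof (eventually_elim, intro allI)
    case (elim x)
    fix n
    have "A n x \<le> T x"
      using sum_le_suminf[OF elim(1), of "{n}"] A0 by (simp add: T_def)
    then have "c n powr p * A n x \<le> c n powr p * T x" by (intro mult_left_mono) auto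
    moreover have "c n powr p * A n x = \<bar>u n x\<bar> powr p + norm (g n x) powr p"
      using c[of n] by (simp add: A_def powr_minus)
    ultimately have le: "\<bar>u n x\<bar> powr p + norm (g n x) powr p \<le> c n powr p * T x"
      by simp
    have *: "a \<le> c n * t x" if "0 \<le> a" "a powr p \<le> c n powr p * T x" for a
    proof -
      have "a = (a powr p) powr (1 / p)" using that(1) p_pos by (simp add: powr_powr)
      also have "\<dots> \<le> (c n powr p * T x) powr (1 / p)" using that(2) p_pos by (intro powr_mono2) auto
      also have "\<dots> = c n * t x" using c[of n] elim(2) p_pos by (simp add: powr_mult powr_powr t_def)
      finally show ?thesis .
    qed
    have "\<bar>u n x\<bar> powr p \<le> c n powr p * T x" "norm (g n x) powr p \<le> c n powr p * T x"
      using le powr_ge_zero[of "\<bar>u n x\<bar>" p] powr_ge_zero[of "norm (g n x)" p] by linarith+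
    then show "\<bar>u n x\<bar> \<le> c n * t x \<and> norm (g n x) \<le> c n * t x" by (auto intro: *)
  qed
  define U where "U x = (\<Sum>n. u n x)" for x
  define G where "G x = (\<Sum>n. g n x)" for x
  define S where "S k x = (\<Sum>n<k. u n x)" for k x
  define H where "H k x = (\<Sum>n<k. g n x)" for k x
  have SH: "has_grad (S k) (H k)" for k unfolding S_def H_def by (rule has_grad_sum[OF g])
  have Sm: "S k \<in> borel_measurable M" and Hm: "H k \<in> borel_measurable M" for k
    by (rule Lp_vec_measurable[OF has_grad_Lp(1)[OF SH]], rule Lp_vec_measurable[OF has_grad_Lp(2)[OF SH]])
  have sumu: "AE x in M. summable (\<lambda>n. u n x)"
    using bnd
  proof eventually_elim
    case (elim x)
    then show ?case using dominated_suminf_tail(1)[of "\<lambda>n. u n x" "t x"] by (simp add: c_def)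
  qed
  show "AE x in M. summable (\<lambda>n. u n x)" by fact
  have sumg: "AE x in M. summable (\<lambda>n. g n x)"
    using bnd
  proof eventually_elim
    case (elim x)
    then show ?case using dominated_suminf_tail(1)[of "\<lambda>n. g n x" "t x"] by (simp add: c_def)
  qed
  have tailU: "AE x in M. \<forall>k. \<bar>U x - S k x\<bar> \<le> (1/2) ^ k * t x"
    using bnd
  proof (eventually_elim, intro allI)
    case (elim x)
    fix k
    show "\<bar>U x - S k x\<bar> \<le> (1/2) ^ k * t x"
      using dominated_suminf_tail(2)[of "\<lambda>n. u n x" "t x" k] elim by (simp add: U_def S_def c_def)
  qed
  have tailG: "AE x in M. \<forall>k. norm (G x - H k x) \<le> (1/2) ^ k * t x"
    using bnd
  proof (eventually_elim, intro allI)
    case (elim x)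
    fix k
    show "norm (G x - H k x) \<le> (1/2) ^ k * t x"
      using dominated_suminf_tail(2)[of "\<lambda>n. g n x" "t x" k] elim by (simp add: G_def H_def c_def)
  qed
  have um: "u n \<in> borel_measurable M" and gm: "g n \<in> borel_measurable M" for n
    by (rule Lp_vec_measurable[OF has_grad_Lp(1)[OF g]], rule Lp_vec_measurable[OF has_grad_Lp(2)[OF g]])
  have Um: "U \<in> borel_measurable M" unfolding U_def using um by (rule borel_measurable_suminf)
  have Gm: "G \<in> borel_measurable M" unfolding G_def using gm by (rule borel_measurable_suminf)
  have tm: "t \<in> borel_measurable M"
    unfolding t_def using borel_measurable_integrable[OF Ti] by measurable
  have tLp: "Lp_vec p \<Omega> t"
    unfolding Lp_vec_def
  proof
    show "integrable M (\<lambda>x. norm (t x) powr p)"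
    proof (rule integrable_cong_AE_imp[OF Ti])
      show "(\<lambda>x. norm (t x) powr p) \<in> borel_measurable M" using tm by measurable
      show "AE x in M. T x = norm (t x) powr p" using tp by eventually_elim (simp add: t_def)
    qed
  qed (fact tm)
  have t0: "0 \<le> t x" for x by (simp add: t_def)
  have bndS: "AE x in M. \<forall>k. \<bar>S k x\<bar> \<le> 2 * t x"
    using tailU
  proof (eventually_elim, intro allI)
    case (elim x)
    fix k
    have "(1/2) ^ k * t x \<le> 1 * t x" using t0 by (intro mult_right_mono) (auto simp: power_le_one)
    moreover have "\<bar>U x\<bar> \<le> t x" using elim[rule_format, of 0] by (simp add: S_def)
    ultimately show "\<bar>S k x\<bar> \<le> 2 * t x" using elim[rule_format, of k] by linarith
  qed
  have bndH: "AE x in M. \<forall>k. norm (H k x) \<le> 2 * t x"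
    using tailG
  proof (eventually_elim, intro allI)
    case (elim x)
    fix k
    have "(1/2) ^ k * t x \<le> 1 * t x" using t0 by (intro mult_right_mono) (auto simp: power_le_one)
    moreover have "norm (G x) \<le> t x" using elim[rule_format, of 0] by (simp add: H_def)
    moreover have "norm (H k x) \<le> norm (G x) + norm (G x - H k x)"
      using norm_triangle_ineq4[of "G x" "G x - H k x"] by simp
    ultimately show "norm (H k x) \<le> 2 * t x" using elim[rule_format, of k] by linarith
  qed
  have ULp: "Lp_vec p \<Omega> U"
  proof (rule Lp_vec_dominated[OF p_nonneg tLp Um])
    show "AE x in M. norm (U x) \<le> norm (t x)"
      using tailU
    proof eventually_elim
      case (elim x)
      show ?case using elim[rule_format, of 0] t0[of x] by (simp add: S_def)
    qed
  qed
  have GLp: "Lp_vec p \<Omega> G"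
  proof (rule Lp_vec_dominated[OF p_nonneg tLp Gm])
    show "AE x in M. norm (G x) \<le> norm (t x)"
      using tailG
    proof eventually_elim
      case (elim x)
      show ?case using elim[rule_format, of 0] t0[of x] by (simp add: H_def)
    qed
  qed
  have Slim: "AE x in M. (\<lambda>k. S k x) \<longlonglongrightarrow> U x"
    using sumu by eventually_elim (simp add: S_def U_def summable_LIMSEQ)
  have Hlim: "AE x in M. (\<lambda>k. H k x) \<longlonglongrightarrow> G x"
    using sumg by eventually_elim (simp add: H_def G_def summable_LIMSEQ)
  have tLpf: "Lp_fun p \<Omega> t" using tLp by (simp add: Lp_fun_iff_Lp_vec)
  have UG: "has_grad U G"
  proof (rule has_gradI[OF ULp GLp])
    fix b :: 'a and \<phi> assume b: "b \<in> Basis" and \<phi>: "test_fun \<Omega> \<phi>"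
    let ?d = "\<lambda>x. frechet_derivative \<phi> (at x) b"
    note \<phi>m = test_fun_borel_measurable_lebesgue_on[OF \<phi>]
    \<comment> \<open>The weak identity passes to the limit because \<open>t\<close> is locally
      integrable and test functions have compact support.\<close>
    have 1: "(\<lambda>k. integral\<^sup>L M (\<lambda>x. S k x * ?d x)) \<longlonglongrightarrow> integral\<^sup>L M (\<lambda>x. U x * ?d x)"
    proof (rule integral_dominated_convergence[where w = "\<lambda>x. 2 * \<bar>t x * ?d x\<bar>"])
      show "integrable M (\<lambda>x. 2 * \<bar>t x * ?d x\<bar>)"
        using integrable_abs[OF test_fun_mult_integrable(2)[OF tLpf \<phi>, of b]] by (rule integrable_mult_right)
      show "AE x in M. (\<lambda>k. S k x * ?d x) \<longlonglongrightarrow> U x * ?d x"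
        using Slim by eventually_elim (rule tendsto_mult_right)
      show "AE x in M. norm (S k x * ?d x) \<le> 2 * \<bar>t x * ?d x\<bar>" for k
        using bndS
      proof eventually_elim
        case (elim x)
        have "\<bar>S k x\<bar> * \<bar>?d x\<bar> \<le> (2 * t x) * \<bar>?d x\<bar>" using elim by (intro mult_right_mono) auto
        then show ?case using t0[of x] by (simp add: abs_mult)
      qed
    qed (intro borel_measurable_times Um Sm \<phi>m)+
    have 2: "(\<lambda>k. integral\<^sup>L M (\<lambda>x. (H k x \<bullet> b) * \<phi> x)) \<longlonglongrightarrow> integral\<^sup>L M (\<lambda>x. (G x \<bullet> b) * \<phi> x)"
    proof (rule integral_dominated_convergence[where w = "\<lambda>x. 2 * \<bar>t x * \<phi> x\<bar>"])
      show "integrable M (\<lambda>x. 2 * \<bar>t x * \<phi> x\<bar>)"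
        using integrable_abs[OF test_fun_mult_integrable(1)[OF tLpf \<phi>]] by (rule integrable_mult_right)
      show "AE x in M. (\<lambda>k. (H k x \<bullet> b) * \<phi> x) \<longlonglongrightarrow> (G x \<bullet> b) * \<phi> x"
        using Hlim by eventually_elim (intro tendsto_mult_right tendsto_inner tendsto_const)
      show "AE x in M. norm ((H k x \<bullet> b) * \<phi> x) \<le> 2 * \<bar>t x * \<phi> x\<bar>" for k
        using bndH
      proof eventually_elim
        case (elim x)
        have "\<bar>H k x \<bullet> b\<bar> \<le> 2 * t x" using Basis_le_norm[OF b, of "H k x"] elim[rule_format, of k] by linarith
        then have "\<bar>H k x \<bullet> b\<bar> * \<bar>\<phi> x\<bar> \<le> (2 * t x) * \<bar>\<phi> x\<bar>" by (intro mult_right_mono) auto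
        then show ?case using t0[of x] by (simp add: abs_mult)
      qed
    qed (intro borel_measurable_times borel_measurable_inner borel_measurable_const Gm Hm \<phi>m)+
    have "(\<lambda>k. - integral\<^sup>L M (\<lambda>x. (H k x \<bullet> b) * \<phi> x)) \<longlonglongrightarrow> integral\<^sup>L M (\<lambda>x. U x * ?d x)"
      using 1 unfolding has_grad_integral[OF SH b \<phi>] .
    from LIMSEQ_unique[OF this tendsto_minus[OF 2]]
    show "integral\<^sup>L M (\<lambda>x. U x * ?d x) = - integral\<^sup>L M (\<lambda>x. (G x \<bullet> b) * \<phi> x)" .
  qed
  \<comment> \<open>The factor 2 arises because the function and its gradient are each bounded by
    the same tail; \<open>k = 0\<close> gives the norm bound of the whole sum.\<close>
  have Ndiff: "N (\<lambda>x. U x - S k x) \<le> ((1/2) ^ k) powr p * (2 * e)" for k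
  proof -
    note D = has_grad_diff[OF UG SH[of k]]
    have "N (\<lambda>x. U x - S k x) = integral\<^sup>L M (\<lambda>x. \<bar>U x - S k x\<bar> powr p + norm (G x - H k x) powr p)"
      by (rule N_eq[OF D])
    also have "\<dots> \<le> integral\<^sup>L M (\<lambda>x. ((1/2) ^ k) powr p * 2 * T x)"
    proof (rule integral_mono_AE[OF has_grad_energy_integrable[OF D] integrable_mult_right[OF Ti]])
      show "AE x in M. \<bar>U x - S k x\<bar> powr p + norm (G x - H k x) powr p \<le> ((1/2) ^ k) powr p * 2 * T x"
        using tailU tailG tp
      proof eventually_elim
        case (elim x)
        have "\<bar>U x - S k x\<bar> powr p \<le> ((1/2) ^ k * t x) powr p" "norm (G x - H k x) powr p \<le> ((1/2) ^ k * t x) powr p"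
          using elim(1,2) p_nonneg by (auto intro!: powr_mono2)
        then show ?case using elim(3) t0[of x] by (simp add: powr_mult)
      qed
    qed
    also have "\<dots> = ((1/2) ^ k) powr p * 2 * integral\<^sup>L M T" by (rule integral_mult_right_zero)
    also have "\<dots> \<le> ((1/2) ^ k) powr p * 2 * e" using Te by (intro mult_left_mono) auto
    finally show ?thesis by (simp add: mult.assoc)
  qed
  have UW: "U \<in> W1p p \<Omega>" using UG by (auto simp: W1p_iff)
  have SW: "S k \<in> W1p p \<Omega>" for k using SH by (auto simp: W1p_iff)
  have "U \<in> W1p_tilde p \<Omega>"
  proof (rule tildeI[OF UW])
    fix r :: real assume "r > 0"
    have "(\<lambda>k. (1/2::real) ^ k) \<longlonglongrightarrow> 0" by (rule LIMSEQ_power_zero) simp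
    then have "(\<lambda>k. ((1/2::real) ^ k) powr p) \<longlonglongrightarrow> 0 powr p"
      using p_pos by (intro tendsto_powr') (auto intro!: always_eventually)
    then have "(\<lambda>k. ((1/2) ^ k) powr p * (2 * e)) \<longlonglongrightarrow> 0 * (2 * e)"
      by (intro tendsto_mult_right) simp
    then have "(\<lambda>k. ((1/2) ^ k) powr p * (2 * e)) \<longlonglongrightarrow> 0" by (simp only: mult_zero_left)
    then have "eventually (\<lambda>k. ((1/2) ^ k) powr p * (2 * e) < r) sequentially"
      using \<open>r > 0\<close> by (rule order_tendstoD)
    then obtain k where "((1/2) ^ k) powr p * (2 * e) < r" by (auto simp: eventually_sequentially)
    then have "N (\<lambda>x. S k x - U x) < r"
      using Ndiff[of k] N_minus_commute[OF UW SW[of k]] by simp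
    moreover have "S k \<in> W1p_tilde p \<Omega>" unfolding S_def by (rule tilde_sum[OF u])
    ultimately show "\<exists>f\<in>W1p_tilde p \<Omega>. N (\<lambda>x. f x - U x) < r" by blast
  qed
  then show "(\<lambda>x. \<Sum>n. u n x) \<in> W1p_tilde p \<Omega>" by (simp add: U_def[abs_def])
  show "N (\<lambda>x. \<Sum>n. u n x) \<le> 2 * e"
    using Ndiff[of 0] by (simp add: S_def U_def[abs_def])
qed

end

section \<open>Capacity and quasi continuous representatives\<close>

definition smooth_abs :: "real \<Rightarrow> real \<Rightarrow> real" where
  "smooth_abs d t = sqrt (t\<^sup>2 + d\<^sup>2) - d"

definition smooth_abs' :: "real \<Rightarrow> real \<Rightarrow> real" where
  "smooth_abs' d t = t / sqrt (t\<^sup>2 + d\<^sup>2)"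

lemma smooth_abs_derivative:
  assumes "d > 0"
  shows "(smooth_abs d has_real_derivative smooth_abs' d t) (at t)"
proof -
  have pos: "t\<^sup>2 + d\<^sup>2 > 0" using assms by (simp add: add_nonneg_pos)
  have "((\<lambda>t. t\<^sup>2 + d\<^sup>2) has_real_derivative 2 * t) (at t)"
    by (auto intro!: derivative_eq_intros)
  then have "((\<lambda>t. sqrt (t\<^sup>2 + d\<^sup>2)) has_real_derivative inverse (sqrt (t\<^sup>2 + d\<^sup>2)) / 2 * (2 * t)) (at t)"
    by (rule DERIV_chain2[where f = sqrt and g = "\<lambda>t. t\<^sup>2 + d\<^sup>2" and x = t, OF DERIV_real_sqrt[OF pos]])
  from DERIV_diff[OF this DERIV_const[of d]]
  have "((\<lambda>t. sqrt (t\<^sup>2 + d\<^sup>2) - d) has_real_derivative inverse (sqrt (t\<^sup>2 + d\<^sup>2)) / 2 * (2 * t) - 0) (at t)" .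
  moreover have "inverse a / 2 * (2 * t) - 0 = t / a" for a :: real by (simp add: field_simps)
  ultimately show ?thesis unfolding smooth_abs_def[abs_def] smooth_abs'_def by (simp only:)
qed

lemma smooth_abs'_bound:
  assumes "d > 0"
  shows "\<bar>smooth_abs' d t\<bar> \<le> 1"
proof -
  have "0 < sqrt (t\<^sup>2 + d\<^sup>2)" using assms by (simp add: add_nonneg_pos)
  moreover have "\<bar>t\<bar> \<le> sqrt (t\<^sup>2 + d\<^sup>2)" by (rule real_le_rsqrt) simp
  ultimately show ?thesis by (simp add: smooth_abs'_def)
qed

lemma smooth_abs'_continuous: "d > 0 \<Longrightarrow> continuous_on UNIV (smooth_abs' d)"
  unfolding smooth_abs'_def by (intro continuous_intros) (auto simp: add_nonneg_eq_0_iff)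

lemma smooth_abs_0: "d > 0 \<Longrightarrow> smooth_abs d 0 = 0"
  by (simp add: smooth_abs_def)

lemma smooth_abs_nonneg: "d > 0 \<Longrightarrow> 0 \<le> smooth_abs d t"
  unfolding smooth_abs_def by (simp add: real_le_rsqrt)

lemma smooth_abs_ge: "\<bar>t\<bar> - d \<le> smooth_abs d t"
  unfolding smooth_abs_def by (simp add: real_le_rsqrt)

text \<open>The parameter 3/4 comes from the Pythagorean triple 3, 4, 5: for
  \<open>\<bar>t\<bar> = 1\<close> the root is exactly 5/4, which leaves 1/2 after
  subtraction.\<close>

lemma smooth_abs_ge_half:
  assumes "1 \<le> \<bar>t\<bar>"
  shows "1 \<le> 2 * smooth_abs (3/4) t"
proof -
  have "1\<^sup>2 \<le> \<bar>t\<bar>\<^sup>2" using assms by (intro power_mono) auto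
  then have "(5/4)\<^sup>2 \<le> t\<^sup>2 + (3/4)\<^sup>2" by (simp add: power2_eq_square)
  then have "5/4 \<le> sqrt (t\<^sup>2 + (3/4)\<^sup>2)" by (rule real_le_rsqrt)
  then show ?thesis by (simp add: smooth_abs_def)
qed

text \<open>Continuity off \<open>V\<close> makes the preimage open only relative to
  \<open>C - V\<close>. Its union with \<open>V\<close> equals the union of \<open>V\<close> with
  the trace of an open set on \<open>C\<close>. In this way open level sets of a quasi continuous
  function become relatively open at the cost of a set of small capacity.\<close>

lemma openin_union_preimage:
  assumes V: "openin (top_of_set C) V" and f: "continuous_on (C - V) f" and T: "open T"
  shows "openin (top_of_set C) (V \<union> {x \<in> C - V. f x \<in> T})"
proof -
  have "openin (top_of_set (C - V)) ((C - V) \<inter> f -` T)"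
    by (rule continuous_openin_preimage_gen[OF f T])
  then obtain W where W: "open W" "(C - V) \<inter> f -` T = (C - V) \<inter> W"
    unfolding openin_open by blast
  have "V \<subseteq> C" using openin_imp_subset[OF V] .
  then have "V \<union> {x \<in> C - V. f x \<in> T} = V \<union> (C \<inter> W)" using W(2) by blast
  moreover have "openin (top_of_set C) (V \<union> (C \<inter> W))"
    by (intro openin_Un V openin_open_Int W(1))
  ultimately show ?thesis by simp
qed

section \<open>Admissible functions and the two comparisons with the capacity\<close>

context sobolev_domain begin

lemma smooth_abs_tilde:
  assumes "u \<in> W1p_tilde p \<Omega>" "d > 0"
  shows "(\<lambda>x. smooth_abs d (u x)) \<in> W1p_tilde p \<Omega>" "N (\<lambda>x. smooth_abs d (u x)) \<le> N u"
proof -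
  note a = smooth_abs_derivative[OF assms(2)] smooth_abs'_bound[OF assms(2)] smooth_abs_0[OF assms(2)] smooth_abs'_continuous[OF assms(2)]
  show "(\<lambda>x. smooth_abs d (u x)) \<in> W1p_tilde p \<Omega>" by (rule tilde_compose[OF assms(1) a])
  show "N (\<lambda>x. smooth_abs d (u x)) \<le> N u" by (rule N_compose_le(2)[OF tilde_imp_W1p[OF assms(1)] a])
qed

text \<open>By \<open>smooth_abs_ge_half\<close> the new function is still at least 1 wherever
  \<open>w\<close> is, and it is nonnegative. Admissible functions for different sets can thus be
  added without spoiling each other, at the price of a constant factor.\<close>

lemma nonneg_majorant:
  assumes "w \<in> W1p_tilde p \<Omega>"
  shows "(\<lambda>x. 2 * smooth_abs (3/4) (w x)) \<in> W1p_tilde p \<Omega>"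
    "N (\<lambda>x. 2 * smooth_abs (3/4) (w x)) \<le> 2 powr p * N w"
proof -
  have d: "(3/4::real) > 0" by simp
  note a = smooth_abs_tilde[OF assms d]
  show "(\<lambda>x. 2 * smooth_abs (3/4) (w x)) \<in> W1p_tilde p \<Omega>" by (rule tilde_scale[OF a(1)])
  have "N (\<lambda>x. 2 * smooth_abs (3/4) (w x)) = \<bar>2\<bar> powr p * N (\<lambda>x. smooth_abs (3/4) (w x))"
    by (rule N_scale[OF tilde_imp_W1p[OF a(1)]])
  also have "\<dots> \<le> \<bar>2\<bar> powr p * N w" by (intro mult_left_mono a(2)) simp
  finally show "N (\<lambda>x. 2 * smooth_abs (3/4) (w x)) \<le> 2 powr p * N w" by simp
qed

lemma Cap_le: "u \<in> Yset p \<Omega> A \<Longrightarrow> Cap p \<Omega> A \<le> ennreal (N u)"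
  unfolding Cap_def by (rule INF_lower)

lemma Cap_lessE:
  assumes "Cap p \<Omega> A < ennreal e"
  obtains u where "u \<in> Yset p \<Omega> A" "N u < e"
proof -
  obtain u where "u \<in> Yset p \<Omega> A" "ennreal (N u) < ennreal e"
    using assms unfolding Cap_def INF_less_iff by blast
  then show ?thesis using that N_nonneg by (simp add: ennreal_less_iff)
qed

lemma AE_M_iff: "(AE x in M. P x) \<longleftrightarrow> (AE x in lebesgue. x \<in> \<Omega> \<longrightarrow> P x)"
  using domain_sets by (simp add: AE_restrict_space_iff)

lemma Cap_zero_of_AE_ge:
  assumes ut: "qc_rep p \<Omega> u ut" and U: "openin (top_of_set (closure \<Omega>)) U"
    and ae: "AE x in lebesgue. x \<in> U \<inter> \<Omega> \<longrightarrow> u x \<ge> 1"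
  shows "Cap p \<Omega> {x \<in> U. ut x < 1} = 0"
proof -
  have "Cap p \<Omega> {x \<in> U. ut x < 1} \<le> 0 + ennreal e" if "e > 0" for e
  proof -
    obtain V where V: "openin (top_of_set (closure \<Omega>)) V" "Cap p \<Omega> V < ennreal e" "continuous_on (closure \<Omega> - V) ut"
      using ut \<open>e > 0\<close> unfolding qc_rep_def quasi_continuous_def by blast
    obtain w where w: "w \<in> Yset p \<Omega> V" "N w < e" using Cap_lessE[OF V(2)] by blast
    define G where "G = V \<union> {x \<in> closure \<Omega> - V. ut x \<in> {..<1}}"
    define Q where "Q = V \<union> (G \<inter> U)"
    have "openin (top_of_set (closure \<Omega>)) G"
      unfolding G_def by (rule openin_union_preimage[OF V(1,3)]) simp
    then have Q: "openin (top_of_set (closure \<Omega>)) Q"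
      unfolding Q_def by (intro openin_Un openin_Int V(1) U)
    have "U \<subseteq> closure \<Omega>" by (rule openin_imp_subset[OF U])
    then have sub: "{x \<in> U. ut x < 1} \<subseteq> Q" by (auto simp: Q_def G_def)
    obtain V' where V': "V \<subseteq> V'" "AE x in lebesgue. x \<in> V' \<inter> \<Omega> \<longrightarrow> w x \<ge> 1"
      using w(1) unfolding Yset_def by blast
    have "AE x in lebesgue. x \<in> \<Omega> \<longrightarrow> ut x = u x"
      using ut unfolding qc_rep_def AE_M_iff by blast
    with V'(2) ae have "AE x in lebesgue. x \<in> Q \<inter> \<Omega> \<longrightarrow> w x \<ge> 1"
    proof eventually_elim
      case (elim x)
      show ?case
      proof
        assume x: "x \<in> Q \<inter> \<Omega>"
        show "w x \<ge> 1"
        proof (cases "x \<in> V")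
          case True
          then show ?thesis using elim(1) V'(1) x by blast
        next
          case False
          \<comment> \<open>Off a null set this case is contradictory, since there
            \<open>ut x = u x\<close> and \<open>u x\<close> is at least 1.\<close>
          then have "x \<in> U" "ut x < 1" using x by (auto simp: Q_def G_def)
          then show ?thesis using elim(2,3) x by auto
        qed
      qed
    qed
    moreover have "w \<in> W1p_tilde p \<Omega>" using w(1) by (simp add: Yset_def)
    ultimately have "w \<in> Yset p \<Omega> {x \<in> U. ut x < 1}"
      unfolding Yset_def using Q sub by blast
    then have "Cap p \<Omega> {x \<in> U. ut x < 1} \<le> ennreal (N w)" by (rule Cap_le)
    also have "\<dots> \<le> ennreal e" using w(2) by (intro ennreal_leI) simp
    finally show ?thesis by simp
  qed
  then have "Cap p \<Omega> {x \<in> U. ut x < 1} \<le> 0" by (rule ennreal_le_epsilon)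
  then show ?thesis by simp
qed

text \<open>The parameter \<open>s\<close> has three roles: the condition that \<open>ut\<close> is
  at least 1 is relaxed to the open condition \<open>ut x > 1 - s\<close>;
  \<open>smooth_abs s\<close> loses a further \<open>s\<close>, and the factor
  \<open>inverse (1 - 2 * s)\<close> restores the value 1; and \<open>1 - s\<close> is the weight in
  \<open>N_add_le\<close>. The summand \<open>z\<close> covers \<open>V\<close> and a neighbourhood
  of \<open>P\<close>, where the values of \<open>ut\<close> give no information.\<close>

lemma Cap_le_of_qc:
  assumes u: "u \<in> W1p_tilde p \<Omega>" and ut: "qc_rep p \<Omega> u ut" and P: "Cap p \<Omega> P = 0"
    and ge: "\<And>x. x \<in> A - P \<Longrightarrow> ut x \<ge> 1" and A: "A \<subseteq> closure \<Omega>" and s: "0 < s" "s < 1/2"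
  shows "Cap p \<Omega> A \<le> ennreal ((1 - s) powr (- p) * ((1 - 2 * s) powr (- p) * N u) + 4 powr p * 2 * s)"
proof -
  \<comment> \<open>In \<open>N_add_le\<close> the norm of \<open>z\<close> is multiplied by
    \<open>s powr (- p)\<close>; with this \<open>h\<close> its contribution still vanishes with
    \<open>s\<close>.\<close>
  define h where "h = s powr p * s"
  have h: "h > 0" using s by (simp add: h_def)
  obtain V where V: "openin (top_of_set (closure \<Omega>)) V" "Cap p \<Omega> V < ennreal h" "continuous_on (closure \<Omega> - V) ut"
    using ut h unfolding qc_rep_def quasi_continuous_def by blast
  obtain w1 where w1: "w1 \<in> Yset p \<Omega> V" "N w1 < h" using Cap_lessE[OF V(2)] by blast
  have "Cap p \<Omega> P < ennreal h" using P h by simp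
  then obtain w2 where w2: "w2 \<in> Yset p \<Omega> P" "N w2 < h" using Cap_lessE by blast
  have w1t: "w1 \<in> W1p_tilde p \<Omega>" and w2t: "w2 \<in> W1p_tilde p \<Omega>" using w1(1) w2(1) by (auto simp: Yset_def)
  obtain V1 where V1: "V \<subseteq> V1" "AE x in lebesgue. x \<in> V1 \<inter> \<Omega> \<longrightarrow> w1 x \<ge> 1"
    using w1(1) unfolding Yset_def by blast
  obtain V2 where V2: "openin (top_of_set (closure \<Omega>)) V2" "P \<subseteq> V2" "AE x in lebesgue. x \<in> V2 \<inter> \<Omega> \<longrightarrow> w2 x \<ge> 1"
    using w2(1) unfolding Yset_def by blast
  define z1 where "z1 x = 2 * smooth_abs (3/4) (w1 x)" for x
  define z2 where "z2 x = 2 * smooth_abs (3/4) (w2 x)" for x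
  note z1 = nonneg_majorant[OF w1t, folded z1_def] and z2 = nonneg_majorant[OF w2t, folded z2_def]
  define z where "z x = z1 x + z2 x" for x
  have zt: "z \<in> W1p_tilde p \<Omega>" unfolding z_def by (rule tilde_add[OF z1(1) z2(1)])
  have "N z \<le> 2 powr p * (N z1 + N z2)"
    unfolding z_def by (rule N_add_le_2[OF tilde_imp_W1p[OF z1(1)] tilde_imp_W1p[OF z2(1)]])
  also have "\<dots> \<le> 2 powr p * (2 powr p * h + 2 powr p * h)"
  proof (intro mult_left_mono add_mono)
    have "2 powr p * N w1 \<le> 2 powr p * h" "2 powr p * N w2 \<le> 2 powr p * h"
      using w1(2) w2(2) by (auto intro!: mult_left_mono)
    then show "N z1 \<le> 2 powr p * h" "N z2 \<le> 2 powr p * h" using z1(2) z2(2) by linarith+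
  qed simp
  also have "\<dots> = (2 powr p * 2 powr p) * (2 * h)" by simp
  also have "2 powr p * 2 powr p = (4::real) powr p" by (simp flip: powr_mult)
  finally have Nz: "N z \<le> 4 powr p * (2 * h)" .
  define c where "c = inverse (1 - 2 * s)"
  have c: "c > 0" using s by (simp add: c_def)
  define y where "y x = c * smooth_abs s (u x)" for x
  note a = smooth_abs_tilde[OF u s(1)]
  have yt: "y \<in> W1p_tilde p \<Omega>" unfolding y_def by (rule tilde_scale[OF a(1)])
  have "N y = \<bar>c\<bar> powr p * N (\<lambda>x. smooth_abs s (u x))"
    unfolding y_def by (rule N_scale[OF tilde_imp_W1p[OF a(1)]])
  also have "\<dots> \<le> \<bar>c\<bar> powr p * N u" by (intro mult_left_mono a(2)) simp
  also have "\<bar>c\<bar> powr p = (1 - 2 * s) powr (- p)"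
    using c s by (simp add: c_def powr_minus inverse_powr)
  finally have Ny: "N y \<le> (1 - 2 * s) powr (- p) * N u" .
  have yzt: "(\<lambda>x. y x + z x) \<in> W1p_tilde p \<Omega>" by (rule tilde_add[OF yt zt])
  have "N (\<lambda>x. y x + z x) \<le> (1 - s) powr (- p) * N y + s powr (- p) * N z"
    using N_add_le[OF tilde_imp_W1p[OF yt] tilde_imp_W1p[OF zt], of "1 - s"] s by simp
  also have "\<dots> \<le> (1 - s) powr (- p) * ((1 - 2 * s) powr (- p) * N u) + s powr (- p) * (4 powr p * (2 * h))"
    by (intro add_mono mult_left_mono Ny Nz powr_ge_zero)
  also have "s powr (- p) * (4 powr p * (2 * h)) = 4 powr p * 2 * s"
    using s by (simp add: h_def powr_minus field_simps)
  finally have Nyz: "N (\<lambda>x. y x + z x) \<le> (1 - s) powr (- p) * ((1 - 2 * s) powr (- p) * N u) + 4 powr p * 2 * s" .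
  define Q where "Q = (V \<union> {x \<in> closure \<Omega> - V. ut x \<in> {1 - s<..}}) \<union> V2"
  have Q: "openin (top_of_set (closure \<Omega>)) Q"
    unfolding Q_def by (intro openin_Un V2(1) openin_union_preimage[OF V(1,3)]) simp
  have AQ: "A \<subseteq> Q"
  proof
    fix x assume x: "x \<in> A"
    show "x \<in> Q"
    proof (cases "x \<in> P")
      case True
      then show ?thesis using V2(2) by (auto simp: Q_def)
    next
      case False
      then have "ut x \<ge> 1" using ge x by blast
      then show ?thesis using x A s by (auto simp: Q_def)
    qed
  qed
  have z0: "0 \<le> z1 x" "0 \<le> z2 x" "0 \<le> y x" for x
    using smooth_abs_nonneg[of "3/4"] smooth_abs_nonneg[OF s(1)] c by (auto simp: z1_def z2_def y_def)
  have "AE x in lebesgue. x \<in> \<Omega> \<longrightarrow> ut x = u x"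
    using ut unfolding qc_rep_def AE_M_iff by blast
  with V1(2) V2(3) have "AE x in lebesgue. x \<in> Q \<inter> \<Omega> \<longrightarrow> y x + z x \<ge> 1"
  proof eventually_elim
    case (elim x)
    show ?case
    proof
      assume x: "x \<in> Q \<inter> \<Omega>"
      consider "x \<in> V" | "x \<in> V2" | "ut x > 1 - s" using x by (auto simp: Q_def)
      then show "y x + z x \<ge> 1"
      proof cases
        case 1
        then have "w1 x \<ge> 1" using elim(1) V1(1) x by blast
        then have "z1 x \<ge> 1" unfolding z1_def by (intro smooth_abs_ge_half) simp
        then show ?thesis using z0[of x] by (simp add: z_def)
      next
        case 2
        then have "w2 x \<ge> 1" using elim(2) x by blast
        then have "z2 x \<ge> 1" unfolding z2_def by (intro smooth_abs_ge_half) simp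
        then show ?thesis using z0[of x] by (simp add: z_def)
      next
        case 3
        then have "u x > 1 - s" using elim(3) x by auto
        then have "1 - 2 * s \<le> smooth_abs s (u x)" using smooth_abs_ge[of "u x" s] by linarith
        then have "c * (1 - 2 * s) \<le> y x" unfolding y_def using c by (intro mult_left_mono) auto
        then have "1 \<le> y x" using s by (simp add: c_def)
        then show ?thesis using z0[of x] by (simp add: z_def)
      qed
    qed
  qed
  then have "(\<lambda>x. y x + z x) \<in> Yset p \<Omega> A" unfolding Yset_def using yzt Q AQ by blast
  then have "Cap p \<Omega> A \<le> ennreal (N (\<lambda>x. y x + z x))" by (rule Cap_le)
  also have "\<dots> \<le> ennreal ((1 - s) powr (- p) * ((1 - 2 * s) powr (- p) * N u) + 4 powr p * 2 * s)"
    by (rule ennreal_leI[OF Nyz])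
  finally show ?thesis .
qed

lemma Cap_le_norm_of_qc:
  assumes u: "u \<in> W1p_tilde p \<Omega>" and ut: "qc_rep p \<Omega> u ut" and P: "Cap p \<Omega> P = 0"
    and ge: "\<And>x. x \<in> A - P \<Longrightarrow> ut x \<ge> 1" and A: "A \<subseteq> closure \<Omega>"
  shows "Cap p \<Omega> A \<le> ennreal (N u)"
proof -
  \<comment> \<open>The offset 2 starts the sequence at 1/3, below the required bound 1/2.\<close>
  define s where "s n = inverse (real (Suc (n + 2)))" for n
  have s0: "s \<longlonglongrightarrow> 0"
    unfolding s_def by (rule LIMSEQ_ignore_initial_segment[OF LIMSEQ_inverse_real_of_nat])
  have s: "0 < s n" "s n < 1/2" for n by (auto simp: s_def field_simps)
  define a where "a n = (1 - s n) powr (- p) * ((1 - 2 * s n) powr (- p) * N u) + 4 powr p * 2 * s n" for n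
  have "a \<longlonglongrightarrow> (1 - 0) powr (- p) * ((1 - 2 * 0) powr (- p) * N u) + 4 powr p * 2 * 0"
    unfolding a_def by (intro tendsto_intros s0) auto
  then have "a \<longlonglongrightarrow> N u" by simp
  then have "(\<lambda>n. ennreal (a n)) \<longlonglongrightarrow> ennreal (N u)" by (rule tendsto_ennrealI)
  moreover have "Cap p \<Omega> A \<le> ennreal (a n)" for n
    unfolding a_def by (rule Cap_le_of_qc[OF u ut P ge A s])
  ultimately show ?thesis by (intro LIMSEQ_le_const) auto
qed

end

section \<open>Existence of quasi continuous representatives\<close>

text \<open>From index \<open>m\<close> on the telescoping series converges uniformly by the M-test.
  The limit function is written without reference to \<open>m\<close>, so that one function serves
  the sets belonging to all \<open>m\<close>.\<close>

lemma continuous_on_lim_of_increments: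
  fixes v :: "nat \<Rightarrow> 'a::topological_space \<Rightarrow> real"
  assumes c: "\<And>n. continuous_on S (v n)"
    and b: "\<And>n x. x \<in> S \<Longrightarrow> m \<le> n \<Longrightarrow> \<bar>v (Suc n) x - v n x\<bar> \<le> (1/2) ^ n"
  shows "continuous_on S (\<lambda>x. lim (\<lambda>n. v n x))"
proof -
  let ?f = "\<lambda>i x. v (Suc (i + m)) x - v (i + m) x"
  have tel: "(\<Sum>i<n. ?f i x) = v (n + m) x - v m x" for n x
    by (induction n) auto
  have "summable (\<lambda>i. (1/2::real) ^ (i + m))"
    by (rule summable_ignore_initial_segment) (simp add: summable_geometric)
  then have u: "uniform_limit S (\<lambda>n x. \<Sum>i<n. ?f i x) (\<lambda>x. \<Sum>i. ?f i x) sequentially"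
    by (rule Weierstrass_m_test[rotated]) (use b in simp)
  have "continuous_on S (\<lambda>x. \<Sum>i. ?f i x)"
    by (rule uniform_limit_theorem[OF _ u])
       (auto intro!: always_eventually continuous_on_sum continuous_on_diff c)
  then have cont: "continuous_on S (\<lambda>x. v m x + (\<Sum>i. ?f i x))" by (intro continuous_on_add c)
  have "lim (\<lambda>n. v n x) = v m x + (\<Sum>i. ?f i x)" if "x \<in> S" for x
  proof -
    have "(\<lambda>n. v (n + m) x - v m x) \<longlonglongrightarrow> (\<Sum>i. ?f i x)"
      using tendsto_uniform_limitI[OF u that] unfolding tel .
    from tendsto_add[OF tendsto_const[of "v m x"] this]
    have "(\<lambda>n. v (n + m) x) \<longlonglongrightarrow> v m x + (\<Sum>i. ?f i x)" by simp
    then have "(\<lambda>n. v n x) \<longlonglongrightarrow> v m x + (\<Sum>i. ?f i x)" by (rule LIMSEQ_offset)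
    then show ?thesis by (rule limI)
  qed
  then show ?thesis using cont by (subst continuous_on_cong[OF refl])
qed

context sobolev_domain begin

text \<open>The approximants \<open>f n\<close> extend continuously to
  \<open>closure \<Omega>\<close> as \<open>v n\<close>, so the set \<open>V n\<close> where
  consecutive extensions differ by more than \<open>(1/2) ^ n\<close> is relatively open. If
  \<open>f n\<close> tends to \<open>u\<close> fast enough, the union \<open>W m\<close> of these
  sets from \<open>m\<close> on has small capacity, and off \<open>W m\<close> the
  \<open>v n\<close> converge uniformly.\<close>

lemma qc_rep_exists:
  assumes u: "u \<in> W1p_tilde p \<Omega>"
  shows "\<exists>ut. qc_rep p \<Omega> u ut"
proof -
  define c :: "nat \<Rightarrow> real" where "c n = (1/2) ^ Suc n" for n
  have c: "c n > 0" for n by (simp add: c_def)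
  \<comment> \<open>\<open>\<delta> n\<close> is chosen such that the functions \<open>w n\<close> below meet the smallness condition of
    \<open>tilde_suminf\<close> even after discarding the first \<open>m\<close> terms, with total norm \<open>2 * (1/2) ^ m\<close>.\<close>
  define K where "K n = 2 powr p * ((2 ^ n) powr p * (2 powr p * 2))" for n
  have K1: "K n \<ge> 1" for n
  proof -
    have 1: "1 \<le> 2 powr p" "1 \<le> (2 ^ n) powr p"
      using p_nonneg by (auto intro!: ge_one_powr_ge_zero)
    then have "1 \<le> (2 ^ n) powr p * (2 powr p * 2)"
      by (smt (verit) mult_le_cancel_left1 mult_le_cancel_right1)
    with 1(1) show ?thesis unfolding K_def by (smt (verit) mult_le_cancel_left1)
  qed
  define \<delta> where "\<delta> n = (1/2) ^ n * (c n * c n powr p) / K n" for n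
  have \<delta>0: "\<delta> n > 0" for n using c[of n] K1[of n] by (simp add: \<delta>_def)
  have \<delta>K: "K n * \<delta> n = (1/2) ^ n * (c n * c n powr p)" for n using K1[of n] by (simp add: \<delta>_def)
  have \<delta>c: "\<delta> n \<le> c n * c n powr p" for n
  proof -
    have "\<delta> n \<le> (1/2) ^ n * (c n * c n powr p)"
      using K1[of n] \<delta>0[of n] unfolding \<delta>K[symmetric] by (simp add: mult_le_cancel_right1)
    also have "\<dots> \<le> 1 * (c n * c n powr p)"
      using c[of n] by (intro mult_right_mono) (auto simp: power_le_one)
    finally show ?thesis by simp
  qed
  \<comment> \<open>\<open>f n\<close> also enters the increment \<open>d (n - 1)\<close>, hence the
    second bound; at \<open>n = 0\<close> the index \<open>n - 1\<close> is 0 and both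
    coincide.\<close>
  have "\<exists>f. f \<in> Cc_W1p p \<Omega> \<and> N (\<lambda>x. f x - u x) < min (\<delta> n) (\<delta> (n - 1))" for n
    using tilde_approx[OF u, of "min (\<delta> n) (\<delta> (n - 1))"] \<delta>0 by (metis min_less_iff_conj)
  then obtain f where f: "\<And>n. f n \<in> Cc_W1p p \<Omega>" and fN: "\<And>n. N (\<lambda>x. f n x - u x) < min (\<delta> n) (\<delta> (n - 1))"
    by metis
  have "\<exists>v. continuous_on (closure \<Omega>) v \<and> (\<forall>x\<in>\<Omega>. f n x = v x)" for n
    using CcE[OF f[of n]] by metis
  then obtain v where v: "\<And>n. continuous_on (closure \<Omega>) (v n)" "\<And>n x. x \<in> \<Omega> \<Longrightarrow> f n x = v n x"
    by metis
  have uW: "u \<in> W1p p \<Omega>" by (rule tilde_imp_W1p[OF u])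
  have fW: "f n \<in> W1p p \<Omega>" for n by (rule Cc_imp_W1p[OF f])
  have ft: "f n \<in> W1p_tilde p \<Omega>" for n by (rule Cc_imp_tilde[OF f])
  define d where "d n x = f (Suc n) x + (-1) * f n x" for n x
  have dt: "d n \<in> W1p_tilde p \<Omega>" for n
    unfolding d_def by (rule tilde_add[OF ft tilde_scale[OF ft]])
  have dN: "N (d n) \<le> 2 powr p * 2 * \<delta> n" for n
  proof -
    have "N (d n) \<le> 2 powr p * (N (\<lambda>x. f (Suc n) x - u x) + N (\<lambda>x. u x - f n x))"
      using N_diff_triangle[OF fW uW fW, of "Suc n" n] by (simp add: d_def[abs_def])
    also have "N (\<lambda>x. u x - f n x) = N (\<lambda>x. f n x - u x)" by (rule N_minus_commute[OF uW fW])
    also have "2 powr p * (N (\<lambda>x. f (Suc n) x - u x) + N (\<lambda>x. f n x - u x)) \<le> 2 powr p * (\<delta> n + \<delta> n)"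
      using fN[of "Suc n"] fN[of n] by (intro mult_left_mono add_mono) auto
    finally show ?thesis by simp
  qed
  \<comment> \<open>The scaling by \<open>2 ^ n\<close> lifts an increment larger than
    \<open>(1/2) ^ n\<close> above 1, so that \<open>smooth_abs_ge_half\<close> makes
    \<open>w n\<close> admissible for \<open>V n\<close>.\<close>
  define w where "w n x = 2 * smooth_abs (3/4) (2 ^ n * d n x)" for n x
  have wt: "w n \<in> W1p_tilde p \<Omega>" for n
    unfolding w_def by (rule nonneg_majorant(1)[OF tilde_scale[OF dt]])
  have wN: "N (w n) \<le> (1/2) ^ n * (c n * c n powr p)" for n
  proof -
    have "N (w n) \<le> 2 powr p * N (\<lambda>x. 2 ^ n * d n x)"
      unfolding w_def by (rule nonneg_majorant(2)[OF tilde_scale[OF dt]])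
    also have "N (\<lambda>x. 2 ^ n * d n x) = \<bar>2 ^ n\<bar> powr p * N (d n)"
      by (rule N_scale[OF tilde_imp_W1p[OF dt]])
    also have "2 powr p * (\<bar>2 ^ n\<bar> powr p * N (d n)) \<le> 2 powr p * (\<bar>2 ^ n\<bar> powr p * (2 powr p * 2 * \<delta> n))"
      by (intro mult_left_mono dN powr_ge_zero)
    \<comment> \<open>\<open>K n\<close> collects the losses: \<open>2 powr p\<close> from the
      majorant, \<open>(2 ^ n) powr p\<close> from the scaling, and \<open>2 powr p * 2\<close> from
      the triangle inequality for \<open>d n\<close>.\<close>
    also have "\<dots> = K n * \<delta> n" by (simp add: K_def)
    finally show ?thesis by (simp add: \<delta>K)
  qed
  have w0: "0 \<le> w n x" for n x using smooth_abs_nonneg[of "3/4"] by (simp add: w_def)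
  define V where "V n = {x \<in> closure \<Omega>. \<bar>v (Suc n) x - v n x\<bar> > (1/2) ^ n}" for n
  have Vo: "openin (top_of_set (closure \<Omega>)) (V n)" for n
  proof -
    have "continuous_on (closure \<Omega>) (\<lambda>x. \<bar>v (Suc n) x - v n x\<bar>)"
      by (intro continuous_on_rabs continuous_on_diff v(1))
    from continuous_openin_preimage_gen[OF this open_greaterThan[of "(1/2) ^ n"]]
    show ?thesis by (simp add: V_def vimage_def Int_def)
  qed
  have wV: "1 \<le> w n x" if "x \<in> V n" "x \<in> \<Omega>" for n x
  proof -
    have "(1/2) ^ n < \<bar>d n x\<bar>" using that v(2)[of x] by (simp add: V_def d_def)
    then have "2 ^ n * (1/2) ^ n \<le> 2 ^ n * \<bar>d n x\<bar>" by (intro mult_left_mono) auto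
    then have "1 \<le> \<bar>2 ^ n * d n x\<bar>" by (simp add: abs_mult power_divide)
    then show ?thesis unfolding w_def by (rule smooth_abs_ge_half)
  qed
  define W where "W m = (\<Union>n\<in>{m..}. V n)" for m
  have Wo: "openin (top_of_set (closure \<Omega>)) (W m)" for m
    unfolding W_def by (intro openin_Union) (auto simp: Vo)
  have WC: "Cap p \<Omega> (W m) \<le> ennreal (2 * (1/2) ^ m)" for m
  proof -
    have small: "N (w (n + m)) \<le> (1/2) ^ m * ((1/2) ^ Suc n * ((1/2) ^ Suc n) powr p)" for n
    proof -
      have "N (w (n + m)) \<le> (1/2) ^ (n + m) * (c (n + m) * c (n + m) powr p)" by (rule wN)
      also have "\<dots> \<le> (1/2) ^ m * (c n * c n powr p)"
      proof (intro mult_mono powr_mono2)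
        show "c (n + m) \<le> c n" unfolding c_def by (rule power_decreasing) auto
        then show "c (n + m) \<le> c n" .
        show "(1/2::real) ^ (n + m) \<le> (1/2) ^ m" by (rule power_decreasing) auto
      qed (use c p_nonneg in \<open>auto simp: less_imp_le\<close>)
      finally show ?thesis by (simp add: c_def)
    qed
    note z = tilde_suminf[of "\<lambda>n. w (n + m)", OF wt small]
    have "AE x in lebesgue. x \<in> \<Omega> \<longrightarrow> summable (\<lambda>n. w (n + m) x)"
      using z(1) unfolding AE_M_iff .
    then have "AE x in lebesgue. x \<in> W m \<inter> \<Omega> \<longrightarrow> 1 \<le> (\<Sum>n. w (n + m) x)"
    proof eventually_elim
      case (elim x)
      show ?case
      proof
        assume x: "x \<in> W m \<inter> \<Omega>"
        then obtain n where n: "m \<le> n" "x \<in> V n" by (auto simp: W_def)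
        have s: "summable (\<lambda>n. w (n + m) x)" using elim x by blast
        have "1 \<le> w (n - m + m) x" using wV[OF n(2)] x n(1) by simp
        also have "\<dots> \<le> (\<Sum>n. w (n + m) x)"
          using sum_le_suminf[OF s, of "{n - m}"] w0 by simp
        finally show "1 \<le> (\<Sum>n. w (n + m) x)" .
      qed
    qed
    then have "(\<lambda>x. \<Sum>n. w (n + m) x) \<in> Yset p \<Omega> (W m)"
      unfolding Yset_def using z(2) Wo by blast
    then have "Cap p \<Omega> (W m) \<le> ennreal (N (\<lambda>x. \<Sum>n. w (n + m) x))" by (rule Cap_le)
    also have "\<dots> \<le> ennreal (2 * (1/2) ^ m)" by (rule ennreal_leI[OF z(3)])
    finally show ?thesis .
  qed
  \<comment> \<open>The limit can fail to exist only at points of \<open>closure \<Omega>\<close>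
    lying in every \<open>W m\<close>; there \<open>lim\<close> has an unspecified value.\<close>
  define ut where "ut x = lim (\<lambda>n. v n x)" for x
  have cont: "continuous_on (closure \<Omega> - W m) ut" for m
    unfolding ut_def
  proof (rule continuous_on_lim_of_increments[where m = m])
    show "continuous_on (closure \<Omega> - W m) (v n)" for n by (rule continuous_on_subset[OF v(1)]) auto
    show "\<bar>v (Suc n) x - v n x\<bar> \<le> (1/2) ^ n" if "x \<in> closure \<Omega> - W m" "m \<le> n" for n x
      using that by (force simp: W_def V_def)
  qed
  have qc: "quasi_continuous p \<Omega> (closure \<Omega>) ut"
    unfolding quasi_continuous_def
  proof (intro allI impI)
    fix e :: real assume "e > 0"
    have "(\<lambda>m. 2 * (1/2::real) ^ m) \<longlonglongrightarrow> 0"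
      by (intro tendsto_mult_right_zero LIMSEQ_power_zero) simp
    then have "eventually (\<lambda>m. 2 * (1/2::real) ^ m < e) sequentially" using \<open>e > 0\<close> by (rule order_tendstoD)
    then obtain m where m: "2 * (1/2::real) ^ m < e" by (auto simp: eventually_sequentially)
    have "Cap p \<Omega> (W m) < ennreal e"
      by (rule le_less_trans[OF WC]) (use m in \<open>simp add: ennreal_less_iff\<close>)
    then show "\<exists>V. openin (top_of_set (closure \<Omega>)) V \<and> Cap p \<Omega> V < ennreal e \<and> continuous_on (closure \<Omega> - V) ut"
      using Wo cont by blast
  qed
  \<comment> \<open>Summability of \<open>f n x - u x\<close> forces its terms to 0, so the full
    sequence \<open>f n\<close> tends to \<open>u\<close> almost everywhere and \<open>ut\<close>
    agrees with \<open>u\<close>.\<close>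
  have small': "N (\<lambda>x. f n x + (-1) * u x) \<le> 1 * ((1/2) ^ Suc n * ((1/2) ^ Suc n) powr p)" for n
    using fN[of n] \<delta>c[of n] by (simp add: c_def)
  have "AE x in M. summable (\<lambda>n. f n x + (-1) * u x)"
    by (rule tilde_suminf(1)[OF tilde_add[OF ft tilde_scale[OF u]] small'])
  then have "AE x in lebesgue. x \<in> \<Omega> \<longrightarrow> ut x = u x"
    unfolding AE_M_iff
  proof eventually_elim
    case (elim x)
    show ?case
    proof
      assume x: "x \<in> \<Omega>"
      then have "(\<lambda>n. f n x - u x) \<longlonglongrightarrow> 0" using summable_LIMSEQ_zero elim by fastforce
      then have "(\<lambda>n. f n x) \<longlonglongrightarrow> u x" by (simp add: LIM_zero_iff)
      then have "(\<lambda>n. v n x) \<longlonglongrightarrow> u x" using v(2)[OF x] by simp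
      then show "ut x = u x" unfolding ut_def by (rule limI)
    qed
  qed
  then have "AE x in M. ut x = u x" unfolding AE_M_iff .
  with qc show ?thesis unfolding qc_rep_def by blast
qed

end

section \<open>The characterization of the capacity\<close>

theorem mainTheorem15:
  fixes \<Omega> :: "'a::euclidean_space set" and p :: real and A :: "'a set"
  assumes "open \<Omega>" and "\<Omega> \<noteq> {}" and "1 < p" and "A \<subseteq> closure \<Omega>"
  shows "Cap p \<Omega> A =
    (INF u\<in>{u \<in> W1p_tilde p \<Omega>. \<exists>ut. qc_rep p \<Omega> u ut \<and>
              (\<exists>P. P \<subseteq> closure \<Omega> \<and> Cap p \<Omega> P = 0 \<and> (\<forall>x\<in>A - P. ut x \<ge> 1))}.
       ennreal (W1p_norm_p p \<Omega> u))"
proof -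
  interpret sobolev_domain \<Omega> p using assms(1,3) by unfold_locales
  let ?S = "{u \<in> W1p_tilde p \<Omega>. \<exists>ut. qc_rep p \<Omega> u ut \<and>
              (\<exists>P. P \<subseteq> closure \<Omega> \<and> Cap p \<Omega> P = 0 \<and> (\<forall>x\<in>A - P. ut x \<ge> 1))}"
  \<comment> \<open>Admissible functions form a subset of the competitors on the right, so one
    inequality is monotonicity of the infimum; the exceptional set is the part of \<open>U\<close>
    where \<open>ut\<close> falls below 1.\<close>
  have sub: "u \<in> ?S" if u: "u \<in> Yset p \<Omega> A" for u
  proof -
    obtain U where U: "openin (top_of_set (closure \<Omega>)) U" "A \<subseteq> U"
      "AE x in lebesgue. x \<in> U \<inter> \<Omega> \<longrightarrow> u x \<ge> 1" and ut: "u \<in> W1p_tilde p \<Omega>"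
      using u unfolding Yset_def by blast
    obtain ut where rep: "qc_rep p \<Omega> u ut" using qc_rep_exists[OF ut] by blast
    let ?P = "{x \<in> U. ut x < 1}"
    have "Cap p \<Omega> ?P = 0" by (rule Cap_zero_of_AE_ge[OF rep U(1,3)])
    moreover have "?P \<subseteq> closure \<Omega>" using openin_imp_subset[OF U(1)] by blast
    moreover have "\<forall>x\<in>A - ?P. ut x \<ge> 1" using U(2) by force
    ultimately show ?thesis using ut rep by blast
  qed
  show ?thesis
  proof (rule antisym)
    show "Cap p \<Omega> A \<le> (INF u\<in>?S. ennreal (N u))"
    proof (rule INF_greatest)
      fix u assume "u \<in> ?S"
      then obtain ut P where "u \<in> W1p_tilde p \<Omega>" "qc_rep p \<Omega> u ut" "Cap p \<Omega> P = 0" "\<And>x. x \<in> A - P \<Longrightarrow> ut x \<ge> 1"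
        by blast
      then show "Cap p \<Omega> A \<le> ennreal (N u)" by (rule Cap_le_norm_of_qc[OF _ _ _ _ assms(4)])
    qed
    show "(INF u\<in>?S. ennreal (N u)) \<le> Cap p \<Omega> A"
      unfolding Cap_def[of p \<Omega> A] by (rule INF_superset_mono[OF subsetI[OF sub]]) simp_all
  qed
qed

end
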